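(* Let $T:\mathbb R\to\mathbb R\cup\{-\infty\}$ be a non-decreasing concave function satisfying: (i) there exist $\alpha>0$ and $c\in[0,1]$ with $T(q)\ge\alpha q-c$ for all $q\ge0$; (ii) $\mathrm{dom}(T)$ equals $\mathbb R$ or $\mathbb R_+$, and $T^*$ is non-negative on its domain; (iii) setting $q_0=\inf\{q\ge0:T(q)>0\}$, either $q_0>0$, or $T'(0^+)>0$ and $T(q)=T'(0^+)q$ for all $q>0$. Then there exists a homogeneously multifractal Hölder continuous function $F$ with $\mathrm{supp}(F)\subset[0,1]$ which satisfies the multifractal formalism (i.e. $\dim_H\underline E(F,h)=T_F^*(h)$ for all $h\in\mathbb R_+\cup\{\infty\}$) with $T_F=T$.
   Context: Work on $\mathbb R$. Fix an orthonormal wavelet basis $\{\psi_I\}$ indexed by dyadic intervals, with mother wavelet in the Schwartz class and the $\psi_I$ normalized to have equal supremum norm. For a bounded Hölder continuous $F:\mathbb R\to\mathbb R$ with wavelet coefficients $\{\lambda_I\}$, let $L_I=\sup|\lambda_{I'}|$ over dyadic $I'$ contained in $I$ or in one of the two neighboring dyadic intervals of the same generation as $I$. $I_n(x)$: closure of the dyadic interval $[k2^{-n},(k+1)2^{-n})$ containing $x$. $\mathrm{supp}(F)=\{x\in[0,1]:L_{I_n(x)}>0\ \forall n\ge1\}$. Pointwise Hölder exponent $h_F(x_0)=\sup\{h\ge0:\exists P\in\mathbb R[X],\ |F(x)-P(x-x_0)|=O(|x-x_0|^h)\}$; $\underline E(F,h)=\{x\in\mathrm{supp}(F):h_F(x)=h\}$;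 $\dim_H\emptyset=-\infty$. $G^*_n$ is the set of dyadic subintervals $I\subset[0,1]$ of length $2^{-n}$ with $L_I>0$, and $T_F(q)=\liminf_{n\to\infty}\frac{-1}{n}\log_2\sum_{I\in G^*_n}L_I^q$. $F$ is homogeneously multifractal if for every $h$, $\dim_H(\underline E(F,h)\cap B)$ does not depend on the ball $B$ whose interior intersects $\mathrm{supp}(F)$. $\mathrm{dom}(T)=\{q:T(q)>-\infty\}$. Extended Legendre transform for $T$ with $0\in\mathrm{dom}(T)$: $T^*(h)=\inf\{hq-T(q):q\in\mathrm{dom}(T)\}$ for $h\in\mathbb R$ and $T^*(\infty)=\inf\{\infty\cdot q-T(q):q\in\mathrm{dom}(T)\cap\mathbb R_-\}$, where $\infty\cdot q=-\infty$ for $q<0$ and $\infty\cdot0=0$. $T'(0^+)$ is the right derivative at $0$. *)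

theory Defs
  imports "HOL-Analysis.Analysis"
begin

definition schwartz :: "(real \<Rightarrow> real) \<Rightarrow> bool" where
  "schwartz \<psi> \<longleftrightarrow>
     (\<forall>n::nat. \<forall>x. ((deriv ^^ n) \<psi>) differentiable (at x)) \<and>
     (\<forall>m n::nat. \<exists>C. \<forall>x. \<bar>x ^ m * (deriv ^^ n) \<psi> x\<bar> \<le> C)"

text \<open>L2-normalised wavelets indexed by the dyadic interval [k 2^-j, (k+1) 2^-j).\<close>
definition wav2 :: "(real \<Rightarrow> real) \<Rightarrow> int \<Rightarrow> int \<Rightarrow> real \<Rightarrow> real" where
  "wav2 \<psi> j k x = 2 powr (real_of_int j / 2) * \<psi> (2 powr real_of_int j * x - real_of_int k)"

definition orthonormal_wavelet :: "(real \<Rightarrow> real) \<Rightarrow> bool" where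
  "orthonormal_wavelet \<psi> \<longleftrightarrow>
     \<psi> \<in> borel_measurable lborel \<and>
     (\<forall>j k. integrable lborel (\<lambda>x. (wav2 \<psi> j k x)\<^sup>2)) \<and>
     (\<forall>j k j' k'. (LINT x|lborel. wav2 \<psi> j k x * wav2 \<psi> j' k' x)
                   = (if j = j' \<and> k = k' then 1 else 0)) \<and>
     (\<forall>f. f \<in> borel_measurable lborel \<and> integrable lborel (\<lambda>x. (f x)\<^sup>2) \<and>
          (\<forall>j k. (LINT x|lborel. f x * wav2 \<psi> j k x) = 0)
          \<longrightarrow> (AE x in lborel. f x = 0))"

text \<open>Wavelet coefficients, with the L-infinity normalisation psi_I(x) = psi(2^j x - k).\<close>
definition wcoeff :: "(real \<Rightarrow> real) \<Rightarrow> (real \<Rightarrow> real) \<Rightarrow> int \<Rightarrow> int \<Rightarrow> real" where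
  "wcoeff \<psi> F j k = 2 powr real_of_int j *
      (LINT x|lborel. F x * \<psi> (2 powr real_of_int j * x - real_of_int k))"

text \<open>Wavelet leader L_I of I = [k 2^-j,(k+1) 2^-j): sup over dyadic I' contained in
  I or in one of its two neighbours of the same generation.\<close>
definition wleader :: "(real \<Rightarrow> real) \<Rightarrow> (real \<Rightarrow> real) \<Rightarrow> int \<Rightarrow> int \<Rightarrow> real" where
  "wleader \<psi> F j k = Sup {\<bar>wcoeff \<psi> F j' k'\<bar> | j' k'.
      j \<le> j' \<and> k' div 2 ^ nat (j' - j) \<in> {k - 1, k, k + 1}}"

definition wsupp :: "(real \<Rightarrow> real) \<Rightarrow> (real \<Rightarrow> real) \<Rightarrow> real set" where
  "wsupp \<psi> F = {x \<in> {0..1}. \<forall>n::nat. n \<ge> 1 \<longrightarrow>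
      wleader \<psi> F (int n) \<lfloor>2 ^ n * x\<rfloor> > 0}"

definition Gstar :: "(real \<Rightarrow> real) \<Rightarrow> (real \<Rightarrow> real) \<Rightarrow> nat \<Rightarrow> int set" where
  "Gstar \<psi> F n = {k \<in> {0..<2 ^ n}. wleader \<psi> F (int n) k > 0}"

definition scaling_fun :: "(real \<Rightarrow> real) \<Rightarrow> (real \<Rightarrow> real) \<Rightarrow> real \<Rightarrow> ereal" where
  "scaling_fun \<psi> F q = liminf (\<lambda>n::nat.
      let S = (\<Sum>k\<in>Gstar \<psi> F n. wleader \<psi> F (int n) k powr q) in
      if S = 0 then \<infinity> else ereal (- (1 / real n) * log 2 S))"

definition hoelder_continuous :: "(real \<Rightarrow> real) \<Rightarrow> bool" where
  "hoelder_continuous F \<longleftrightarrow> (\<exists>\<alpha>>0. \<exists>C. \<forall>x y. \<bar>F x - F y\<bar> \<le> C * \<bar>x - y\<bar> powr \<alpha>)"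

definition hoelder_exp :: "(real \<Rightarrow> real) \<Rightarrow> real \<Rightarrow> ereal" where
  "hoelder_exp F x0 = Sup (ereal ` {h. h \<ge> 0 \<and> (\<exists>P :: real poly. \<exists>C \<delta>. \<delta> > 0 \<and>
      (\<forall>x. \<bar>x - x0\<bar> < \<delta> \<longrightarrow> \<bar>F x - poly P (x - x0)\<bar> \<le> C * \<bar>x - x0\<bar> powr h))})"

definition iso_set :: "(real \<Rightarrow> real) \<Rightarrow> (real \<Rightarrow> real) \<Rightarrow> ereal \<Rightarrow> real set" where
  "iso_set \<psi> F h = {x \<in> wsupp \<psi> F. hoelder_exp F x = h}"

definition hausdorff_pre :: "real \<Rightarrow> real \<Rightarrow> real set \<Rightarrow> ennreal" where
  "hausdorff_pre s \<delta> E = Inf {(\<Sum>i. ennreal (diameter (U i) powr s)) | U :: nat \<Rightarrow> real set.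
      (\<forall>i. bounded (U i) \<and> diameter (U i) \<le> \<delta>) \<and> E \<subseteq> (\<Union>i. U i)}"

definition hausdorff_measure :: "real \<Rightarrow> real set \<Rightarrow> ennreal" where
  "hausdorff_measure s E = (SUP \<delta>\<in>{0<..}. hausdorff_pre s \<delta> E)"

text \<open>dim_H E = inf {s : H^s(E) = 0}; the infimum may be taken over s > 0; dim_H of the
  empty set is -infinity.\<close>
definition dimH :: "real set \<Rightarrow> ereal" where
  "dimH E = (if E = {} then -\<infinity> else Inf {ereal s | s. s > 0 \<and> hausdorff_measure s E = 0})"

definition edom :: "(real \<Rightarrow> ereal) \<Rightarrow> real set" where
  "edom T = {q. T q > -\<infinity>}"

definition legendre :: "(real \<Rightarrow> ereal) \<Rightarrow> ereal \<Rightarrow> ereal" where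
  "legendre T h = (if h = \<infinity>
      then Inf {(if q < 0 then -\<infinity> else 0) - T q | q. q \<in> edom T \<and> q \<le> 0}
      else Inf {ereal (real_of_ereal h * q) - T q | q. q \<in> edom T})"

definition homogeneously_multifractal :: "(real \<Rightarrow> real) \<Rightarrow> (real \<Rightarrow> real) \<Rightarrow> bool" where
  "homogeneously_multifractal \<psi> F \<longleftrightarrow>
     (\<forall>h x1 r1 x2 r2. r1 > 0 \<longrightarrow> r2 > 0 \<longrightarrow>
        ball x1 r1 \<inter> wsupp \<psi> F \<noteq> {} \<longrightarrow> ball x2 r2 \<inter> wsupp \<psi> F \<noteq> {} \<longrightarrow>
        dimH (iso_set \<psi> F h \<inter> ball x1 r1) = dimH (iso_set \<psi> F h \<inter> ball x2 r2))"

end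

theory Submission
  imports Defs "HOL-Probability.Sinc_Integral" "HOL-Real_Asymp.Real_Asymp"
begin

text \<open>
  The wavelet coefficients of F are the weights of an inhomogeneous multiplicative cascade. At stage i
  every node, a dyadic interval of generation n_i, gets children of generation n_i + l_i with l_i = o(n_i).
  For each point (h, d) of a grid of mesh 1/m_i just below the graph of the Legendre transform T*, about
  2^(l_i d) of the children carry the weight of their parent multiplied by 2^(- l_i h). The number of grid points is
  2^(o(l_i)), so the partition function of one stage is 2^(- l_i (T(q) + o(1))), because the infimum of
  h q - T*(h) over h is T(q).

  The nodes are separated and interior to their parents, hence the leader at a node is its own coefficient,
  supp(F) is the limit set of the nodes, and the Hoelder exponent at x in supp(F) is the lower limit of
  -(log2 of the coefficient of the stage i node containing x) / n_i. For the lower bound of the exponent the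
  Taylor polynomials of the blocks at x are summed up; the upper bound uses that all moments of the wavelet vanish.

  Covering by nodes gives dim E(h) \<le> T*(h), and emptiness of E(h) where T*(h) is negative. Conversely, following
  from some stage on only children of types converging to (h, T*(h)) yields a homogeneous Cantor set inside
  E(h) of dimension T*(h) in every ball that meets the support.
\<close>

section \<open>Schwartz wavelets\<close>

text \<open>One sequence of stage lengths has to serve all exponents at once. The lengths l_i must
  tend to infinity, so that the grid of types can be refined without limit, and must be o(n_i), so
  that consecutive generations have ratio tending to 1: then passing from stage i to stage i + 1
  never changes an exponent, and the lower limit over all generations that defines the scaling
  function can be read off at the stages. Linear l_i achieve both. With m the integer part of the
  square root of l, the number of types is polynomial in m, hence at most 2^m for large m, and m
  \<le> l / m = o(l). The Hoelder exponent is a lower limit, so for q \<ge> 0 the points of E(h) are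
  heavy at infinitely many stages, while for q < 0 they are light at all late stages; one covering
  argument with the partition function serves both signs. When T is finite only on the half line,
  the exponent \<infinity> and the values T(q) = -\<infinity> for q < 0 are produced together, by
  types whose exponent m grows with the stage.\<close>

lemma sum_int_inverse_square_bound:
  assumes "finite (A :: int set)"
  shows "(\<Sum>k\<in>A. 1 / (1 + \<bar>real_of_int k\<bar>)^2) \<le> 2 * (\<Sum>n. 1 / (1 + real n)^2)"
proof -
  define g where "g n = 1 / (1 + real n)^2" for n
  have sm: "summable g"
  proof -
    have "summable (\<lambda>n. 1 / real n ^ 2)"
      using inverse_power_summable[of 2] by (simp add: inverse_eq_divide)
    then have "summable (\<lambda>n. 1 / real (Suc n) ^ 2)"
      by (subst summable_Suc_iff)
    then show ?thesis unfolding g_def by (simp add: add.commute)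
  qed
  have half: "(\<Sum>k\<in>B. g (nat \<bar>k\<bar>)) \<le> suminf g" if "finite B" "inj_on (\<lambda>k. nat \<bar>k\<bar>) B" for B :: "int set"
  proof -
    have "(\<Sum>k\<in>B. g (nat \<bar>k\<bar>)) = sum g ((\<lambda>k. nat \<bar>k\<bar>) ` B)"
      using sum.reindex[OF that(2), of g] by simp
    also have "\<dots> \<le> suminf g"
      using that by (intro sum_le_suminf sm) (auto simp: g_def)
    finally show ?thesis .
  qed
  have eq: "A = (A \<inter> {0..}) \<union> (A \<inter> {..<0})" by auto
  have "(\<Sum>k\<in>A. 1 / (1 + \<bar>real_of_int k\<bar>)^2) = (\<Sum>k\<in>A. g (nat \<bar>k\<bar>))"
    by (intro sum.cong) (auto simp: g_def)
  also have "\<dots> = (\<Sum>k\<in>(A \<inter> {0..}) \<union> (A \<inter> {..<0}). g (nat \<bar>k\<bar>))"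
    using eq by (rule arg_cong)
  also have "(\<Sum>k\<in>(A \<inter> {0..}) \<union> (A \<inter> {..<0}). g (nat \<bar>k\<bar>)) =
     (\<Sum>k\<in>A \<inter> {0..}. g (nat \<bar>k\<bar>)) + (\<Sum>k\<in>A \<inter> {..<0}. g (nat \<bar>k\<bar>))"
    using assms by (intro sum.union_disjoint) auto
  also have "\<dots> \<le> suminf g + suminf g"
    using assms by (intro add_mono half) (auto simp: inj_on_def)
  finally show ?thesis unfolding g_def by simp
qed

text \<open>The bound is uniform in \<open>u\<close> because replacing \<open>u\<close> by its floor
  changes each term by at most a factor 4. It controls every sum of wavelets of one generation at a
  point.\<close>

lemma lattice_sum_bound:
  "\<exists>K>0. \<forall>(u::real) (A::int set). finite A \<longrightarrow> (\<Sum>p\<in>A. (1 + \<bar>u - real_of_int p\<bar>) powr (-2)) \<le> K"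
proof -
  define K where "K = 8 * (\<Sum>n. 1 / (1 + real n)^2) + 1"
  have K: "(\<Sum>p\<in>A. (1 + \<bar>u - real_of_int p\<bar>) powr (-2)) \<le> K" if "finite A" for u :: real and A :: "int set"
  proof -
    have "(\<Sum>p\<in>A. (1 + \<bar>u - real_of_int p\<bar>) powr (-2)) \<le> (\<Sum>p\<in>A. 4 * (1 / (1 + \<bar>real_of_int (p - \<lfloor>u\<rfloor>)\<bar>)^2))"
    proof (intro sum_mono)
      fix p
      have "1 + \<bar>real_of_int (p - \<lfloor>u\<rfloor>)\<bar> \<le> 2 * (1 + \<bar>u - real_of_int p\<bar>)"
        by (simp add: abs_if) linarith
      then have "(1 + \<bar>real_of_int (p - \<lfloor>u\<rfloor>)\<bar>)^2 \<le> (2 * (1 + \<bar>u - real_of_int p\<bar>))^2"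
        by (intro power_mono) auto
      then have *: "(1 + \<bar>real_of_int (p - \<lfloor>u\<rfloor>)\<bar>)^2 \<le> 4 * (1 + \<bar>u - real_of_int p\<bar>)^2"
        by (simp only: power_mult_distrib) simp
      have "(1 + \<bar>u - real_of_int p\<bar>) powr (-2) = 1 / (1 + \<bar>u - real_of_int p\<bar>)^2"
        by (simp add: powr_minus_divide powr_numeral)
      also have "\<dots> \<le> 4 * (1 / (1 + \<bar>real_of_int (p - \<lfloor>u\<rfloor>)\<bar>)^2)"
        using * by (simp add: field_simps add_pos_nonneg)
      finally show "(1 + \<bar>u - real_of_int p\<bar>) powr (-2) \<le> 4 * (1 / (1 + \<bar>real_of_int (p - \<lfloor>u\<rfloor>)\<bar>)^2)" .
    qed
    also have "\<dots> = 4 * (\<Sum>k\<in>(\<lambda>p. p - \<lfloor>u\<rfloor>) ` A. 1 / (1 + \<bar>real_of_int k\<bar>)^2)"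
      by (subst sum.reindex) (auto simp: inj_on_def sum_distrib_left)
    also have "\<dots> \<le> K"
      using sum_int_inverse_square_bound[of "(\<lambda>p. p - \<lfloor>u\<rfloor>) ` A"] that by (simp add: K_def)
    finally show ?thesis .
  qed
  have "K \<ge> 0" using K[of "{}" 0] by simp
  then have "K + 1 > 0" by simp
  moreover have "\<forall>(u::real) (A::int set). finite A \<longrightarrow> (\<Sum>p\<in>A. (1 + \<bar>u - real_of_int p\<bar>) powr (-2)) \<le> K + 1"
    using K by (smt (verit))
  ultimately show ?thesis by blast
qed

lemma integrable_inverse_square: "integrable lborel (\<lambda>x::real. (1 + \<bar>x\<bar>) powr (-2))"
proof (rule Bochner_Integration.integrable_bound)
  show "integrable lborel (\<lambda>x::real. inverse (1 + x^2))"
    using integrable_inverse_1_plus_square by (simp add: set_integrable_def)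
  have "(1 + \<bar>x\<bar>) powr (-2) \<le> inverse (1 + x^2)" for x :: real
  proof -
    have "1 + x^2 \<le> (1 + \<bar>x\<bar>)^2" by (simp add: power2_sum)
    then show ?thesis
      by (simp add: powr_minus powr_numeral le_imp_inverse_le add_pos_nonneg)
  qed
  then show "AE x in lborel. norm ((1 + \<bar>x :: real\<bar>) powr (-2)) \<le> norm (inverse (1 + x^2))"
    by (auto simp: add_nonneg_nonneg)
qed auto

lemma powr_min_interp:
  fixes t :: real
  assumes "0 \<le> t" "t \<le> 1" "b \<le> real n"
  shows "n > 0 \<Longrightarrow> t ^ n \<le> t powr b"
proof -
  assume "n > 0"
  then have "t ^ n = t powr (real n)" using assms by (simp add: powr_realpow')
  then show ?thesis using powr_mono'[of b "real n" t] assms by simp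
qed

locale schwartz_wavelet =
  fixes \<psi> :: "real \<Rightarrow> real"
  assumes sch: "schwartz \<psi>" and onw: "orthonormal_wavelet \<psi>"
begin

abbreviation D :: "nat \<Rightarrow> real \<Rightarrow> real" where "D l \<equiv> (deriv ^^ l) \<psi>"

lemma DERIV_D: "(D l has_real_derivative D (Suc l) x) (at x)"
proof -
  have "D l differentiable (at x)"
    using sch unfolding schwartz_def by blast
  then show ?thesis
    unfolding funpow.simps comp_apply DERIV_deriv_iff_real_differentiable .
qed

lemma continuous_D: "continuous_on A (D l)"
  by (rule DERIV_continuous_on[OF has_field_derivative_at_within[OF DERIV_D]])

lemma measurable_D [measurable]: "D l \<in> borel_measurable borel"
  by (intro borel_measurable_continuous_onI continuous_D)

lemma measurable_psi [measurable]: "\<psi> \<in> borel_measurable borel"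
  using measurable_D[of 0] by simp

lemma D_decay: "\<exists>C>0. \<forall>x. \<bar>D l x\<bar> \<le> C * (1 + \<bar>x\<bar>) powr (- M)"
proof -
  define m where "m = nat \<lceil>M\<rceil>"
  have m: "M \<le> real m" unfolding m_def by linarith
  obtain C0 where C0: "\<bar>x ^ 0 * D l x\<bar> \<le> C0" for x
    using sch unfolding schwartz_def by blast
  obtain Cm where Cm: "\<bar>x ^ m * D l x\<bar> \<le> Cm" for x
    using sch unfolding schwartz_def by blast
  define C where "C = 2 ^ m * (C0 + Cm) + 1"
  have pos: "C0 \<ge> 0" "Cm \<ge> 0" using C0[of 0] Cm[of 0] by auto
  have "\<bar>D l x\<bar> \<le> C * (1 + \<bar>x\<bar>) powr (- M)" for x
  proof -
    have "(1 + \<bar>x\<bar>) ^ m \<le> 2 ^ m * (1 + \<bar>x\<bar> ^ m)"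
    proof (cases "\<bar>x\<bar> \<le> 1")
      case True
      then have "(1 + \<bar>x\<bar>) ^ m \<le> 2 ^ m" by (intro power_mono) auto
      then show ?thesis by (smt (verit) mult_le_cancel_left1 zero_le_power abs_ge_zero)
    next
      case False
      then have "(1 + \<bar>x\<bar>) ^ m \<le> (2 * \<bar>x\<bar>) ^ m" by (intro power_mono) auto
      then show ?thesis by (simp add: power_mult_distrib algebra_simps) (smt (verit) zero_le_power)
    qed
    then have "(1 + \<bar>x\<bar>) ^ m * \<bar>D l x\<bar> \<le> 2 ^ m * (1 + \<bar>x\<bar> ^ m) * \<bar>D l x\<bar>"
      by (intro mult_right_mono) auto
    also have "\<dots> = 2 ^ m * (\<bar>D l x\<bar> + \<bar>x ^ m * D l x\<bar>)"
      by (simp add: abs_mult power_abs algebra_simps)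
    also have "\<dots> \<le> 2 ^ m * (C0 + Cm)"
      using C0[of x] Cm[of x] by (intro mult_left_mono) auto
    also have "\<dots> \<le> C" by (simp add: C_def)
    finally have "(1 + \<bar>x\<bar>) ^ m * \<bar>D l x\<bar> \<le> C" .
    then have "\<bar>D l x\<bar> \<le> C * (1 + \<bar>x\<bar>) powr (- real m)"
      by (simp add: powr_minus powr_realpow field_simps add_pos_nonneg)
    also have "\<dots> \<le> C * (1 + \<bar>x\<bar>) powr (- M)"
      using m pos by (intro mult_left_mono powr_mono) (auto simp: C_def)
    finally show ?thesis .
  qed
  moreover have "C > 0" using pos by (simp add: C_def add_nonneg_pos)
  ultimately show ?thesis by blast
qed

lemma psi_decay: "\<exists>C>0. \<forall>x. \<bar>\<psi> x\<bar> \<le> C * (1 + \<bar>x\<bar>) powr (- M)"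
  using D_decay[of 0 M] by simp

lemma D_bounded: "\<exists>C>0. \<forall>x. \<bar>D l x\<bar> \<le> C"
proof -
  obtain C where "C > 0" "\<And>x. \<bar>D l x\<bar> \<le> C * (1 + \<bar>x\<bar>) powr (- 0)"
    using D_decay[of l 0] by blast
  moreover have "(1 + \<bar>x\<bar>) powr (- 0) = 1" for x :: real by (simp add: add_nonneg_eq_0_iff)
  ultimately have "\<bar>D l x\<bar> \<le> C" for x by (metis mult.right_neutral)
  with \<open>C > 0\<close> show ?thesis by blast
qed

text \<open>Rapid decay of \<psi> beats polynomial growth of any order; two spare powers make the
  product integrable.\<close>

lemma integrable_decay_psi:
  fixes g :: "real \<Rightarrow> real"
  assumes [measurable]: "g \<in> borel_measurable borel" and b: "\<And>x. \<bar>g x\<bar> \<le> B * (1 + \<bar>x\<bar>) powr M"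
  shows "integrable lborel (\<lambda>x. g x * \<psi> x)"
proof -
  obtain C where C: "C > 0" "\<And>x. \<bar>\<psi> x\<bar> \<le> C * (1 + \<bar>x\<bar>) powr (- (M + 2))"
    using psi_decay[of "M + 2"] by blast
  show ?thesis
  proof (rule Bochner_Integration.integrable_bound)
    show "integrable lborel (\<lambda>x::real. B * C * (1 + \<bar>x\<bar>) powr (-2))"
      using integrable_inverse_square by (intro integrable_mult_right)
    have "\<bar>g x * \<psi> x\<bar> \<le> B * C * (1 + \<bar>x\<bar>) powr (-2)" for x
    proof -
      have "\<bar>g x * \<psi> x\<bar> \<le> (B * (1 + \<bar>x\<bar>) powr M) * (C * (1 + \<bar>x\<bar>) powr (- (M + 2)))"
        unfolding abs_mult using b[of x] C(2)[of x] by (intro mult_mono) auto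
      also have "\<dots> = B * C * ((1 + \<bar>x\<bar>) powr M * (1 + \<bar>x\<bar>) powr (- (M + 2)))" by simp
      also have "(1 + \<bar>x\<bar>) powr M * (1 + \<bar>x\<bar>) powr (- (M + 2)) = (1 + \<bar>x\<bar>) powr (-2)"
        by (subst powr_add[symmetric]) auto
      finally show ?thesis .
    qed
    then show "AE x in lborel. norm (g x * \<psi> x) \<le> norm (B * C * (1 + \<bar>x\<bar>) powr (-2))"
      by (intro AE_I2) (metis abs_ge_self order_trans real_norm_def)
    show "(\<lambda>x. g x * \<psi> x) \<in> borel_measurable lborel" by measurable
  qed
qed

lemma integrable_decay_abs_psi:
  fixes g :: "real \<Rightarrow> real"
  assumes [measurable]: "g \<in> borel_measurable borel" and b: "\<And>x. \<bar>g x\<bar> \<le> B * (1 + \<bar>x\<bar>) powr M"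
  shows "integrable lborel (\<lambda>x. g x * \<bar>\<psi> x\<bar>)"
proof (rule Bochner_Integration.integrable_bound[OF integrable_decay_psi[OF assms]])
  show "AE x in lborel. norm (g x * \<bar>\<psi> x\<bar>) \<le> norm (g x * \<psi> x)" by (simp add: abs_mult)
  show "(\<lambda>x. g x * \<bar>\<psi> x\<bar>) \<in> borel_measurable lborel" by measurable
qed

lemma integrable_psi: "integrable lborel \<psi>"
proof -
  have "integrable lborel (\<lambda>x. 1 * \<psi> x)"
    by (rule integrable_decay_psi[of _ 1 1]) (auto simp: powr_def)
  then show ?thesis by simp
qed

lemma integrable_power_psi: "integrable lborel (\<lambda>x. x ^ m * \<psi> x)"
proof (rule integrable_decay_psi)
  show "\<bar>x ^ m\<bar> \<le> 1 * (1 + \<bar>x\<bar>) powr real m" for x :: real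
    by (simp add: powr_realpow add_pos_nonneg power_abs power_mono)
qed measurable

lemma wavelet_inner:
  "(LINT x|lborel. \<psi> (2 powr real_of_int j * x - real_of_int k) * \<psi> (2 powr real_of_int j' * x - real_of_int k'))
     = (if j = j' \<and> k = k' then 2 powr (- real_of_int j) else 0)"
proof -
  define I where "I = (LINT x|lborel. \<psi> (2 powr real_of_int j * x - real_of_int k) * \<psi> (2 powr real_of_int j' * x - real_of_int k'))"
  have "(LINT x|lborel. wav2 \<psi> j k x * wav2 \<psi> j' k' x) =
     (LINT x|lborel. 2 powr (real_of_int j / 2) * 2 powr (real_of_int j' / 2) *
       (\<psi> (2 powr real_of_int j * x - real_of_int k) * \<psi> (2 powr real_of_int j' * x - real_of_int k')))"
    by (intro arg_cong[where f="integral\<^sup>L lborel"] ext, unfold wav2_def) (simp only: mult_ac)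
  also have "\<dots> = 2 powr (real_of_int j / 2) * 2 powr (real_of_int j' / 2) * I"
    unfolding I_def by (rule integral_mult_right_zero)
  also have "2 powr (real_of_int j / 2) * 2 powr (real_of_int j' / 2) = (2::real) powr ((real_of_int j + real_of_int j') / 2)"
    by (simp only: powr_add[symmetric] add_divide_distrib)
  finally have 1: "(LINT x|lborel. wav2 \<psi> j k x * wav2 \<psi> j' k' x) = 2 powr ((real_of_int j + real_of_int j') / 2) * I" .
  have 2: "(LINT x|lborel. wav2 \<psi> j k x * wav2 \<psi> j' k' x) = (if j = j' \<and> k = k' then 1 else 0)"
    using onw unfolding orthonormal_wavelet_def by blast
  have 3: "2 powr ((real_of_int j + real_of_int j') / 2) * I = (if j = j' \<and> k = k' then 1 else 0)"
    by (rule trans[OF 1[symmetric] 2])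
  have "I = (if j = j' \<and> k = k' then 2 powr (- real_of_int j) else 0)"
  proof (cases "j = j' \<and> k = k'")
    case True
    then have "2 powr (real_of_int j) * I = 1" using 3 by simp
    then have "2 powr (- real_of_int j) * (2 powr (real_of_int j) * I) = 2 powr (- real_of_int j)" by simp
    then show ?thesis using True by (simp add: mult.assoc[symmetric] powr_add[symmetric])
  next
    case False
    then have "2 powr ((real_of_int j + real_of_int j') / 2) * I = 0"
      using 3 by (simp only: if_not_P if_False)
    then have "I = 0" by simp
    then show ?thesis using False by (simp only: if_not_P if_False)
  qed
  then show ?thesis unfolding I_def .
qed

text \<open>The substitution y = 2^j x - k turns a sup-normalised coefficient into an integral
  against \<psi> at unit scale, where moment and decay estimates are carried out.\<close>

lemma wavelet_cov:
  fixes G :: "real \<Rightarrow> real" and j k :: real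
  shows "2 powr j * (LINT x|lborel. G x * \<psi> (2 powr j * x - k)) = (LINT y|lborel. G (2 powr (- j) * (y + k)) * \<psi> y)"
proof -
  have one: "2 powr j * 2 powr (- j) = (1::real)" by (simp add: powr_add[symmetric])
  have "(LINT x|lborel. G x * \<psi> (2 powr j * x - k)) =
     2 powr (- j) * (LINT y|lborel. G (2 powr (- j) * k + 2 powr (- j) * y) *
        \<psi> (2 powr j * (2 powr (- j) * k + 2 powr (- j) * y) - k))"
    using lborel_integral_real_affine[of "2 powr (- j)" "\<lambda>x. G x * \<psi> (2 powr j * x - k)" "2 powr (- j) * k"] by simp
  also have "(\<lambda>y. G (2 powr (- j) * k + 2 powr (- j) * y) *
        \<psi> (2 powr j * (2 powr (- j) * k + 2 powr (- j) * y) - k)) = (\<lambda>y. G (2 powr (- j) * (y + k)) * \<psi> y)"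
  proof
    fix y
    have "2 powr j * (2 powr (- j) * k + 2 powr (- j) * y) - k = (2 powr j * 2 powr (- j)) * (k + y) - k"
      by (simp only: distrib_left mult.assoc)
    also have "\<dots> = y" unfolding one by simp
    finally have "2 powr j * (2 powr (- j) * k + 2 powr (- j) * y) - k = y" .
    then show "G (2 powr (- j) * k + 2 powr (- j) * y) * \<psi> (2 powr j * (2 powr (- j) * k + 2 powr (- j) * y) - k)
        = G (2 powr (- j) * (y + k)) * \<psi> y"
      by (simp only: distrib_left add.commute)
  qed
  finally have "2 powr j * (LINT x|lborel. G x * \<psi> (2 powr j * x - k)) =
      (2 powr j * 2 powr (- j)) * (LINT y|lborel. G (2 powr (- j) * (y + k)) * \<psi> y)" by (simp only: mult.assoc)
  then show ?thesis unfolding one by simp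
qed

end

section \<open>Vanishing moments of a Schwartz wavelet\<close>

lemma dyadic_floor_tendsto: "(\<lambda>n. real_of_int \<lfloor>2 ^ n * x\<rfloor> / 2 ^ n) \<longlonglongrightarrow> x"
proof (rule LIMSEQ_I)
  fix r :: real assume "r > 0"
  then obtain N where N: "(1/2) ^ N < r" using real_arch_pow_inv[of r "1/2"] by auto
  have "norm (real_of_int \<lfloor>2 ^ n * x\<rfloor> / 2 ^ n - x) < r" if "n \<ge> N" for n
  proof -
    have "real_of_int \<lfloor>2 ^ n * x\<rfloor> / 2 ^ n - x = - ((2 ^ n * x - real_of_int \<lfloor>2 ^ n * x\<rfloor>) / 2 ^ n)"
      by (simp add: field_simps)
    then have "norm (real_of_int \<lfloor>2 ^ n * x\<rfloor> / 2 ^ n - x) = \<bar>2 ^ n * x - real_of_int \<lfloor>2 ^ n * x\<rfloor>\<bar> / 2 ^ n"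
      by simp
    also have "\<dots> \<le> 1 / 2 ^ n" by (intro divide_right_mono) (linarith, simp)
    also have "\<dots> = (1/2) ^ n" by (simp add: power_divide)
    also have "\<dots> \<le> (1/2) ^ N" using that by (intro power_decreasing) auto
    finally show ?thesis using N by simp
  qed
  then show "\<exists>no. \<forall>n\<ge>no. norm (real_of_int \<lfloor>2 ^ n * x\<rfloor> / 2 ^ n - x) < r" by blast
qed

context schwartz_wavelet
begin

lemma taylor_psi:
  "\<exists>t. \<bar>t\<bar> \<le> \<bar>w\<bar> \<and> \<psi> (u + w) = (\<Sum>l<n. D l u / fact l * w ^ l) + D n (u + t) / fact n * w ^ n"
proof -
  have "\<exists>t. \<bar>t\<bar> \<le> \<bar>w\<bar> \<and> (\<lambda>w. \<psi> (u + w)) w = (\<Sum>l<n. (\<lambda>l w. D l (u + w)) l 0 / fact l * w ^ l)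
     + (\<lambda>l w. D l (u + w)) n t / fact n * w ^ n"
  proof (rule Maclaurin_all_le)
    have "((\<lambda>w. D l (u + w)) has_real_derivative D (Suc l) (u + w)) (at w)" for l w
      by (rule DERIV_chain'[OF _ DERIV_D, THEN DERIV_cong]) (auto intro!: derivative_eq_intros)
    then show "\<forall>l w. ((\<lambda>w. D l (u + w)) has_real_derivative D (Suc l) (u + w)) (at w)" by blast
  qed simp
  then show ?thesis by simp
qed

text \<open>If the derivative of order m + 1 vanishes identically, the one of order m is constant,
  and a constant that decays at infinity is zero.\<close>

lemma D_zero_imp_psi_zero: "(\<forall>x. D m x = 0) \<Longrightarrow> \<psi> x = 0"
proof (induction m arbitrary: x)
  case 0
  then show ?case by simp
next
  case (Suc m)
  have "D m y = 0" for y
  proof (rule ccontr)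
    assume ne: "D m y \<noteq> 0"
    have const: "D m z = D m y" for z
      by (rule DERIV_isconst_all) (use DERIV_D[of m] Suc.prems in metis)
    obtain C where C: "C > 0" "\<And>x. \<bar>D m x\<bar> \<le> C * (1 + \<bar>x\<bar>) powr (- 1)"
      using D_decay[of m 1] by blast
    \<comment> \<open>At this point the decay bound is C / (1 + z), and C = z * |D m y|, so the
      bound is smaller than the constant value |D m y|.\<close>
    define z where "z = C / \<bar>D m y\<bar>"
    have z: "z > 0" using C ne by (simp add: z_def)
    have "\<bar>D m y\<bar> \<le> C * (1 + \<bar>z\<bar>) powr (- 1)" using C(2)[of z] const[of z] by simp
    also have "\<dots> = C / (1 + z)" using z by (simp add: powr_minus_divide)
    finally have "\<bar>D m y\<bar> * (1 + z) \<le> C" using z by (simp add: field_simps)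
    moreover have "\<bar>D m y\<bar> * z = C" using ne by (simp add: z_def)
    ultimately show False using ne by (simp add: distrib_left)
  qed
  then show ?case using Suc.IH by blast
qed

text \<open>By continuity dyadic points suffice, and \<psi> is not identically zero because its L2
  norm is one. A dyadic point is wanted because wavelets of every high generation are centred
  exactly there.\<close>

lemma D_nonzero_dyadic: "\<exists>(k::int) (j::nat). D m (real_of_int k / 2 ^ j) \<noteq> 0"
proof (rule ccontr)
  assume "\<not> ?thesis"
  then have z: "D m (real_of_int k / 2 ^ j) = 0" for k j by blast
  have "D m x = 0" for x
  proof -
    have "isCont (D m) x" using DERIV_D DERIV_isCont by blast
    then have "(\<lambda>n. D m (real_of_int \<lfloor>2 ^ n * x\<rfloor> / 2 ^ n)) \<longlonglongrightarrow> D m x"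
      by (rule isCont_tendsto_compose[OF _ dyadic_floor_tendsto])
    then show ?thesis using LIMSEQ_unique[of "\<lambda>_. 0" 0 "D m x"] by (simp add: z)
  qed
  then have "\<psi> x = 0" for x using D_zero_imp_psi_zero by blast
  then show False using wavelet_inner[of 0 0 0 0] by simp
qed

text \<open>Expand \<psi> at a dyadic point where its m-th derivative does not vanish and use the orthogonality of
  \<psi> to the wavelets of high generation located at that point.\<close>

lemma vanishing_moment: "(LINT y|lborel. y ^ m * \<psi> y) = 0"
proof (induction m rule: less_induct)
  case (less m)
  define I where "I = (LINT y|lborel. y ^ m * \<psi> y)"
  obtain k0 :: int and j0 :: nat where kj: "D m (real_of_int k0 / 2 ^ j0) \<noteq> 0"
    using D_nonzero_dyadic by blast
  define x0 where "x0 = real_of_int k0 / 2 ^ j0"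
  obtain B where B: "B > 0" "\<And>x. \<bar>D (Suc m) x\<bar> \<le> B" using D_bounded[of "Suc m"] by blast
  define A where "A = (LINT y|lborel. \<bar>y ^ (Suc m)\<bar> * \<bar>\<psi> y\<bar>)"
  have intA: "integrable lborel (\<lambda>y. \<bar>y ^ (Suc m)\<bar> * \<bar>\<psi> y\<bar>)"
  proof (rule integrable_decay_abs_psi)
    show "\<bar>\<bar>x ^ (Suc m)\<bar>\<bar> \<le> 1 * (1 + \<bar>x\<bar>) powr real (Suc m)" for x :: real
    proof -
      have "\<bar>\<bar>x ^ (Suc m)\<bar>\<bar> \<le> (1 + \<bar>x\<bar>) ^ Suc m"
        unfolding abs_abs power_abs by (intro power_mono) auto
      then show ?thesis by (subst powr_realpow) auto
    qed
  qed measurable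
  have key: "\<bar>D m x0 / fact m * I\<bar> \<le> B * A * (1/2) ^ J" if J: "J \<ge> j0" "J \<ge> 1" for J :: nat
  proof -
    define \<epsilon> :: real where "\<epsilon> = (1/2) ^ J"
    have eps: "\<epsilon> > 0" by (simp add: \<epsilon>_def)
    define k where "k = k0 * 2 ^ (J - j0)"
    have eps': "2 powr (- real J) = \<epsilon>" by (simp add: \<epsilon>_def powr_minus powr_realpow power_divide inverse_eq_divide)
    have x0: "\<epsilon> * real_of_int k = x0"
    proof -
      have "(2::real) ^ J = 2 ^ (J - j0) * 2 ^ j0" using J by (simp add: power_add[symmetric])
      then show ?thesis by (simp add: \<epsilon>_def k_def x0_def power_divide field_simps)
    qed
    have "2 powr real J * (LINT x|lborel. \<psi> x * \<psi> (2 powr real J * x - real_of_int k)) =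
       (LINT y|lborel. \<psi> (2 powr (- real J) * (y + real_of_int k)) * \<psi> y)"
      by (rule wavelet_cov)
    moreover have "(LINT x|lborel. \<psi> x * \<psi> (2 powr real J * x - real_of_int k)) = 0"
      using wavelet_inner[of 0 0 "int J" k] J by simp
    moreover have "2 powr (- real J) * (y + real_of_int k) = x0 + \<epsilon> * y" for y
      unfolding eps' distrib_left x0 by simp
    ultimately have zero: "(LINT y|lborel. \<psi> (x0 + \<epsilon> * y) * \<psi> y) = 0" by simp
    define S where "S y = (\<Sum>l<Suc m. D l x0 / fact l * (\<epsilon> * y) ^ l)" for y
    define R where "R y = \<psi> (x0 + \<epsilon> * y) - S y" for y
    have intpsi: "integrable lborel (\<lambda>y. \<psi> (x0 + \<epsilon> * y) * \<psi> y)"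
    proof -
      obtain C where C: "\<And>x. \<bar>\<psi> x\<bar> \<le> C" using D_bounded[of 0] by auto
      have "C \<ge> 0" using C[of 0] by simp
      have "\<bar>\<psi> (x0 + \<epsilon> * y)\<bar> \<le> C * (1 + \<bar>y\<bar>) powr 1" for y
        using C[of "x0 + \<epsilon> * y"] \<open>C \<ge> 0\<close> by (simp add: distrib_left) (smt (verit) mult_nonneg_nonneg)
      then show ?thesis by (intro integrable_decay_psi) measurable
    qed
    have Seq: "S y * \<psi> y = (\<Sum>l<Suc m. D l x0 / fact l * \<epsilon> ^ l * (y ^ l * \<psi> y))" for y
      by (simp only: S_def sum_distrib_right power_mult_distrib mult.assoc)
    have intS: "integrable lborel (\<lambda>y. S y * \<psi> y)"
      unfolding Seq by (intro Bochner_Integration.integrable_sum integrable_mult_right integrable_power_psi)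
    \<comment> \<open>By the induction hypothesis the lower moments vanish, so only the Taylor term
      of order m survives. The remainder carries one more factor \<epsilon>, which tends to 0 as
      \<open>J\<close> grows.\<close>
    have "(LINT y|lborel. S y * \<psi> y) = (\<Sum>l<Suc m. D l x0 / fact l * \<epsilon> ^ l * (LINT y|lborel. y ^ l * \<psi> y))"
      unfolding Seq by (subst Bochner_Integration.integral_sum)
        (auto intro!: integrable_mult_right integrable_power_psi sum.cong simp del: sum.lessThan_Suc)
    also have "\<dots> = D m x0 / fact m * \<epsilon> ^ m * I"
      using less by (simp add: I_def)
    finally have IS: "(LINT y|lborel. S y * \<psi> y) = D m x0 / fact m * \<epsilon> ^ m * I" .
    have "(LINT y|lborel. R y * \<psi> y) = (LINT y|lborel. \<psi> (x0 + \<epsilon> * y) * \<psi> y) - (LINT y|lborel. S y * \<psi> y)"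
      unfolding R_def left_diff_distrib by (rule Bochner_Integration.integral_diff[OF intpsi intS])
    then have eq: "(LINT y|lborel. R y * \<psi> y) = - (D m x0 / fact m * \<epsilon> ^ m * I)"
      using zero IS by simp
    have bR: "\<bar>R y\<bar> \<le> B * \<epsilon> ^ Suc m * \<bar>y ^ Suc m\<bar>" for y
    proof -
      obtain t where t: "\<psi> (x0 + \<epsilon> * y) = S y + D (Suc m) (x0 + t) / fact (Suc m) * (\<epsilon> * y) ^ Suc m"
        using taylor_psi[of "\<epsilon> * y" x0 "Suc m"] unfolding S_def by blast
      have "\<bar>D (Suc m) (x0 + t)\<bar> / fact (Suc m) \<le> \<bar>D (Suc m) (x0 + t)\<bar> / 1"
        by (intro divide_left_mono) (auto simp del: fact_Suc)
      then have "\<bar>D (Suc m) (x0 + t)\<bar> / fact (Suc m) \<le> B"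
        using B(2)[of "x0 + t"] by linarith
      then have "\<bar>D (Suc m) (x0 + t)\<bar> / fact (Suc m) * \<bar>(\<epsilon> * y) ^ Suc m\<bar> \<le> B * \<bar>(\<epsilon> * y) ^ Suc m\<bar>"
        by (intro mult_right_mono) auto
      moreover have "\<bar>(\<epsilon> * y) ^ Suc m\<bar> = \<epsilon> ^ Suc m * \<bar>y ^ Suc m\<bar>"
        using eps by (simp only: power_mult_distrib abs_mult power_abs)
      moreover have "\<bar>R y\<bar> = \<bar>D (Suc m) (x0 + t)\<bar> / fact (Suc m) * \<bar>(\<epsilon> * y) ^ Suc m\<bar>"
        by (simp only: R_def t add_diff_cancel_left' abs_mult abs_divide abs_of_pos[OF fact_gt_zero])
      ultimately show ?thesis by (simp only: mult.assoc)
    qed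
    have "\<bar>LINT y|lborel. R y * \<psi> y\<bar> \<le> (LINT y|lborel. B * \<epsilon> ^ Suc m * (\<bar>y ^ (Suc m)\<bar> * \<bar>\<psi> y\<bar>))"
    proof (rule integral_abs_bound_integral)
      show "integrable lborel (\<lambda>y. R y * \<psi> y)"
        unfolding R_def left_diff_distrib by (rule Bochner_Integration.integrable_diff[OF intpsi intS])
      show "integrable lborel (\<lambda>y. B * \<epsilon> ^ Suc m * (\<bar>y ^ (Suc m)\<bar> * \<bar>\<psi> y\<bar>))"
        by (intro integrable_mult_right intA)
      show "\<bar>R y * \<psi> y\<bar> \<le> B * \<epsilon> ^ Suc m * (\<bar>y ^ (Suc m)\<bar> * \<bar>\<psi> y\<bar>)" for y
        using mult_right_mono[OF bR[of y], of "\<bar>\<psi> y\<bar>"] by (simp only: abs_mult mult.assoc abs_ge_zero)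
    qed
    also have "\<dots> = B * \<epsilon> ^ Suc m * A" unfolding A_def by (rule integral_mult_right_zero)
    finally have "\<bar>D m x0 / fact m * I\<bar> * \<epsilon> ^ m \<le> (B * A * \<epsilon>) * \<epsilon> ^ m"
      unfolding eq using eps by (simp add: abs_mult mult_ac)
    then have "\<bar>D m x0 / fact m * I\<bar> \<le> B * A * \<epsilon>"
      by (rule mult_right_le_imp_le) (use eps in simp)
    then show ?thesis by (simp only: \<epsilon>_def)
  qed
  have "(\<lambda>J. B * A * (1/2) ^ J) \<longlonglongrightarrow> B * A * 0"
    by (intro tendsto_intros LIMSEQ_power_zero) auto
  then have "\<bar>D m x0 / fact m * I\<bar> \<le> 0"
    using key by (intro LIMSEQ_le_const[of _ 0]) (auto intro!: exI[of _ "max j0 1"])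
  then have "D m x0 / fact m * I = 0" by (simp only: abs_le_zero_iff)
  moreover have "D m x0 / fact m \<noteq> 0" using kj by (simp add: x0_def)
  ultimately show ?case by (simp only: I_def mult_eq_0_iff) simp
qed

lemma poly_psi_integral:
  "integrable lborel (\<lambda>y. poly Q y * \<psi> y)" "(LINT y|lborel. poly Q y * \<psi> y) = 0"
proof -
  have eq: "poly Q y * \<psi> y = (\<Sum>i\<le>degree Q. coeff Q i * (y ^ i * \<psi> y))" for y
    by (simp only: poly_altdef sum_distrib_right mult.assoc)
  show "integrable lborel (\<lambda>y. poly Q y * \<psi> y)"
    unfolding eq by (intro Bochner_Integration.integrable_sum integrable_mult_right integrable_power_psi)
  show "(LINT y|lborel. poly Q y * \<psi> y) = 0"
    unfolding eq by (subst Bochner_Integration.integral_sum)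
      (auto intro!: integrable_mult_right integrable_power_psi simp: vanishing_moment)
qed

end

section \<open>Cascades on dyadic digits\<close>

lemma floor_power_div: "\<lfloor>2 ^ (a + b) * x\<rfloor> div 2 ^ b = \<lfloor>2 ^ a * (x::real)\<rfloor>"
proof -
  have "\<lfloor>(2 ^ (a + b) * x) / real_of_int (2 ^ b)\<rfloor> = \<lfloor>2 ^ (a + b) * x\<rfloor> div 2 ^ b"
    by (rule floor_divide_real_eq_div) simp
  then show ?thesis by (simp add: power_add)
qed

lemma int_div_less_iff:
  fixes a b p :: int
  assumes "0 < b"
  shows "p div b < a \<longleftrightarrow> p < a * b"
proof
  assume "p div b < a"
  then have "(p div b + 1) * b \<le> a * b" using assms by (intro mult_right_mono) auto
  then have "p div b * b + b \<le> a * b" by (simp add: distrib_right)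
  moreover have "p mod b < b" using assms by simp
  ultimately show "p < a * b"
    using div_mult_mod_eq[of p b] by linarith
next
  assume "p < a * b"
  moreover have "0 \<le> p mod b" using assms by simp
  ultimately have "p div b * b < a * b"
    using div_mult_mod_eq[of p b] by linarith
  then show "p div b < a" using assms by simp
qed

text \<open>Stage i splits a node into 2^(\<open>len i\<close>) intervals, and \<open>v i c\<close>
  is the factor handed to child c; the value 0 means that there is no child. Digits are multiples of
  4 at distance at least 4 from both ends of the range, so two nodes of one stage are never
  neighbours and a node moved by one interval stays inside its parent.\<close>

locale cascade =
  fixes len :: "nat \<Rightarrow> nat" and v :: "nat \<Rightarrow> int \<Rightarrow> real" and \<alpha> :: real
  assumes ell_ge: "3 \<le> len i"
    and v_nonneg: "0 \<le> v i c"
    and v_digit: "0 < v i c \<Longrightarrow> 4 \<le> c \<and> c \<le> 2 ^ len i - 4 \<and> 4 dvd c"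
    and alpha_pos: "0 < \<alpha>"
    and v_upper: "v i c \<le> 2 powr (- (\<alpha> * len i))"
    and digit_ex: "\<exists>c. 0 < v i c"
    and growth: "(\<lambda>i. real (len i) / real (\<Sum>j<i. len j)) \<longlonglongrightarrow> 0"
begin

definition gen :: "nat \<Rightarrow> nat" where "gen s = (\<Sum>i<s. len i)"

abbreviation node :: "nat \<Rightarrow> real \<Rightarrow> int" where "node s x \<equiv> \<lfloor>2 ^ gen s * x\<rfloor>"

abbreviation off :: "nat \<Rightarrow> real \<Rightarrow> int \<Rightarrow> real" where "off s x p \<equiv> 2 ^ gen s * x - real_of_int p"

lemma gen_0 [simp]: "gen 0 = 0" and gen_Suc: "gen (Suc s) = gen s + len s"
  by (simp_all add: gen_def)

lemma gen_mono: "s \<le> t \<Longrightarrow> gen s \<le> gen t"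
  unfolding gen_def by (intro sum_mono2) auto

lemma gen_less_Suc: "gen s < gen (Suc s)"
  using ell_ge[of s] by (simp add: gen_Suc)

lemma gen_strict_mono: "strict_mono gen"
  by (simp add: strict_mono_Suc_iff gen_less_Suc)

lemma gen_ge: "s \<le> gen s"
  using gen_strict_mono by (rule strict_mono_imp_increasing)

lemma gen_diff_Suc: "s \<le> t \<Longrightarrow> gen (Suc t) - gen s = len t + (gen t - gen s)"
  using gen_mono[of s t] by (simp add: gen_Suc)

lemma ratio: "(\<lambda>i. real (len i) / real (gen i)) \<longlonglongrightarrow> 0"
  using growth by (simp add: gen_def)

lemma gen_at_top: "filterlim (\<lambda>s. real (gen s)) at_top sequentially"
  by (rule filterlim_at_top_mono[OF filterlim_real_sequentially]) (simp add: gen_ge)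

lemma ratio_Suc: "(\<lambda>s. real (gen (Suc s)) / real (gen s)) \<longlonglongrightarrow> 1"
proof -
  have "(\<lambda>s. 1 + real (len s) / real (gen s)) \<longlonglongrightarrow> 1 + 0"
    by (intro tendsto_intros ratio)
  moreover have "eventually (\<lambda>s. 1 + real (len s) / real (gen s) = real (gen (Suc s)) / real (gen s)) sequentially"
    using eventually_gt_at_top[of 0]
  proof eventually_elim
    case (elim s)
    then have "gen s > 0" using gen_ge[of s] by linarith
    then show ?case by (simp add: gen_Suc field_simps)
  qed
  ultimately show ?thesis by (simp add: Lim_transform_eventually)
qed

text \<open>Any constant is absorbed by an arbitrarily small loss in the exponent, since
  \<open>gen s\<close> tends to infinity.\<close>

lemma absorb_const:
  fixes a b C :: real
  assumes "a < b"
  shows "\<forall>\<^sub>F s in sequentially. C * 2 powr (- (gen s * b)) \<le> 2 powr (- (gen s * a))"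
proof -
  have "filterlim (\<lambda>s. real (gen s) * (b - a)) at_top sequentially"
    using filterlim_tendsto_pos_mult_at_top[OF tendsto_const[of "b - a"] _ gen_at_top] assms by (simp add: mult.commute)
  then have "\<forall>\<^sub>F s in sequentially. log 2 (max 1 C) \<le> real (gen s) * (b - a)"
    unfolding filterlim_at_top by blast
  then show ?thesis
  proof eventually_elim
    case (elim s)
    have "C \<le> max 1 C" by simp
    also have "\<dots> = 2 powr (log 2 (max 1 C))" by (intro powr_log_cancel[symmetric]) auto
    also have "\<dots> \<le> 2 powr (real (gen s) * (b - a))" using elim by (intro powr_mono) auto
    finally have "C * 2 powr (- (gen s * b)) \<le> 2 powr (real (gen s) * (b - a)) * 2 powr (- (gen s * b))"
      by (intro mult_right_mono) auto
    also have "\<dots> = 2 powr (- (gen s * a))" by (simp add: powr_add[symmetric] algebra_simps)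
    finally show ?case .
  qed
qed

text \<open>The ratio of consecutive generations tends to 1, so the gap between a and b pays for the
  passage to the next stage; \<open>c\<close> covers the finitely many early stages.\<close>

lemma gen_Suc_slack:
  fixes a b :: real
  assumes "0 \<le> a" "a < b"
  obtains c where "c \<ge> 0" "\<And>s. gen (Suc s) * a \<le> gen s * b + c"
proof -
  have "(\<lambda>s. a * (real (gen (Suc s)) / real (gen s))) \<longlonglongrightarrow> a * 1"
    by (intro tendsto_intros ratio_Suc)
  then have "\<forall>\<^sub>F s in sequentially. a * (real (gen (Suc s)) / real (gen s)) < b"
    using assms by (intro order_tendstoD) auto
  then have "\<forall>\<^sub>F s in sequentially. gen (Suc s) * a \<le> gen s * b"
    using eventually_ge_at_top[of 1]
  proof eventually_elim
    case (elim s)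
    have "gen s > 0" using gen_ge[of s] elim by linarith
    then show ?case using elim by (simp add: field_simps)
  qed
  then obtain N where N: "\<And>s. s \<ge> N \<Longrightarrow> gen (Suc s) * a \<le> gen s * b"
    unfolding eventually_sequentially by blast
  have "gen (Suc s) * a \<le> gen s * b + gen N * a" for s
  proof (cases "s \<ge> N")
    case True
    have "0 \<le> gen N * a" using assms by simp
    then show ?thesis using N[OF True] by linarith
  next
    case False
    have "gen (Suc s) * a \<le> gen N * a"
      using False gen_mono[of "Suc s" N] assms by (intro mult_right_mono) auto
    moreover have "0 \<le> gen s * b" using assms by simp
    ultimately show ?thesis by linarith
  qed
  then show ?thesis using assms by (intro that[of "gen N * a"]) auto
qed

text \<open>Stage 0 carries weight at the unit interval only, so no node leaves [0, 1).\<close>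

primrec lam :: "nat \<Rightarrow> int \<Rightarrow> real" where
  "lam 0 p = (if p = 0 then 1 else 0)"
| "lam (Suc s) p = lam s (p div 2 ^ len s) * v s (p mod 2 ^ len s)"

lemma lam_nonneg: "0 \<le> lam s p"
  by (induction s arbitrary: p) (auto intro: mult_nonneg_nonneg v_nonneg)

lemma lam_SucD: "0 < lam (Suc s) p \<Longrightarrow> 0 < lam s (p div 2 ^ len s) \<and> 0 < v s (p mod 2 ^ len s)"
  using lam_nonneg[of s "p div 2 ^ len s"] v_nonneg[of s "p mod 2 ^ len s"] by (auto simp: zero_less_mult_iff)

lemma v_le_1: "v s c \<le> 1"
  using v_upper[of s c] alpha_pos powr_mono[of "- (\<alpha> * len s)" 0 2] by simp

lemma lam_pos_range: "0 < lam s p \<Longrightarrow> 0 \<le> p \<and> p < 2 ^ gen s"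
proof (induction s arbitrary: p)
  case 0
  then show ?case by (simp split: if_splits)
next
  case (Suc s)
  from Suc.IH[of "p div 2 ^ len s"] lam_SucD[OF Suc.prems]
  have *: "0 \<le> p div 2 ^ len s" "p div 2 ^ len s < 2 ^ gen s" by auto
  then have "0 \<le> p" by (simp add: pos_imp_zdiv_nonneg_iff)
  moreover have "p < 2 ^ gen s * 2 ^ len s"
    using *(2) by (simp add: int_div_less_iff)
  ultimately show ?case by (simp add: gen_Suc power_add)
qed

lemma four_dvd_pow: "(4::int) dvd 2 ^ len s"
  using le_imp_power_dvd[of 2 "len s" "2::int"] ell_ge[of s] by simp

lemma lam_pos_dvd: "0 < lam s p \<Longrightarrow> 4 dvd p"
proof (cases s)
  case (Suc t)
  assume "0 < lam s p"
  then have "4 dvd p mod 2 ^ len t" using lam_SucD[of t p] v_digit Suc by blast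
  then show "4 dvd p" using four_dvd_pow dvd_mod_iff by blast
qed (simp split: if_splits)

lemma lam_separated:
  assumes "0 < lam s p" "0 < lam s p'" "p \<noteq> p'"
  shows "4 \<le> \<bar>p - p'\<bar>"
  using zdvd_imp_le[of 4 "\<bar>p - p'\<bar>"] lam_pos_dvd[OF assms(1)] lam_pos_dvd[OF assms(2)] assms(3)
  by (simp add: dvd_diff)

lemma lam_le: "lam s p \<le> 2 powr (- (\<alpha> * gen s))"
proof (induction s arbitrary: p)
  case 0
  then show ?case by simp
next
  case (Suc s)
  have "lam (Suc s) p \<le> 2 powr (- (\<alpha> * gen s)) * 2 powr (- (\<alpha> * len s))"
    using Suc v_upper[of s "p mod 2 ^ len s"] by (auto intro!: mult_mono v_nonneg)
  also have "\<dots> = 2 powr (- (\<alpha> * gen (Suc s)))"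
    by (simp add: powr_add[symmetric] gen_Suc algebra_simps)
  finally show ?case .
qed

lemma lam_le_1: "lam s p \<le> 1"
proof -
  have "2 powr (- (\<alpha> * gen s)) \<le> 2 powr 0" using alpha_pos by (intro powr_mono) auto
  then show ?thesis using lam_le[of s p] by simp
qed

lemma lam_ancestor: "s \<le> t \<Longrightarrow> lam t p \<le> lam s (p div 2 ^ (gen t - gen s))"
proof (induction t arbitrary: p rule: dec_induct)
  case base
  then show ?case by simp
next
  case (step t)
  have "lam (Suc t) p \<le> lam t (p div 2 ^ len t) * 1"
    unfolding lam.simps by (intro mult_left_mono v_le_1 lam_nonneg)
  also have "\<dots> \<le> lam s ((p div 2 ^ len t) div 2 ^ (gen t - gen s))"
    using step.IH by simp
  also have "(p div 2 ^ len t) div 2 ^ (gen t - gen s) = p div 2 ^ (gen (Suc t) - gen s)"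
    using step.hyps by (simp add: gen_diff_Suc power_add zdiv_zmult2_eq)
  finally show ?case .
qed

lemma floor_ancestor: "s \<le> t \<Longrightarrow> node t x div 2 ^ (gen t - gen s) = \<lfloor>2 ^ gen s * (x::real)\<rfloor>"
  using floor_power_div[of "gen s" "gen t - gen s" x] gen_mono[of s t] by simp

text \<open>The digit of \<open>p\<close> is at distance at least 4 from both ends of its range, so
  moving one interval sideways does not leave the parent.\<close>

lemma near_node_floor:
  assumes "0 < lam (Suc s) p" "\<bar>node (Suc s) x - p\<bar> \<le> 1"
  shows "\<lfloor>2 ^ gen s * (x::real)\<rfloor> = p div 2 ^ len s"
proof -
  define b :: int where "b = 2 ^ len s"
  have b: "b > 0" by (simp add: b_def)
  have c: "4 \<le> p mod b" "p mod b \<le> b - 4"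
    using v_digit[of s "p mod 2 ^ len s"] lam_SucD[OF assms(1)] by (auto simp: b_def)
  define f where "f = node (Suc s) x"
  have "f = (p div b) * b + (p mod b + (f - p))" by simp
  moreover have "0 \<le> p mod b + (f - p)" "p mod b + (f - p) < b"
    using c assms(2) by (auto simp: f_def)
  ultimately have "f div b = p div b"
    by (metis b div_mult_self3 div_pos_pos_trivial add.commute add.right_neutral less_irrefl)
  then show ?thesis
    using floor_ancestor[of s "Suc s" x] by (simp add: f_def b_def gen_Suc)
qed

definition K :: "real set" where "K = {x. \<forall>s. 0 < lam s (node s x)}"

lemma K_range: "x \<in> K \<Longrightarrow> 0 \<le> x \<and> x < 1"
proof -
  assume "x \<in> K"
  then have "0 < lam 0 (node 0 x)" unfolding K_def by blast
  then have "\<lfloor>x\<rfloor> = 0" by (simp split: if_splits)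
  then show ?thesis by linarith
qed

text \<open>Since 0 powr q = 0 for every q, only the digits (the c of positive weight) contribute to Z.\<close>

definition Z :: "nat \<Rightarrow> real \<Rightarrow> real" where
  "Z i q = (\<Sum>c\<in>{0..<2 ^ len i}. v i c powr q)"

lemma digit_range: "0 < v i c \<Longrightarrow> c \<in> {0..<2 ^ len i}"
  using v_digit[of i c] by auto

lemma Z_pos: "0 < Z i q"
proof -
  obtain c where c: "0 < v i c" using digit_ex by blast
  show ?thesis unfolding Z_def
    by (rule sum_pos2[of _ c]) (use c digit_range[OF c] in auto)
qed

text \<open>Writing p = a * b + c with b = 2^(\<open>len s\<close>) separates the parent a from the
  digit c. The factors available below a do not depend on a, so the sum factorises stage by
  stage.\<close>

lemma partition_function:
  "(\<Sum>p\<in>{0..<2 ^ gen s}. lam s p powr q) = (\<Prod>i<s. Z i q)"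
proof (induction s)
  case 0
  then show ?case by simp
next
  case (Suc s)
  define b :: int where "b = 2 ^ len s"
  have b: "b > 0" by (simp add: b_def)
  have "(\<Sum>p\<in>{0..<2 ^ gen (Suc s)}. lam (Suc s) p powr q) =
     (\<Sum>(a, c)\<in>{0..<2 ^ gen s} \<times> {0..<b}. lam s a powr q * v s c powr q)"
  proof (rule sum.reindex_bij_witness[where i = "\<lambda>(a, c). a * b + c" and j = "\<lambda>p. (p div b, p mod b)"])
    fix p assume p: "p \<in> {0..<2 ^ gen (Suc s) :: int}"
    then show "(case (p div b, p mod b) of (a, c) \<Rightarrow> a * b + c) = p" by simp
    have "p div b < 2 ^ gen s"
      using p b by (simp add: int_div_less_iff b_def gen_Suc power_add)
    then show "(p div b, p mod b) \<in> {0..<2 ^ gen s} \<times> {0..<b}"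
      using p b by (simp add: pos_imp_zdiv_nonneg_iff)
    show "(case (p div b, p mod b) of (a, c) \<Rightarrow> lam s a powr q * v s c powr q) = lam (Suc s) p powr q"
      by (simp add: b_def powr_mult)
  next
    fix ac :: "int \<times> int" assume ac: "ac \<in> {0..<2 ^ gen s} \<times> {0..<b}"
    then obtain a c where [simp]: "ac = (a, c)" and r: "0 \<le> a" "a < 2 ^ gen s" "0 \<le> c" "c < b" by auto
    show "((case ac of (a, c) \<Rightarrow> a * b + c) div b, (case ac of (a, c) \<Rightarrow> a * b + c) mod b) = ac"
      using r by simp
    have "a * b + c < (a + 1) * b" using r by (simp add: distrib_right)
    also have "\<dots> \<le> 2 ^ gen s * b" using r b by (intro mult_right_mono) auto
    finally show "(case ac of (a, c) \<Rightarrow> a * b + c) \<in> {0..<2 ^ gen (Suc s)}"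
      using r b by (simp add: gen_Suc power_add b_def)
  qed
  also have "\<dots> = (\<Sum>a\<in>{0..<2 ^ gen s}. lam s a powr q) * (\<Sum>c\<in>{0..<b}. v s c powr q)"
    by (simp add: sum.cartesian_product[symmetric] sum_product)
  also have "\<dots> = (\<Prod>i<Suc s. Z i q)"
    using Suc by (simp add: Z_def b_def)
  finally show ?case .
qed

text \<open>The finitely many stages that violate the bound contribute only a constant
  factor.\<close>

lemma prod_upper:
  fixes z :: "nat \<Rightarrow> real" and \<tau> :: real
  assumes "\<And>i. 0 \<le> z i" and ev: "eventually (\<lambda>i. z i \<le> 2 powr (- (len i * \<tau>))) sequentially"
  obtains C where "C \<ge> 1" "\<And>s. (\<Prod>i<s. z i) \<le> C * 2 powr (- (gen s * \<tau>))"
proof -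
  from ev obtain N where N: "\<And>i. i \<ge> N \<Longrightarrow> z i \<le> 2 powr (- (len i * \<tau>))"
    unfolding eventually_sequentially by blast
  \<comment> \<open>The excess of \<open>z i\<close> over its bound, cut off below at 1. It equals 1
    from \<open>N\<close> on, so the partial products are bounded.\<close>
  define w where "w i = max 1 (z i / 2 powr (- (len i * \<tau>)))" for i
  have w1: "w i \<ge> 1" for i by (simp add: w_def)
  have zw: "z i \<le> w i * 2 powr (- (len i * \<tau>))" for i
    unfolding w_def by (simp add: field_simps max_def)
  have wN: "w i = 1" if "i \<ge> N" for i using N[OF that] by (simp add: w_def field_simps max_def)
  have "(\<Prod>i<s. z i) \<le> (\<Prod>i<s. w i) * 2 powr (- (gen s * \<tau>))" for s
  proof (induction s)
    case (Suc s)
    have "(\<Prod>i<Suc s. z i) \<le> ((\<Prod>i<s. w i) * 2 powr (- (gen s * \<tau>))) * (w s * 2 powr (- (len s * \<tau>)))"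
      unfolding prod.lessThan_Suc using assms(1) w1 zw
      by (intro mult_mono Suc) (auto intro!: prod_nonneg mult_nonneg_nonneg intro: order_trans[OF zero_le_one])
    also have "\<dots> = (\<Prod>i<Suc s. w i) * 2 powr (- (gen (Suc s) * \<tau>))"
    proof -
      have "2 powr (- (gen s * \<tau>)) * 2 powr (- (len s * \<tau>)) = 2 powr (- (gen (Suc s) * \<tau>))"
        by (simp add: powr_add[symmetric] gen_Suc algebra_simps)
      then show ?thesis by (simp only: prod.lessThan_Suc mult_ac)
    qed
    finally show ?case .
  qed simp
  moreover have "(\<Prod>i<s. w i) \<le> (\<Prod>i<N. w i)" for s
  proof (cases "s \<le> N")
    case True
    then show ?thesis by (intro prod_mono2) (auto intro: w1 order_trans[OF zero_le_one w1])
  next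
    case False
    have "(\<Prod>i<s. w i) = (\<Prod>i<N. w i)"
      using False by (intro prod.mono_neutral_right) (auto simp: wN)
    then show ?thesis by simp
  qed
  ultimately have "(\<Prod>i<s. z i) \<le> (\<Prod>i<N. w i) * 2 powr (- (gen s * \<tau>))" for s
    by (meson mult_right_mono order_trans powr_ge_zero)
  moreover have "(\<Prod>i<N. w i) \<ge> 1" by (intro prod_ge_1) (auto intro: w1)
  ultimately show ?thesis by (rule that[rotated])
qed

lemma prod_lower:
  fixes z :: "nat \<Rightarrow> real" and \<tau> :: real
  assumes pos: "\<And>i. 0 < z i" and ev: "eventually (\<lambda>i. 2 powr (- (len i * \<tau>)) \<le> z i) sequentially"
  obtains c where "c > 0" "\<And>s. c * 2 powr (- (gen s * \<tau>)) \<le> (\<Prod>i<s. z i)"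
proof -
  have "eventually (\<lambda>i. inverse (z i) \<le> 2 powr (- (len i * (- \<tau>)))) sequentially"
    using ev by eventually_elim (use pos in \<open>auto simp: powr_minus intro: inverse_le_imp_le le_imp_inverse_le\<close>)
  then obtain C where C: "C \<ge> 1" "\<And>s. (\<Prod>i<s. inverse (z i)) \<le> C * 2 powr (- (gen s * (- \<tau>)))"
    using prod_upper[of "\<lambda>i. inverse (z i)" "- \<tau>"] pos by (auto simp: less_imp_le)
  have "inverse C * 2 powr (- (gen s * \<tau>)) \<le> (\<Prod>i<s. z i)" for s
  proof -
    have p: "(\<Prod>i<s. z i) > 0" using pos by (intro prod_pos) auto
    have "inverse (\<Prod>i<s. z i) \<le> C * 2 powr (gen s * \<tau>)"
      using C(2)[of s] by (simp add: prod_inversef[symmetric] comp_def)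
    then have "inverse (C * 2 powr (gen s * \<tau>)) \<le> inverse (inverse (\<Prod>i<s. z i))"
      using p by (intro le_imp_inverse_le) auto
    then show ?thesis by (simp add: powr_minus)
  qed
  then show ?thesis using C by (intro that[of "inverse C"]) auto
qed

primrec pos :: "(nat \<Rightarrow> int) \<Rightarrow> nat \<Rightarrow> int" where
  "pos c 0 = 0"
| "pos c (Suc s) = pos c s * 2 ^ len s + c s"

lemma pos_divmod:
  assumes "0 < v s (c s)"
  shows "pos c (Suc s) div 2 ^ len s = pos c s" "pos c (Suc s) mod 2 ^ len s = c s"
  using digit_range[OF assms] by auto

lemma lam_pos:
  assumes "\<And>i. 0 < v i (c i)"
  shows "lam s (pos c s) = (\<Prod>i<s. v i (c i))"
proof (induction s)
  case (Suc s)
  then show ?case using pos_divmod[of s c] assms by simp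
qed simp

lemma point_exists:
  assumes v: "\<And>i. 0 < v i (c i)"
  obtains x :: real where "x \<in> K" "\<And>s. node s x = pos c s"
proof -
  define a where "a s = real_of_int (pos c s) / 2 ^ gen s" for s
  define b where "b s = (real_of_int (pos c s) + 1) / 2 ^ gen s" for s
  have dig: "4 \<le> c i" "c i \<le> 2 ^ len i - 4" for i using v_digit[OF v[of i]] by auto
  have dig': "real_of_int (c i) \<le> 2 ^ len i - 4" for i
  proof -
    have "real_of_int (c i) \<le> real_of_int (2 ^ len i - 4)" using dig(2)[of i] by (simp only: of_int_le_iff)
    then show ?thesis by simp
  qed
  have aS: "a s \<le> a (Suc s)" for s
    using dig(1)[of s] by (simp add: a_def gen_Suc power_add divide_simps)
  \<comment> \<open>The right end points decrease strictly because no digit is the last child. Hence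
    the limit lies in each half-open interval and has the prescribed floors.\<close>
  have bS: "b (Suc s) < b s" for s
    using dig'[of s] by (simp add: b_def gen_Suc power_add divide_simps) (simp add: algebra_simps)
  have ab: "a s \<le> b s" for s by (simp add: a_def b_def divide_right_mono)
  have inc: "incseq a" using aS by (simp add: incseq_SucI)
  have dec: "decseq b" using bS by (simp add: decseq_SucI less_imp_le)
  have aleb: "a s \<le> b t" for s t
  proof -
    have "a s \<le> a (max s t)" using inc by (simp add: incseqD)
    also have "\<dots> \<le> b (max s t)" by (rule ab)
    also have "\<dots> \<le> b t" using dec by (simp add: decseqD)
    finally show ?thesis .
  qed
  obtain x where x: "a \<longlonglongrightarrow> x" "\<And>s. a s \<le> x"
    using incseq_convergent[OF inc, of "b 0"] aleb by blast
  have xb: "x < b s" for s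
  proof -
    have "x \<le> b (Suc s)" by (rule LIMSEQ_le_const2[OF x(1)]) (use aleb in blast)
    then show ?thesis using bS[of s] by simp
  qed
  have fl: "node s x = pos c s" for s
    using x(2)[of s] xb[of s] by (intro floor_unique) (auto simp: a_def b_def field_simps)
  have "x \<in> K"
    using v by (auto simp: K_def fl lam_pos[OF v] intro: prod_pos)
  with fl show ?thesis using that by blast
qed

end

section \<open>The wavelet series of a cascade\<close>

lemma summable_powr_gen:
  fixes g :: "nat \<Rightarrow> nat" and \<delta> :: real
  assumes "\<And>s. s \<le> g s" "\<delta> > 0"
  shows "summable (\<lambda>s. 2 powr (- (\<delta> * g s)))"
proof (rule summable_comparison_test)
  show "summable (\<lambda>s. (2 powr (- \<delta>)) ^ s)"
    using assms(2) by (intro summable_geometric) (simp add: powr_minus_divide)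
  have "norm (2 powr (- (\<delta> * g s))) \<le> (2 powr (- \<delta>)) ^ s" for s
  proof -
    have "2 powr (- (\<delta> * g s)) \<le> 2 powr (- \<delta> * real s)"
      using assms by (intro powr_mono) (auto intro: mult_left_mono)
    also have "\<dots> = (2 powr (- \<delta>)) ^ s" by (simp only: powr_powr[symmetric] powr_realpow[OF powr_gt_zero[THEN iffD2, OF zero_neq_numeral[symmetric]]])
    finally show ?thesis by simp
  qed
  then show "\<exists>N. \<forall>s\<ge>N. norm (2 powr (- (\<delta> * g s))) \<le> (2 powr (- \<delta>)) ^ s" by blast
qed

context schwartz_wavelet
begin

text \<open>For |w| \<le> 1 the intermediate point is within distance 1 of u, so the remainder
  inherits the decay in u at the cost of a factor 2^M. This decay makes the remainders summable over
  the lattice of one generation.\<close>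

lemma taylor_remainder:
  fixes M :: real
  assumes "M \<ge> 0"
  shows "\<exists>C>0. \<forall>u w. \<bar>w\<bar> \<le> 1 \<longrightarrow>
    \<bar>\<psi> (u + w) - (\<Sum>l<Suc N. D l u / fact l * w ^ l)\<bar> \<le> C * (1 + \<bar>u\<bar>) powr (- M) * \<bar>w\<bar> ^ Suc N"
proof -
  obtain C where C: "C > 0" "\<And>x. \<bar>D (Suc N) x\<bar> \<le> C * (1 + \<bar>x\<bar>) powr (- M)"
    using D_decay[of "Suc N" M] by blast
  have "\<bar>\<psi> (u + w) - (\<Sum>l<Suc N. D l u / fact l * w ^ l)\<bar> \<le> (C * 2 powr M) * (1 + \<bar>u\<bar>) powr (- M) * \<bar>w\<bar> ^ Suc N"
    if w: "\<bar>w\<bar> \<le> 1" for u w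
  proof -
    obtain t where t: "\<bar>t\<bar> \<le> \<bar>w\<bar>" "\<psi> (u + w) = (\<Sum>l<Suc N. D l u / fact l * w ^ l) + D (Suc N) (u + t) / fact (Suc N) * w ^ Suc N"
      using taylor_psi[of w u "Suc N"] by blast
    have "1 + \<bar>u\<bar> \<le> 2 * (1 + \<bar>u + t\<bar>)" using t(1) w by (smt (verit))
    then have "(1 + \<bar>u\<bar>) powr M \<le> (2 * (1 + \<bar>u + t\<bar>)) powr M"
      using assms by (intro powr_mono2) auto
    then have "(1 + \<bar>u\<bar>) powr M \<le> 2 powr M * (1 + \<bar>u + t\<bar>) powr M" by (simp only: powr_mult)
    then have dec: "(1 + \<bar>u + t\<bar>) powr (- M) \<le> 2 powr M * (1 + \<bar>u\<bar>) powr (- M)"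
      by (simp add: powr_minus field_simps add_pos_nonneg)
    have "\<bar>D (Suc N) (u + t)\<bar> / fact (Suc N) \<le> \<bar>D (Suc N) (u + t)\<bar> / 1"
      by (intro divide_left_mono) (auto simp del: fact_Suc)
    also have "\<dots> \<le> C * (1 + \<bar>u + t\<bar>) powr (- M)" using C(2)[of "u + t"] by simp
    also have "\<dots> \<le> C * (2 powr M * (1 + \<bar>u\<bar>) powr (- M))" using C(1) dec by (intro mult_left_mono) auto
    finally have "\<bar>D (Suc N) (u + t)\<bar> / fact (Suc N) * \<bar>w\<bar> ^ Suc N \<le> C * (2 powr M * (1 + \<bar>u\<bar>) powr (- M)) * \<bar>w\<bar> ^ Suc N"
      by (intro mult_right_mono) auto
    moreover have "\<bar>\<psi> (u + w) - (\<Sum>l<Suc N. D l u / fact l * w ^ l)\<bar> = \<bar>D (Suc N) (u + t)\<bar> / fact (Suc N) * \<bar>w\<bar> ^ Suc N"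
      by (simp only: t(2) add_diff_cancel_left' abs_mult abs_divide abs_of_pos[OF fact_gt_zero] power_abs)
    ultimately show ?thesis by (simp only: mult.assoc)
  qed
  moreover have "C * 2 powr M > 0" using C by simp
  ultimately show ?thesis by blast
qed

lemma integrable_psi_affine: "integrable lborel (\<lambda>x. \<psi> (2 powr j * x - k))"
  using lborel_integrable_real_affine[OF integrable_psi, of "2 powr j" "- k"] by simp

lemma integrable_bounded_psi_affine:
  fixes g :: "real \<Rightarrow> real"
  assumes [measurable]: "g \<in> borel_measurable borel" and b: "\<And>x. \<bar>g x\<bar> \<le> B"
  shows "integrable lborel (\<lambda>x. g x * \<psi> (2 powr j * x - k))"
proof (rule Bochner_Integration.integrable_bound)
  show "integrable lborel (\<lambda>x. B * \<psi> (2 powr j * x - k))"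
    by (intro integrable_mult_right integrable_psi_affine)
  show "(\<lambda>x. g x * \<psi> (2 powr j * x - k)) \<in> borel_measurable lborel" by measurable
  have "B \<ge> 0" using b[of 0] by simp
  then show "AE x in lborel. norm (g x * \<psi> (2 powr j * x - k)) \<le> norm (B * \<psi> (2 powr j * x - k))"
    using b by (intro AE_I2) (simp add: abs_mult mult_right_mono)
qed

end

locale wavelet_cascade = schwartz_wavelet + cascade
begin

definition blk :: "nat \<Rightarrow> real \<Rightarrow> real" where
  "blk s x = (\<Sum>p\<in>{0..<2 ^ gen s}. lam s p * \<psi> (off s x p))"

definition F :: "real \<Rightarrow> real" where "F x = (\<Sum>s. blk s x)"

lemma measurable_blk [measurable]: "blk s \<in> borel_measurable borel"
  unfolding blk_def by measurable

lemma measurable_F [measurable]: "F \<in> borel_measurable borel"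
  unfolding F_def by measurable

lemma blk_bound: "\<exists>C>0. \<forall>s x. \<bar>blk s x\<bar> \<le> C * 2 powr (- (\<alpha> * gen s))"
proof -
  obtain L where L: "L > 0" "\<And>u A. finite A \<Longrightarrow> (\<Sum>p\<in>A. (1 + \<bar>u - real_of_int p\<bar>) powr (-2)) \<le> L"
    using lattice_sum_bound by blast
  obtain C where C: "C > 0" "\<And>x. \<bar>\<psi> x\<bar> \<le> C * (1 + \<bar>x\<bar>) powr (-2)"
    using psi_decay[of 2] by blast
  have "\<bar>blk s x\<bar> \<le> (C * L) * 2 powr (- (\<alpha> * gen s))" for s x
  proof -
    have "\<bar>blk s x\<bar> \<le> (\<Sum>p\<in>{0..<2 ^ gen s}. \<bar>lam s p * \<psi> (off s x p)\<bar>)"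
      unfolding blk_def by (rule sum_abs)
    also have "\<dots> \<le> (\<Sum>p\<in>{0..<2 ^ gen s}. 2 powr (- (\<alpha> * gen s)) * (C * (1 + \<bar>off s x p\<bar>) powr (-2)))"
      unfolding abs_mult abs_of_nonneg[OF lam_nonneg]
      by (intro sum_mono mult_mono lam_le C(2)) (auto simp: lam_nonneg)
    also have "\<dots> = 2 powr (- (\<alpha> * gen s)) * (C * (\<Sum>p\<in>{0..<2 ^ gen s}. (1 + \<bar>off s x p\<bar>) powr (-2)))"
      by (simp only: sum_distrib_left)
    also have "\<dots> \<le> 2 powr (- (\<alpha> * gen s)) * (C * L)"
      using C(1) by (intro mult_left_mono L(2)) auto
    finally show ?thesis by (simp only: mult_ac)
  qed
  then show ?thesis using C(1) L(1) by (intro exI[of _ "C * L"]) simp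
qed

lemma summable_decay: "(\<delta> :: real) > 0 \<Longrightarrow> summable (\<lambda>s. 2 powr (- (\<delta> * gen s)))"
  by (rule summable_powr_gen) (rule gen_ge)

lemma summable_blk: "summable (\<lambda>s. \<bar>blk s x\<bar>)" "summable (\<lambda>s. blk s x)"
proof -
  obtain C where C: "\<And>s x. \<bar>blk s x\<bar> \<le> C * 2 powr (- (\<alpha> * gen s))" using blk_bound by blast
  show "summable (\<lambda>s. \<bar>blk s x\<bar>)"
    by (rule summable_comparison_test'[where g = "\<lambda>s. C * 2 powr (- (\<alpha> * gen s))" and N = 0])
      (use C in \<open>auto intro!: summable_mult summable_decay alpha_pos\<close>)
  then show "summable (\<lambda>s. blk s x)" by (rule summable_rabs_cancel)
qed

lemma F_bounded: "\<exists>B>0. \<forall>x. \<bar>F x\<bar> \<le> B"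
proof -
  obtain C where C: "\<And>s x. \<bar>blk s x\<bar> \<le> C * 2 powr (- (\<alpha> * gen s))" using blk_bound by blast
  have "\<bar>F x\<bar> \<le> (\<Sum>s. C * 2 powr (- (\<alpha> * gen s)))" for x
  proof -
    have "\<bar>F x\<bar> \<le> (\<Sum>s. \<bar>blk s x\<bar>)"
      unfolding F_def by (rule summable_rabs[OF summable_blk(1)])
    also have "\<dots> \<le> (\<Sum>s. C * 2 powr (- (\<alpha> * gen s)))"
      by (intro suminf_le C summable_blk summable_mult summable_decay alpha_pos)
    finally show ?thesis .
  qed
  then have "\<forall>x. \<bar>F x\<bar> \<le> max 1 (\<Sum>s. C * 2 powr (- (\<alpha> * gen s)))" by (auto intro: max.coboundedI2)
  then show ?thesis by (intro exI[of _ "max 1 (\<Sum>s. C * 2 powr (- (\<alpha> * gen s)))"]) simp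
qed

lemma F_hoelder: "hoelder_continuous F"
proof -
  \<comment> \<open>\<beta> \<le> 1 lets the Lipschitz bound for t \<le> 1 be weakened to t^\<beta>,
    and \<beta> < \<alpha> leaves a factor 2^(-(\<alpha> - \<beta>) n) that is summable over the
    stages.\<close>
  define \<beta> where "\<beta> = min 1 (\<alpha> / 2)"
  have beta: "0 < \<beta>" "\<beta> \<le> 1" "\<alpha> - \<beta> > 0" using alpha_pos by (auto simp: \<beta>_def min_def)
  obtain L where L: "L > 0" "\<And>u A. finite A \<Longrightarrow> (\<Sum>p\<in>A. (1 + \<bar>u - real_of_int p\<bar>) powr (-2)) \<le> L"
    using lattice_sum_bound by blast
  obtain C where C: "C > 0" "\<And>s x. \<bar>blk s x\<bar> \<le> C * 2 powr (- (\<alpha> * gen s))" using blk_bound by blast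
  obtain R where R: "R > 0" "\<And>u w. \<bar>w\<bar> \<le> 1 \<Longrightarrow>
    \<bar>\<psi> (u + w) - (\<Sum>l<Suc 0. D l u / fact l * w ^ l)\<bar> \<le> R * (1 + \<bar>u\<bar>) powr (- 2) * \<bar>w\<bar> ^ Suc 0"
    using taylor_remainder[of 2 0, OF zero_le_numeral] by blast
  define B where "B = max (2 * C) (R * L)"
  have B: "B \<ge> 2 * C" "B \<ge> R * L" "B > 0" using C by (auto simp: B_def less_max_iff_disj)
  have one: "\<bar>blk s x - blk s y\<bar> \<le> B * \<bar>x - y\<bar> powr \<beta> * 2 powr (- ((\<alpha> - \<beta>) * gen s))" for s x y
  proof -
    define t where "t = 2 ^ gen s * \<bar>x - y\<bar>"
    have t0: "t \<ge> 0" by (simp add: t_def)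
    have "\<bar>blk s x - blk s y\<bar> \<le> 2 powr (- (\<alpha> * gen s)) * (B * t powr \<beta>)"
    proof (cases "t \<le> 1")
      case True
      have eq: "blk s x - blk s y = (\<Sum>p\<in>{0..<2 ^ gen s}. lam s p * (\<psi> (off s x p) - \<psi> (off s y p)))"
        by (simp add: blk_def sum_subtractf[symmetric] right_diff_distrib)
      have "\<bar>blk s x - blk s y\<bar> \<le> (\<Sum>p\<in>{0..<2 ^ gen s}. \<bar>lam s p * (\<psi> (off s x p) - \<psi> (off s y p))\<bar>)"
        unfolding eq by (rule sum_abs)
      also have "\<dots> \<le> (\<Sum>p\<in>{0..<2 ^ gen s}. 2 powr (- (\<alpha> * gen s)) * (R * (1 + \<bar>off s y p\<bar>) powr (-2) * t))"
      proof (rule sum_mono)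
        fix p :: int
        define w where "w = 2 ^ gen s * (x - y)"
        have w: "\<bar>w\<bar> = t" unfolding w_def t_def abs_mult by simp
        have "\<bar>\<psi> ((off s y p) + w) - \<psi> (off s y p)\<bar> \<le> R * (1 + \<bar>off s y p\<bar>) powr (- 2) * t"
          using R(2)[of w "off s y p"] True w by simp
        moreover have "(off s y p) + w = off s x p"
          by (simp add: w_def algebra_simps)
        ultimately show "\<bar>lam s p * (\<psi> (off s x p) - \<psi> (off s y p))\<bar>
          \<le> 2 powr (- (\<alpha> * gen s)) * (R * (1 + \<bar>off s y p\<bar>) powr (-2) * t)"
          unfolding abs_mult abs_of_nonneg[OF lam_nonneg]
          by (intro mult_mono lam_le) (auto simp: lam_nonneg)
      qed
      also have "\<dots> = 2 powr (- (\<alpha> * gen s)) * (R * (\<Sum>p\<in>{0..<2 ^ gen s}. (1 + \<bar>off s y p\<bar>) powr (-2)) * t)"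
        by (simp only: sum_distrib_left sum_distrib_right)
      also have "\<dots> \<le> 2 powr (- (\<alpha> * gen s)) * (R * L * t)"
        using R(1) t0 by (intro mult_left_mono mult_right_mono L(2)) auto
      also have "\<dots> \<le> 2 powr (- (\<alpha> * gen s)) * (B * t powr \<beta>)"
        using B t0 True beta powr_min_interp[of t \<beta> 1] R(1) L(1)
        by (intro mult_left_mono mult_mono) auto
      finally show ?thesis .
    next
      case False
      have "\<bar>blk s x - blk s y\<bar> \<le> \<bar>blk s x\<bar> + \<bar>blk s y\<bar>" by (rule abs_triangle_ineq4)
      also have "\<dots> \<le> C * 2 powr (- (\<alpha> * gen s)) + C * 2 powr (- (\<alpha> * gen s))" by (intro add_mono C)
      also have "\<dots> = 2 powr (- (\<alpha> * gen s)) * (2 * C * 1)" by simp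
      also have "\<dots> \<le> 2 powr (- (\<alpha> * gen s)) * (B * t powr \<beta>)"
        using False beta C(1) B by (intro mult_left_mono mult_mono ge_one_powr_ge_zero) auto
      finally show ?thesis .
    qed
    also have "t powr \<beta> = 2 powr (\<beta> * gen s) * \<bar>x - y\<bar> powr \<beta>"
    proof -
      have "(2::real) ^ gen s = 2 powr real (gen s)" by (simp add: powr_realpow)
      then show ?thesis by (simp only: t_def powr_mult powr_powr mult.commute[of \<beta>])
    qed
    also have "2 powr (- (\<alpha> * gen s)) * (B * (2 powr (\<beta> * gen s) * \<bar>x - y\<bar> powr \<beta>)) =
        B * \<bar>x - y\<bar> powr \<beta> * (2 powr (- (\<alpha> * gen s)) * 2 powr (\<beta> * gen s))" by simp
    also have "2 powr (- (\<alpha> * gen s)) * 2 powr (\<beta> * gen s) = 2 powr (- ((\<alpha> - \<beta>) * gen s))"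
      by (simp add: powr_add[symmetric] algebra_simps)
    finally show ?thesis .
  qed
  define S where "S = (\<Sum>s. 2 powr (- ((\<alpha> - \<beta>) * gen s)))"
  have "\<bar>F x - F y\<bar> \<le> (B * S) * \<bar>x - y\<bar> powr \<beta>" for x y
  proof -
    have eq: "F x - F y = (\<Sum>s. blk s x - blk s y)"
      unfolding F_def by (rule suminf_diff[OF summable_blk(2) summable_blk(2)])
    have "\<bar>F x - F y\<bar> \<le> (\<Sum>s. B * \<bar>x - y\<bar> powr \<beta> * 2 powr (- ((\<alpha> - \<beta>) * gen s)))"
    proof -
      have sm: "summable (\<lambda>s. B * \<bar>x - y\<bar> powr \<beta> * 2 powr (- ((\<alpha> - \<beta>) * gen s)))"
        by (intro summable_mult summable_decay beta)
      then have sa: "summable (\<lambda>s. \<bar>blk s x - blk s y\<bar>)"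
        by (rule summable_comparison_test'[where N = 0]) (use one in auto)
      have "\<bar>\<Sum>s. blk s x - blk s y\<bar> \<le> (\<Sum>s. \<bar>blk s x - blk s y\<bar>)" by (rule summable_rabs[OF sa])
      also have "\<dots> \<le> (\<Sum>s. B * \<bar>x - y\<bar> powr \<beta> * 2 powr (- ((\<alpha> - \<beta>) * gen s)))"
        by (rule suminf_le[OF one sa sm])
      finally show ?thesis unfolding eq .
    qed
    also have "\<dots> = B * \<bar>x - y\<bar> powr \<beta> * S"
      unfolding S_def by (rule suminf_mult[OF summable_decay[OF beta(3)]])
    finally show ?thesis by (simp only: mult_ac)
  qed
  then show ?thesis unfolding hoelder_continuous_def using beta(1) by blast
qed

lemma lam_eq_0: "k \<notin> {0..<2 ^ gen s} \<Longrightarrow> lam s k = 0"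
  using lam_pos_range[of s k] lam_nonneg[of s k] by force

lemma blk_inner:
  "(LINT x|lborel. blk s x * \<psi> (2 powr real_of_int j * x - real_of_int k)) =
     (if j = int (gen s) then lam s k * 2 powr (- real_of_int j) else 0)"
proof -
  have eq: "blk s x * \<psi> (2 powr real_of_int j * x - real_of_int k) =
     (\<Sum>p\<in>{0..<2 ^ gen s}. lam s p * (\<psi> (2 powr real_of_int (int (gen s)) * x - real_of_int p) * \<psi> (2 powr real_of_int j * x - real_of_int k)))" for x
    by (simp add: blk_def sum_distrib_right powr_realpow mult.assoc)
  obtain C where C: "\<And>x. \<bar>\<psi> x\<bar> \<le> C" using D_bounded[of 0] by auto
  have int: "integrable lborel (\<lambda>x. \<psi> (2 powr real_of_int (int (gen s)) * x - real_of_int p) * \<psi> (2 powr real_of_int j * x - real_of_int k))" for p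
    by (rule integrable_bounded_psi_affine[where B = C]) (measurable, rule C)
  have "(LINT x|lborel. blk s x * \<psi> (2 powr real_of_int j * x - real_of_int k)) =
     (\<Sum>p\<in>{0..<2 ^ gen s}. LINT x|lborel. lam s p * (\<psi> (2 powr real_of_int (int (gen s)) * x - real_of_int p) * \<psi> (2 powr real_of_int j * x - real_of_int k)))"
    unfolding eq by (rule Bochner_Integration.integral_sum) (intro integrable_mult_right int)
  also have "\<dots> = (\<Sum>p\<in>{0..<2 ^ gen s}. if p = k then (if j = int (gen s) then lam s k * 2 powr (- real_of_int j) else 0) else 0)"
    by (intro sum.cong refl, subst integral_mult_right_zero, subst wavelet_inner) auto
  also have "\<dots> = (if j = int (gen s) then lam s k * 2 powr (- real_of_int j) else 0)"
    using lam_eq_0[of k s] by simp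
  finally show ?thesis .
qed

text \<open>Termwise integration is justified by the uniform decay of the blocks and the
  integrability of \<psi>; orthogonality then evaluates each term.\<close>

lemma wcoeff_sums:
  "(\<lambda>s. if j = int (gen s) then lam s k else 0) sums wcoeff \<psi> F j k"
proof -
  define ph where "ph x = \<psi> (2 powr real_of_int j * x - real_of_int k)" for x
  have [measurable]: "ph \<in> borel_measurable borel" unfolding ph_def by measurable
  obtain C where C: "C > 0" "\<And>s x. \<bar>blk s x\<bar> \<le> C * 2 powr (- (\<alpha> * gen s))" using blk_bound by blast
  have inth: "integrable lborel (\<lambda>x. \<bar>ph x\<bar>)"
    unfolding ph_def by (rule integrable_abs[OF integrable_psi_affine])
  have int: "integrable lborel (\<lambda>x. blk s x * ph x)" for s
    unfolding ph_def by (rule integrable_bounded_psi_affine[where B = "C * 2 powr (- (\<alpha> * gen s))"]) (measurable, rule C(2))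
  have "(\<lambda>s. LINT x|lborel. blk s x * ph x) sums (LINT x|lborel. (\<Sum>s. blk s x * ph x))"
  proof (rule sums_integral[OF int])
    show "AE x in lborel. summable (\<lambda>s. norm (blk s x * ph x))"
      by (intro AE_I2) (simp add: abs_mult summable_mult2 summable_blk)
    show "summable (\<lambda>s. LINT x|lborel. norm (blk s x * ph x))"
    proof (rule summable_comparison_test'[where N = 0])
      show "summable (\<lambda>s. (C * (LINT x|lborel. \<bar>ph x\<bar>)) * 2 powr (- (\<alpha> * gen s)))"
        by (intro summable_mult summable_decay alpha_pos)
      fix s
      have "(LINT x|lborel. norm (blk s x * ph x)) \<le> (LINT x|lborel. C * 2 powr (- (\<alpha> * gen s)) * \<bar>ph x\<bar>)"
        using int[of s] inth C(2)
        by (intro integral_mono integrable_norm integrable_mult_right) (auto simp: abs_mult intro!: mult_right_mono)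
      also have "\<dots> = (C * (LINT x|lborel. \<bar>ph x\<bar>)) * 2 powr (- (\<alpha> * gen s))"
        by simp
      finally show "norm (LINT x|lborel. norm (blk s x * ph x)) \<le> (C * (LINT x|lborel. \<bar>ph x\<bar>)) * 2 powr (- (\<alpha> * gen s))"
        by simp
    qed
  qed
  also have "(\<lambda>x. \<Sum>s. blk s x * ph x) = (\<lambda>x. F x * ph x)"
    unfolding F_def by (rule ext) (rule suminf_mult2[OF summable_blk(2), symmetric])
  finally have "(\<lambda>s. 2 powr real_of_int j * (LINT x|lborel. blk s x * ph x)) sums (2 powr real_of_int j * (LINT x|lborel. F x * ph x))"
    by (rule sums_mult)
  moreover have "2 powr real_of_int j * (LINT x|lborel. blk s x * ph x) = (if j = int (gen s) then lam s k else 0)" for s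
    unfolding ph_def blk_inner by (simp add: powr_minus)
  ultimately show ?thesis unfolding wcoeff_def ph_def by simp
qed

lemma wcoeff_gen: "wcoeff \<psi> F (int (gen s)) k = lam s k"
proof -
  have "(\<lambda>t. if int (gen s) = int (gen t) then lam t k else 0) = (\<lambda>t. if t = s then lam t k else 0)"
    using strict_mono_eq[OF gen_strict_mono] by auto
  then have "(\<lambda>t. if t = s then lam t k else 0) sums wcoeff \<psi> F (int (gen s)) k"
    using wcoeff_sums[of "int (gen s)" k] by simp
  then show ?thesis using sums_single[of s "\<lambda>t. lam t k"] sums_unique2 by blast
qed

lemma wcoeff_not_gen: "j \<notin> range (\<lambda>s. int (gen s)) \<Longrightarrow> wcoeff \<psi> F j k = 0"
proof -
  assume "j \<notin> range (\<lambda>s. int (gen s))"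
  then have "\<And>s. j \<noteq> int (gen s)" by blast
  then have "(\<lambda>s. if j = int (gen s) then lam s k else 0) = (\<lambda>_. 0)" by simp
  then have "(\<lambda>_. 0) sums wcoeff \<psi> F j k" using wcoeff_sums[of j k] by simp
  then show ?thesis using sums_0 sums_unique2 by blast
qed

end

section \<open>Wavelet leaders and the scaling function\<close>

context wavelet_cascade
begin

abbreviation leader :: "nat \<Rightarrow> int \<Rightarrow> real" where "leader n k \<equiv> wleader \<psi> F (int n) k"

lemma wcoeff_cases:
  obtains t where "j = int (gen t)" "\<bar>wcoeff \<psi> F j k\<bar> = lam t k" | "wcoeff \<psi> F j k = 0"
proof (cases "j \<in> range (\<lambda>s. int (gen s))")
  case True
  then obtain t where "j = int (gen t)" by blast
  then show ?thesis using that(1)[of t] by (simp add: wcoeff_gen lam_nonneg)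
next
  case False
  then show ?thesis using that(2) wcoeff_not_gen by blast
qed

lemma leader_ge:
  assumes "n \<le> gen t" "p div 2 ^ (gen t - n) \<in> {k - 1, k, k + 1}"
  shows "lam t p \<le> leader n k"
  unfolding wleader_def
proof (rule cSup_upper)
  have "lam t p = \<bar>wcoeff \<psi> F (int (gen t)) p\<bar>" by (simp add: wcoeff_gen lam_nonneg)
  moreover have "nat (int (gen t) - int n) = gen t - n" by simp
  ultimately show "lam t p \<in> {\<bar>wcoeff \<psi> F j' k'\<bar> |j' k'. int n \<le> j' \<and> k' div 2 ^ nat (j' - int n) \<in> {k - 1, k, k + 1}}"
    using assms by (intro CollectI exI[of _ "int (gen t)"] exI[of _ p]) auto
  show "bdd_above {\<bar>wcoeff \<psi> F j' k'\<bar> |j' k'. int n \<le> j' \<and> k' div 2 ^ nat (j' - int n) \<in> {k - 1, k, k + 1}}"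
  proof (rule bdd_aboveI[of _ 1])
    fix x assume "x \<in> {\<bar>wcoeff \<psi> F j' k'\<bar> |j' k'. int n \<le> j' \<and> k' div 2 ^ nat (j' - int n) \<in> {k - 1, k, k + 1}}"
    then obtain j' k' where "x = \<bar>wcoeff \<psi> F j' k'\<bar>" by blast
    then show "x \<le> 1"
      by (cases rule: wcoeff_cases[of j' k']) (use lam_le_1 in auto)
  qed
qed

text \<open>\<open>s\<close> is the first stage of generation at least \<open>n\<close>. Every
  deeper node below the three intervals has an ancestor of stage \<open>s\<close> below them, and
  weights do not increase along a branch, so the supremum is a maximum over finitely many nodes of
  stage \<open>s\<close>.\<close>

lemma leader_attained:
  assumes pos: "0 < leader n k" and s: "n \<le> gen s" "\<And>r. n \<le> gen r \<Longrightarrow> s \<le> r"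
  obtains p where "0 < lam s p" "p div 2 ^ (gen s - n) \<in> {k - 1, k, k + 1}" "leader n k = lam s p"
proof -
  define P where "P = {p \<in> {0..<2 ^ gen s}. p div 2 ^ (gen s - n) \<in> {k - 1, k, k + 1}}"
  \<comment> \<open>The 0 accounts for coefficients of generations that are not stages, and keeps
    the set nonempty.\<close>
  define Y where "Y = insert 0 (lam s ` P)"
  have "finite P" unfolding P_def by (rule finite_subset[of _ "{0..<2 ^ gen s}"]) auto
  then have fin: "finite Y" "Y \<noteq> {}" by (auto simp: Y_def)
  have "leader n k \<le> Max Y"
    unfolding wleader_def
  proof (rule cSup_least)
    have "\<bar>wcoeff \<psi> F (int n) k\<bar> \<in> {\<bar>wcoeff \<psi> F j' k'\<bar> |j' k'. int n \<le> j' \<and> k' div 2 ^ nat (j' - int n) \<in> {k - 1, k, k + 1}}"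
      by (intro CollectI exI[of _ "int n"] exI[of _ k]) auto
    then show "{\<bar>wcoeff \<psi> F j' k'\<bar> |j' k'. int n \<le> j' \<and> k' div 2 ^ nat (j' - int n) \<in> {k - 1, k, k + 1}} \<noteq> {}"
      by (metis empty_iff)
  next
    fix x assume "x \<in> {\<bar>wcoeff \<psi> F j' k'\<bar> |j' k'. int n \<le> j' \<and> k' div 2 ^ nat (j' - int n) \<in> {k - 1, k, k + 1}}"
    then obtain j' k' where x: "x = \<bar>wcoeff \<psi> F j' k'\<bar>" "int n \<le> j'" "k' div 2 ^ nat (j' - int n) \<in> {k - 1, k, k + 1}"
      by blast
    show "x \<le> Max Y"
    proof (cases "x \<le> 0")
      case True
      also have "0 \<le> Max Y" using fin by (intro Max_ge) (auto simp: Y_def)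
      finally show ?thesis .
    next
      case False
      with x(1) obtain t where t: "j' = int (gen t)" "x = lam t k'" using wcoeff_cases[of j' k'] by auto
      have nt: "n \<le> gen t" using x(2) t by simp
      then have st: "s \<le> t" by (rule s(2))
      define p where "p = k' div 2 ^ (gen t - gen s)"
      have le: "lam t k' \<le> lam s p" unfolding p_def by (rule lam_ancestor[OF st])
      have "gen t - n = (gen t - gen s) + (gen s - n)" using s(1) gen_mono[OF st] by simp
      then have "p div 2 ^ (gen s - n) = k' div 2 ^ (gen t - n)"
        by (simp add: p_def power_add zdiv_zmult2_eq)
      moreover have "nat (j' - int n) = gen t - n" using t by simp
      moreover have "p \<in> {0..<2 ^ gen s}" using lam_eq_0[of p s] le t False by force
      ultimately have "p \<in> P" using x(3) by (simp add: P_def)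
      then have "lam s p \<le> Max Y" using fin by (intro Max_ge) (auto simp: Y_def)
      then show ?thesis using le t by simp
    qed
  qed
  moreover have "Max Y \<in> Y" using fin by (rule Max_in)
  ultimately obtain p where p: "p \<in> P" "Max Y = lam s p"
    using pos unfolding Y_def by force
  have "lam s p \<le> leader n k" using p s(1) by (intro leader_ge) (auto simp: P_def)
  then have "leader n k = lam s p" using \<open>leader n k \<le> Max Y\<close> p by simp
  then show ?thesis using that[of p] p pos by (auto simp: P_def)
qed

text \<open>Nodes of one stage are at distance at least 4, so neither neighbour of a node is a node,
  and deeper coefficients are dominated by those of the stage.\<close>

lemma leader_node: "0 < lam s p \<Longrightarrow> leader (gen s) p = lam s p"
proof -
  assume p: "0 < lam s p"
  have ge: "lam s p \<le> leader (gen s) p" by (rule leader_ge) auto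
  obtain p' where p': "0 < lam s p'" "p' div 2 ^ (gen s - gen s) \<in> {p - 1, p, p + 1}" "leader (gen s) p = lam s p'"
  proof (rule leader_attained)
    show "0 < leader (gen s) p" using p ge by simp
    show "s \<le> r" if "gen s \<le> gen r" for r using that strict_mono_less_eq[OF gen_strict_mono] by simp
  qed auto
  have "p' = p"
  proof (rule ccontr)
    assume "p' \<noteq> p"
    then have "4 \<le> \<bar>p' - p\<bar>" using lam_separated p p' by blast
    moreover have "p' \<in> {p - 1, p, p + 1}" using p'(2) by simp
    ultimately show False by auto
  qed
  then show ?thesis using p' by simp
qed

lemma wsupp_eq: "wsupp \<psi> F = K"
proof (intro equalityI subsetI)
  fix x assume x: "x \<in> wsupp \<psi> F"
  have "0 < lam s (node s x)" for s
  proof -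
    \<comment> \<open>A positive leader only yields a node at most one interval away from
      \<open>x\<close>. Reading it one stage deeper than needed turns this into equality of the
      parents.\<close>
    define n where "n = gen (Suc s)"
    have n: "n \<ge> 1" using gen_ge[of "Suc s"] by (simp add: n_def)
    then have "0 < leader n \<lfloor>2 ^ n * x\<rfloor>" using x unfolding wsupp_def by blast
    then obtain p where p: "0 < lam (Suc s) p" "p div 2 ^ (gen (Suc s) - n) \<in> {\<lfloor>2 ^ n * x\<rfloor> - 1, \<lfloor>2 ^ n * x\<rfloor>, \<lfloor>2 ^ n * x\<rfloor> + 1}"
    proof (rule leader_attained)
      show "n \<le> gen (Suc s)" by (simp add: n_def)
      show "Suc s \<le> r" if "n \<le> gen r" for r
        using that strict_mono_less_eq[OF gen_strict_mono] unfolding n_def by blast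
    qed
    have "p \<in> {node (Suc s) x - 1, node (Suc s) x, node (Suc s) x + 1}"
      using p(2) by (simp add: n_def)
    then have "\<bar>node (Suc s) x - p\<bar> \<le> 1" by auto
    then have "node s x = p div 2 ^ len s" by (rule near_node_floor[OF p(1)])
    then show ?thesis using lam_SucD[OF p(1)] by simp
  qed
  then show "x \<in> K" by (simp add: K_def)
next
  fix x assume x: "x \<in> K"
  have "0 < leader n \<lfloor>2 ^ n * x\<rfloor>" for n
  proof -
    have "n \<le> gen n" by (rule gen_ge)
    then have "lam n (node n x) \<le> leader n \<lfloor>2 ^ n * x\<rfloor>"
      using floor_power_div[of n "gen n - n" x] by (intro leader_ge) auto
    then show ?thesis using x unfolding K_def by (smt (verit) mem_Collect_eq)
  qed
  then show "x \<in> wsupp \<psi> F" using K_range[OF x] by (simp add: wsupp_def)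
qed

definition lsum :: "real \<Rightarrow> nat \<Rightarrow> real" where
  "lsum q n = (\<Sum>k\<in>Gstar \<psi> F n. leader n k powr q)"

lemma finite_Gstar: "finite (Gstar \<psi> F n)"
  unfolding Gstar_def by (rule finite_subset[of _ "{0..<2 ^ n}"]) auto

text \<open>Each positive leader is the weight of some node of stage \<open>s\<close>, and a node is
  seen by at most three intervals of generation \<open>n\<close>; hence the factor 3, for q of
  either sign.\<close>

lemma lsum_upper:
  assumes s: "n \<le> gen s" "\<And>r. n \<le> gen r \<Longrightarrow> s \<le> r"
  shows "lsum q n \<le> 3 * (\<Prod>i<s. Z i q)"
proof -
  define P where "P = {0..<2 ^ gen s :: int}"
  define near where "near k p \<longleftrightarrow> p div 2 ^ (gen s - n) \<in> {k - 1, k, k + 1}" for k p :: int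
  note finG = finite_Gstar[of n]
  have "lsum q n \<le> (\<Sum>k\<in>Gstar \<psi> F n. \<Sum>p\<in>P. if near k p then lam s p powr q else 0)"
    unfolding lsum_def
  proof (rule sum_mono)
    fix k assume "k \<in> Gstar \<psi> F n"
    then have "0 < leader n k" by (simp add: Gstar_def)
    then obtain p where p: "0 < lam s p" "near k p" "leader n k = lam s p"
      unfolding near_def by (rule leader_attained[OF _ s])
    have "lam s p powr q = (if near k p then lam s p powr q else 0)" using p by simp
    also have "\<dots> \<le> (\<Sum>p\<in>P. if near k p then lam s p powr q else 0)"
      using lam_pos_range[OF p(1)] by (intro member_le_sum) (auto simp: P_def)
    finally show "leader n k powr q \<le> (\<Sum>p\<in>P. if near k p then lam s p powr q else 0)" using p by simp
  qed
  also have "\<dots> = (\<Sum>p\<in>P. \<Sum>k\<in>Gstar \<psi> F n. if near k p then lam s p powr q else 0)"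
    by (rule sum.swap)
  also have "\<dots> \<le> (\<Sum>p\<in>P. 3 * lam s p powr q)"
  proof (rule sum_mono)
    fix p :: int
    define d where "d = p div 2 ^ (gen s - n)"
    have "(\<Sum>k\<in>Gstar \<psi> F n. if near k p then lam s p powr q else 0) = (\<Sum>k\<in>{k\<in>Gstar \<psi> F n. near k p}. lam s p powr q)"
      using finG by (simp add: sum.If_cases Int_def)
    also have "\<dots> \<le> (\<Sum>k\<in>{d - 1, d, d + 1}. lam s p powr q)"
      by (intro sum_mono2) (auto simp: near_def d_def)
    also have "\<dots> = 3 * lam s p powr q" by simp
    finally show "(\<Sum>k\<in>Gstar \<psi> F n. if near k p then lam s p powr q else 0) \<le> 3 * lam s p powr q" .
  qed
  also have "\<dots> = 3 * (\<Prod>i<s. Z i q)"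
    by (simp add: sum_distrib_left[symmetric] P_def partition_function)
  finally show ?thesis .
qed

text \<open>At a stage the nodes are among the intervals with positive leader, and there the leader
  is the weight.\<close>

lemma lsum_lower: "(\<Prod>i<s. Z i q) \<le> lsum q (gen s)"
proof -
  have "(\<Prod>i<s. Z i q) = (\<Sum>p\<in>{0..<2 ^ gen s}. lam s p powr q)" by (simp add: partition_function)
  also have "\<dots> = (\<Sum>p\<in>{p\<in>{0..<2 ^ gen s}. 0 < lam s p}. lam s p powr q)"
    by (rule sum.mono_neutral_right) (use lam_nonneg in \<open>auto simp: order.order_iff_strict\<close>)
  also have "\<dots> = (\<Sum>p\<in>{p\<in>{0..<2 ^ gen s}. 0 < lam s p}. leader (gen s) p powr q)"
    by (rule sum.cong) (auto simp: leader_node)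
  also have "\<dots> \<le> lsum q (gen s)"
    unfolding lsum_def by (rule sum_mono2[OF finite_Gstar]) (auto simp: Gstar_def leader_node)
  finally show ?thesis .
qed

lemma stage_exists:
  obtains st where "\<And>n. n \<le> gen (st n)" "\<And>n r. n \<le> gen r \<Longrightarrow> st n \<le> r"
proof
  define st where "st n = (LEAST s. n \<le> gen s)" for n
  show "n \<le> gen (LEAST s. n \<le> gen s)" for n by (rule LeastI[of _ n]) (rule gen_ge)
  show "(LEAST s. n \<le> gen s) \<le> r" if "n \<le> gen r" for n r using that by (rule Least_le)
qed

text \<open>If r is the stage before \<open>st n\<close>, then \<open>gen r\<close> < n \<le>
  \<open>gen (Suc r)\<close>, and the ratio of these two generations tends to 1.\<close>

lemma stage_ratio:
  assumes st: "\<And>n. n \<le> gen (st n)" "\<And>n r. n \<le> gen r \<Longrightarrow> st n \<le> r"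
  shows "(\<lambda>n. real (gen (st n)) / real n) \<longlonglongrightarrow> 1"
proof -
  define r where "r n = st n - 1" for n
  have rs: "st n = Suc (r n)" "gen (r n) < n" if "n \<ge> 1" for n
  proof -
    have "st n \<noteq> 0" using st(1)[of n] that by (cases "st n") auto
    then show "st n = Suc (r n)" by (simp add: r_def)
    then show "gen (r n) < n" using st(2)[of n "r n"] by (metis not_less not_less_eq_eq order_refl)
  qed
  have rinf: "filterlim r at_top sequentially"
    unfolding filterlim_at_top
  proof
    fix R
    show "\<forall>\<^sub>F n in sequentially. R \<le> r n"
      using eventually_gt_at_top[of "gen R"]
    proof eventually_elim
      case (elim n)
      then have "gen R < gen (Suc (r n))" using st(1)[of n] rs[of n] by simp
      then have "R < Suc (r n)" using strict_mono_less[OF gen_strict_mono] by blast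
      then show ?case by simp
    qed
  qed
  show ?thesis
  proof (rule tendsto_sandwich)
    show "(\<lambda>_. 1) \<longlonglongrightarrow> (1::real)" by simp
    show "(\<lambda>n. real (gen (Suc (r n))) / real (gen (r n))) \<longlonglongrightarrow> 1"
      using filterlim_compose[OF ratio_Suc rinf] .
    show "\<forall>\<^sub>F n in sequentially. 1 \<le> real (gen (st n)) / real n"
      using eventually_ge_at_top[of 1]
      by eventually_elim (use st(1) in \<open>auto simp: field_simps\<close>)
    have "\<forall>\<^sub>F n in sequentially. 1 \<le> r n" using rinf unfolding filterlim_at_top by blast
    then show "\<forall>\<^sub>F n in sequentially. real (gen (st n)) / real n \<le> real (gen (Suc (r n))) / real (gen (r n))"
      using eventually_ge_at_top[of 1]
    proof eventually_elim
      case (elim n)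
      have "0 < gen (r n)" using gen_ge[of "r n"] elim by simp
      then show ?case unfolding rs(1)[OF elim(2)] using rs(2)[OF elim(2)]
        by (intro divide_left_mono) auto
    qed
  qed
qed

lemma scaling_fun_lsum:
  "scaling_fun \<psi> F q = liminf (\<lambda>n. if lsum q n = 0 then \<infinity> else ereal (- (1 / real n) * log 2 (lsum q n)))"
  unfolding scaling_fun_def lsum_def Let_def by (rule refl)

lemma lsum_nonneg: "0 \<le> lsum q n"
  unfolding lsum_def by (intro sum_nonneg) simp

text \<open>Every generation n matters here; n is compared with the next stage, whose generation is
  (1 + o(1)) n.\<close>

lemma scaling_fun_ge:
  fixes \<tau> :: real
  assumes "\<forall>\<^sub>F i in sequentially. Z i q \<le> 2 powr (- (len i * \<tau>))"
  shows "ereal \<tau> \<le> scaling_fun \<psi> F q"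
proof -
  obtain C where C: "C \<ge> 1" "\<And>s. (\<Prod>i<s. Z i q) \<le> C * 2 powr (- (gen s * \<tau>))"
    using prod_upper[of "\<lambda>i. Z i q" \<tau>] assms Z_pos by (metis less_imp_le)
  obtain st where st: "\<And>n. n \<le> gen (st n)" "\<And>n r. n \<le> gen r \<Longrightarrow> st n \<le> r" by (rule stage_exists) blast
  define u where "u n = real (gen (st n)) / real n * \<tau> - log 2 (3 * C) / real n" for n
  have "u \<longlonglongrightarrow> 1 * \<tau> - 0"
    unfolding u_def by (intro tendsto_intros stage_ratio st lim_const_over_n) auto
  then have "(\<lambda>n. ereal (u n)) \<longlonglongrightarrow> ereal \<tau>" by simp
  then have "liminf (\<lambda>n. ereal (u n)) = ereal \<tau>" by (rule lim_imp_Liminf[OF sequentially_bot])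
  moreover have "liminf (\<lambda>n. ereal (u n)) \<le> scaling_fun \<psi> F q"
    unfolding scaling_fun_lsum
  proof (rule Liminf_mono)
    show "\<forall>\<^sub>F n in sequentially. ereal (u n) \<le> (if lsum q n = 0 then \<infinity> else ereal (- (1 / real n) * log 2 (lsum q n)))"
      using eventually_ge_at_top[of 1]
    proof eventually_elim
      case (elim n)
      show ?case
      proof (cases "lsum q n = 0")
        case False
        then have pos: "0 < lsum q n" using lsum_nonneg[of q n] by simp
        have "lsum q n \<le> 3 * (\<Prod>i<st n. Z i q)" by (rule lsum_upper[OF st(1) st(2)])
        also have "\<dots> \<le> 3 * C * 2 powr (- (gen (st n) * \<tau>))" using C(2)[of "st n"] by simp
        finally have "log 2 (lsum q n) \<le> log 2 (3 * C * 2 powr (- (gen (st n) * \<tau>)))"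
          using pos C(1) by (intro log_mono) auto
        also have "\<dots> = log 2 (3 * C) - gen (st n) * \<tau>"
          using C(1) by (subst log_mult) auto
        finally have "(gen (st n) * \<tau> - log 2 (3 * C)) / real n \<le> - log 2 (lsum q n) / real n"
          by (intro divide_right_mono) auto
        then show ?thesis using False by (simp add: u_def diff_divide_distrib)
      qed simp
    qed
  qed
  ultimately show ?thesis by simp
qed

text \<open>A lower limit is bounded above along any subsequence, so the generations of the stages
  suffice.\<close>

lemma scaling_fun_le:
  fixes \<tau> :: real
  assumes "\<forall>\<^sub>F i in sequentially. 2 powr (- (len i * \<tau>)) \<le> Z i q"
  shows "scaling_fun \<psi> F q \<le> ereal \<tau>"
proof -
  obtain c where c: "c > 0" "\<And>s. c * 2 powr (- (gen s * \<tau>)) \<le> (\<Prod>i<s. Z i q)"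
    using prod_lower[of "\<lambda>i. Z i q" \<tau>] assms Z_pos by blast
  define u where "u s = \<tau> - log 2 c / real (gen s)" for s
  have "u \<longlonglongrightarrow> \<tau> - 0"
    unfolding u_def using gen_at_top
    by (intro tendsto_diff tendsto_const real_tendsto_divide_at_top[OF tendsto_const])
  then have "(\<lambda>s. ereal (u s)) \<longlonglongrightarrow> ereal \<tau>" by simp
  then have lim: "liminf (\<lambda>s. ereal (u s)) = ereal \<tau>" by (rule lim_imp_Liminf[OF sequentially_bot])
  define X where "X = (\<lambda>n. if lsum q n = 0 then \<infinity> else ereal (- (1 / real n) * log 2 (lsum q n)))"
  have "scaling_fun \<psi> F q \<le> liminf (X \<circ> gen)"
    unfolding scaling_fun_lsum X_def by (rule liminf_subseq_mono[OF gen_strict_mono])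
  also have "\<dots> \<le> liminf (\<lambda>s. ereal (u s))"
  proof (rule Liminf_mono)
    show "\<forall>\<^sub>F s in sequentially. (X \<circ> gen) s \<le> ereal (u s)"
      using eventually_ge_at_top[of 1]
    proof eventually_elim
      case (elim s)
      have g: "gen s > 0" using elim gen_ge[of s] by linarith
      have cp: "0 < c * 2 powr (- (gen s * \<tau>))" using c by simp
      have ge: "c * 2 powr (- (gen s * \<tau>)) \<le> lsum q (gen s)" using c(2)[of s] lsum_lower[where s = s and q = q] by linarith
      have "log 2 c - gen s * \<tau> = log 2 (c * 2 powr (- (gen s * \<tau>)))"
        using c(1) by (subst log_mult) auto
      also have "\<dots> \<le> log 2 (lsum q (gen s))" using ge cp by (intro log_mono) auto
      finally have "- log 2 (lsum q (gen s)) / gen s \<le> (gen s * \<tau> - log 2 c) / gen s"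
        by (intro divide_right_mono) auto
      also have "\<dots> = u s" using g by (simp add: u_def diff_divide_distrib)
      finally show ?case using ge cp by (auto simp: X_def)
    qed
  qed
  finally show ?thesis using lim by simp
qed

end

section \<open>Pointwise regularity\<close>

lemma poly_growth:
  fixes P :: "real poly"
  obtains A where "A \<ge> 0" "\<And>z. \<bar>poly P z\<bar> \<le> A * (1 + \<bar>z\<bar>) ^ degree P"
proof
  define A where "A = (\<Sum>i\<le>degree P. \<bar>coeff P i\<bar>)"
  show "A \<ge> 0" by (simp add: A_def sum_nonneg)
  show "\<bar>poly P z\<bar> \<le> A * (1 + \<bar>z\<bar>) ^ degree P" for z
  proof -
    have "\<bar>poly P z\<bar> \<le> (\<Sum>i\<le>degree P. \<bar>coeff P i * z ^ i\<bar>)"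
      unfolding poly_altdef by (rule sum_abs)
    also have "\<dots> \<le> (\<Sum>i\<le>degree P. \<bar>coeff P i\<bar> * (1 + \<bar>z\<bar>) ^ degree P)"
    proof (rule sum_mono)
      fix i assume "i \<in> {..degree P}"
      then have "\<bar>z\<bar> ^ i \<le> (1 + \<bar>z\<bar>) ^ i" "(1 + \<bar>z\<bar>) ^ i \<le> (1 + \<bar>z\<bar>) ^ degree P"
        by (auto intro!: power_mono power_increasing)
      then show "\<bar>coeff P i * z ^ i\<bar> \<le> \<bar>coeff P i\<bar> * (1 + \<bar>z\<bar>) ^ degree P"
        unfolding abs_mult power_abs by (intro mult_left_mono) auto
    qed
    also have "\<dots> = A * (1 + \<bar>z\<bar>) ^ degree P" by (simp only: A_def sum_distrib_right)
    finally show ?thesis .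
  qed
qed

context wavelet_cascade
begin

text \<open>The vanishing moments allow the polynomial to be subtracted from F without changing the
  coefficient of the interval at x0; only a difference of order |x - x0|^h is integrated.\<close>

lemma hoelder_exp_gt_imp_lam_le:
  fixes h' x0 :: real
  assumes h': "ereal h' < hoelder_exp F x0"
  shows "\<forall>\<^sub>F s in sequentially. lam s (node s x0) \<le> 2 powr (- (gen s * h'))"
proof -
  obtain h P C \<delta> where h: "h' < h" "h \<ge> 0" and del: "\<delta> > 0"
    and bd: "\<And>x. \<bar>x - x0\<bar> < \<delta> \<Longrightarrow> \<bar>F x - poly P (x - x0)\<bar> \<le> C * \<bar>x - x0\<bar> powr h"
    using h' unfolding hoelder_exp_def less_Sup_iff by auto
  define d where "d = degree P"
  obtain A where A: "A \<ge> 0" "\<And>z. \<bar>poly P z\<bar> \<le> A * (1 + \<bar>z\<bar>) ^ d"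
    using poly_growth[of P] unfolding d_def by blast
  obtain B where B: "B > 0" "\<And>x. \<bar>F x\<bar> \<le> B" using F_bounded by blast
  \<comment> \<open>The Hoelder bound holds only near x0. Farther away F is bounded and P grows
    polynomially, and \<delta>^(-h) |x - x0|^h is at least 1 there, which merges both regimes into
    one constant.\<close>
  define G where "G = \<bar>C\<bar> + (B + A) * \<delta> powr (- h)"
  have G0: "G \<ge> 0" using A B by (simp add: G_def)
  have glob: "\<bar>F x - poly P (x - x0)\<bar> \<le> G * \<bar>x - x0\<bar> powr h * (1 + \<bar>x - x0\<bar>) ^ d" for x
  proof (cases "\<bar>x - x0\<bar> < \<delta>")
    case True
    have "\<bar>F x - poly P (x - x0)\<bar> \<le> C * \<bar>x - x0\<bar> powr h" by (rule bd[OF True])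
    also have "\<dots> \<le> G * \<bar>x - x0\<bar> powr h"
      using A B by (intro mult_right_mono) (auto simp: G_def intro: order_trans[OF abs_ge_self])
    also have "\<dots> \<le> G * \<bar>x - x0\<bar> powr h * (1 + \<bar>x - x0\<bar>) ^ d"
      using mult_left_mono[of 1 "(1 + \<bar>x - x0\<bar>) ^ d" "G * \<bar>x - x0\<bar> powr h"] G0 by simp
    finally show ?thesis .
  next
    case False
    have one: "1 \<le> (1 + \<bar>x - x0\<bar>) ^ d" by simp
    have "1 = \<delta> powr (- h) * \<delta> powr h" using del by (simp add: powr_add[symmetric])
    also have "\<dots> \<le> \<delta> powr (- h) * \<bar>x - x0\<bar> powr h"
      using False del h by (intro mult_left_mono powr_mono2) auto
    finally have two: "1 \<le> \<delta> powr (- h) * \<bar>x - x0\<bar> powr h" .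
    have "\<bar>F x - poly P (x - x0)\<bar> \<le> B * 1 + A * (1 + \<bar>x - x0\<bar>) ^ d"
      using B(2)[of x] A(2)[of "x - x0"] by linarith
    also have "\<dots> \<le> B * (1 + \<bar>x - x0\<bar>) ^ d + A * (1 + \<bar>x - x0\<bar>) ^ d"
      using one B by (intro add_right_mono mult_left_mono) auto
    also have "\<dots> = ((B + A) * 1) * (1 + \<bar>x - x0\<bar>) ^ d" by (simp add: distrib_right)
    also have "\<dots> \<le> ((B + A) * (\<delta> powr (- h) * \<bar>x - x0\<bar> powr h)) * (1 + \<bar>x - x0\<bar>) ^ d"
      using two A B by (intro mult_right_mono mult_left_mono) auto
    also have "\<dots> \<le> G * \<bar>x - x0\<bar> powr h * (1 + \<bar>x - x0\<bar>) ^ d"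
      unfolding mult.assoc[symmetric] by (intro mult_right_mono) (auto simp: G_def)
    finally show ?thesis .
  qed
  define J where "J = (LINT y|lborel. (1 + \<bar>y\<bar>) powr (h + d) * \<bar>\<psi> y\<bar>)"
  have intJ: "integrable lborel (\<lambda>y. (1 + \<bar>y\<bar>) powr (h + d) * \<bar>\<psi> y\<bar>)"
    by (rule integrable_decay_abs_psi[where B = 1 and M = "h + d"]) auto
  have main: "lam s (node s x0) \<le> (G * 2 ^ d * J) * 2 powr (- (gen s * h))" for s
  proof -
    define p where "p = node s x0"
    define e :: real where "e = 2 powr (- real (gen s))"
    have e: "0 < e" "e \<le> 1" using powr_mono[of "- real (gen s)" 0 2] by (auto simp: e_def)
    have e2: "e * 2 ^ gen s = 1" by (simp add: e_def powr_minus powr_realpow)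
    define E where "E y = F (e * (y + real_of_int p)) - poly P (e * (y + real_of_int p) - x0)" for y
    \<comment> \<open>The approximating polynomial in the unit-scale variable, to which the moment
      condition applies.\<close>
    define Q where "Q = pcompose P [:e * real_of_int p - x0, e:]"
    have Q: "poly Q y = poly P (e * (y + real_of_int p) - x0)" for y
      by (simp add: Q_def poly_pcompose algebra_simps)
    have dist: "\<bar>e * (y + real_of_int p) - x0\<bar> \<le> e * (1 + \<bar>y\<bar>)" for y
    proof -
      have "e * (y + real_of_int p) - x0 = e * (y + real_of_int p) - (e * 2 ^ gen s) * x0" unfolding e2 by simp
      also have "\<dots> = e * (y + (real_of_int p - 2 ^ gen s * x0))" by (simp add: algebra_simps)
      finally have "\<bar>e * (y + real_of_int p) - x0\<bar> = e * \<bar>y + (real_of_int p - 2 ^ gen s * x0)\<bar>" using e by (simp add: abs_mult)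
      also have "\<bar>real_of_int p - 2 ^ gen s * x0\<bar> \<le> 1" unfolding p_def by linarith
      then have "e * \<bar>y + (real_of_int p - 2 ^ gen s * x0)\<bar> \<le> e * (1 + \<bar>y\<bar>)"
        using e by (intro mult_left_mono) linarith+
      finally show ?thesis .
    qed
    have bE: "\<bar>E y\<bar> \<le> (G * e powr h * 2 ^ d) * (1 + \<bar>y\<bar>) powr (h + d)" for y
    proof -
      define r where "r = \<bar>e * (y + real_of_int p) - x0\<bar>"
      have r: "0 \<le> r" "r \<le> e * (1 + \<bar>y\<bar>)" "r \<le> 1 + \<bar>y\<bar>"
        using dist[of y] e mult_right_mono[of e 1 "1 + \<bar>y\<bar>"] by (auto simp: r_def)
      have "\<bar>E y\<bar> \<le> G * r powr h * (1 + r) ^ d"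
        unfolding E_def r_def using glob[of "e * (y + real_of_int p)"] by simp
      also have "\<dots> \<le> G * (e * (1 + \<bar>y\<bar>)) powr h * (2 * (1 + \<bar>y\<bar>)) ^ d"
      proof (rule mult_mono)
        show "G * r powr h \<le> G * (e * (1 + \<bar>y\<bar>)) powr h"
          using r G0 h(2) by (intro mult_left_mono powr_mono2) auto
        show "(1 + r) ^ d \<le> (2 * (1 + \<bar>y\<bar>)) ^ d" using r by (intro power_mono) auto
      qed (use r G0 in auto)
      also have "\<dots> = (G * e powr h * 2 ^ d) * ((1 + \<bar>y\<bar>) powr h * (1 + \<bar>y\<bar>) powr (real d))"
      proof -
        have "(1 + \<bar>y\<bar>) powr real d = (1 + \<bar>y\<bar>) ^ d" by (simp add: powr_realpow add_pos_nonneg)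
        then show ?thesis by (simp only: powr_mult power_mult_distrib mult_ac)
      qed
      also have "(1 + \<bar>y\<bar>) powr h * (1 + \<bar>y\<bar>) powr (real d) = (1 + \<bar>y\<bar>) powr (h + d)"
        by (simp only: powr_add)
      finally show ?thesis .
    qed
    have "continuous_on UNIV (\<lambda>x. poly Q x)" by (intro continuous_intros)
    then have [measurable]: "poly Q \<in> borel_measurable borel"
      by (intro borel_measurable_continuous_onI) simp
    have [measurable]: "E \<in> borel_measurable borel"
      unfolding E_def Q[symmetric] by measurable
    have intE: "integrable lborel (\<lambda>y. E y * \<psi> y)"
      by (rule integrable_decay_psi[OF _ bE]) measurable
    have "lam s p = (LINT y|lborel. F (e * (y + real_of_int p)) * \<psi> y)"
      using wcoeff_gen[of s p] wavelet_cov[of "real (gen s)" F "real_of_int p"]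
      by (simp add: wcoeff_def e_def)
    also have "\<dots> = (LINT y|lborel. E y * \<psi> y + poly Q y * \<psi> y)"
      by (intro arg_cong[where f = "integral\<^sup>L lborel"] ext) (simp add: E_def Q distrib_right[symmetric])
    also have "\<dots> = (LINT y|lborel. E y * \<psi> y) + (LINT y|lborel. poly Q y * \<psi> y)"
      by (rule Bochner_Integration.integral_add[OF intE poly_psi_integral(1)])
    also have "\<dots> = (LINT y|lborel. E y * \<psi> y)" by (simp add: poly_psi_integral)
    also have "\<dots> \<le> \<bar>LINT y|lborel. E y * \<psi> y\<bar>" by simp
    also have "\<dots> \<le> (LINT y|lborel. (G * e powr h * 2 ^ d) * ((1 + \<bar>y\<bar>) powr (h + d) * \<bar>\<psi> y\<bar>))"
    proof (rule integral_abs_bound_integral[OF intE])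
      show "integrable lborel (\<lambda>y. (G * e powr h * 2 ^ d) * ((1 + \<bar>y\<bar>) powr (h + d) * \<bar>\<psi> y\<bar>))"
        by (rule integrable_mult_right[OF intJ])
      show "\<bar>E y * \<psi> y\<bar> \<le> (G * e powr h * 2 ^ d) * ((1 + \<bar>y\<bar>) powr (h + d) * \<bar>\<psi> y\<bar>)" for y
        using mult_right_mono[OF bE[of y], of "\<bar>\<psi> y\<bar>"] by (simp only: abs_mult mult.assoc abs_ge_zero)
    qed
    also have "\<dots> = (G * 2 ^ d * J) * e powr h"
      unfolding J_def integral_mult_right_zero by simp
    also have "e powr h = 2 powr (- (gen s * h))" by (simp add: e_def powr_powr)
    finally show ?thesis unfolding p_def .
  qed
  from absorb_const[OF h(1), of "G * 2 ^ d * J"] show ?thesis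
    by eventually_elim (use main in \<open>blast intro: order_trans\<close>)
qed

text \<open>If p leaves the branch of x0 after stage i, then its weight is at most that of the common ancestor of
  stage i, while separation bounds the distance to x0 from below by the mesh of stage i + 1.\<close>

lemma two_microlocal:
  fixes h' h0 x0 :: real
  assumes x0: "x0 \<in> K" and h: "0 \<le> h'" "h' < h0"
    and ev: "\<forall>\<^sub>F s in sequentially. lam s (node s x0) \<le> 2 powr (- (gen s * h0))"
  obtains C where "C \<ge> 1"
    "\<And>s p. lam s p \<le> C * 2 powr (- (gen s * h')) * (1 + \<bar>off s x0 p\<bar>) powr h'"
proof -
  define fl where "fl s = node s x0" for s
  have fl_pos: "0 < lam s (fl s)" for s using x0 unfolding K_def fl_def by blast
  obtain N where N: "\<And>s. s \<ge> N \<Longrightarrow> lam s (fl s) \<le> 2 powr (- (gen s * h0))"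
    using ev unfolding eventually_sequentially fl_def by blast
  have c1: "lam s (fl s) \<le> 2 powr (gen N * h0) * 2 powr (- (gen s * h0))" for s
  proof (cases "s \<ge> N")
    case True
    have "1 * 2 powr (- (gen s * h0)) \<le> 2 powr (gen N * h0) * 2 powr (- (gen s * h0))"
      using h by (intro mult_right_mono ge_one_powr_ge_zero) auto
    then show ?thesis using N[OF True] by linarith
  next
    case False
    have "lam s (fl s) \<le> 1" by (rule lam_le_1)
    also have "1 \<le> 2 powr (gen N * h0 + - (gen s * h0))"
      using False gen_mono[of s N] h by (intro ge_one_powr_ge_zero) (auto intro!: mult_right_mono)
    finally show ?thesis by (simp only: powr_add)
  qed
  \<comment> \<open>The weight is bounded at stage i but the distance at stage i + 1; the gap
    between h' and h0 pays for this shift.\<close>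
  obtain c0 where c0: "c0 \<ge> 0" "\<And>s. gen (Suc s) * h' \<le> gen s * h0 + c0"
    using gen_Suc_slack[OF h] by blast
  define C1 where "C1 = 2 powr (gen N * h0)"
  define C where "C = C1 * 2 powr c0"
  have C1: "C1 \<ge> 1" unfolding C1_def using h by (intro ge_one_powr_ge_zero) auto
  have p2: "(1::real) \<le> 2 powr c0" using c0 by (intro ge_one_powr_ge_zero) auto
  have C: "C \<ge> 1" "C \<ge> C1" using mult_mono[OF C1 p2] C1 mult_left_mono[OF p2, of C1] by (auto simp: C_def)
  have "lam s p \<le> C * 2 powr (- (gen s * h')) * (1 + \<bar>off s x0 p\<bar>) powr h'" for s p
  proof -
    define v where "v = \<bar>off s x0 p\<bar>"
    have v1: "1 \<le> (1 + v) powr h'" using h by (intro ge_one_powr_ge_zero) (auto simp: v_def)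
    consider "lam s p \<le> 0" | "p = fl s" | "0 < lam s p" "p \<noteq> fl s" by linarith
    then have "lam s p \<le> C * 2 powr (- (gen s * h')) * (1 + v) powr h'"
    proof cases
      case 1
      also have "0 \<le> C * 2 powr (- (gen s * h')) * (1 + v) powr h'" using C by (simp add: v_def)
      finally show ?thesis .
    next
      case 2
      have "lam s p \<le> C1 * 2 powr (- (gen s * h0))" using c1[of s] 2 by (simp add: C1_def)
      also have "\<dots> \<le> C * 2 powr (- (gen s * h'))"
        using C C1 h by (intro mult_mono powr_mono) (auto intro!: mult_left_mono)
      also have "\<dots> \<le> C * 2 powr (- (gen s * h')) * (1 + v) powr h'"
        using mult_left_mono[OF v1, of "C * 2 powr (- (gen s * h'))"] C by simp
      finally show ?thesis .
    next
      case 3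
      define anc where "anc j = p div 2 ^ (gen s - gen j)" for j
      have anc_lam: "lam s p \<le> lam j (anc j)" if "j \<le> s" for j
        unfolding anc_def by (rule lam_ancestor[OF that])
      have "0 < lam 0 (anc 0)" using anc_lam[of 0] 3 by linarith
      moreover have "0 < lam 0 (fl 0)" by (rule fl_pos)
      ultimately have "\<not> anc 0 \<noteq> fl 0" by (simp split: if_splits)
      moreover have "anc s \<noteq> fl s" using 3 by (simp add: anc_def)
      ultimately obtain i where i: "i < s" "anc i = fl i" "anc (Suc i) \<noteq> fl (Suc i)"
        using ex_least_nat_less[of "\<lambda>j. anc j \<noteq> fl j" s] by blast
      define a where "a = anc (Suc i)"
      have "0 < lam (Suc i) a" using anc_lam[of "Suc i"] i 3 by (simp add: a_def)
      then have sep: "4 \<le> \<bar>a - fl (Suc i)\<bar>"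
        using lam_separated fl_pos i(3) unfolding a_def by blast
      define g where "g = gen s - gen (Suc i)"
      have g: "gen s = gen (Suc i) + g" using gen_mono[of "Suc i" s] i by (simp add: g_def)
      have pa: "real_of_int a * 2 ^ g \<le> p" "p < (real_of_int a + 1) * 2 ^ g"
      proof -
        have a: "a = p div 2 ^ g" by (simp add: a_def anc_def g_def)
        have "a * 2 ^ g \<le> p" unfolding a by (metis div_mult_mod_eq le_add_same_cancel1 pos_mod_sign zero_less_numeral zero_less_power)
        moreover have "p < (a + 1) * 2 ^ g" unfolding a using int_div_less_iff[of "2 ^ g" p "p div 2 ^ g + 1"] by simp
        ultimately have "real_of_int (a * 2 ^ g) \<le> p" "real_of_int p < real_of_int ((a + 1) * 2 ^ g)"
          by (simp_all only: of_int_le_iff of_int_less_iff)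
        then show "real_of_int a * 2 ^ g \<le> p" "p < (real_of_int a + 1) * 2 ^ g" by simp_all
      qed
      have xa: "real_of_int (fl (Suc i)) * 2 ^ g \<le> 2 ^ gen s * x0" "2 ^ gen s * x0 < (real_of_int (fl (Suc i)) + 1) * 2 ^ g"
      proof -
        have "2 ^ gen s * x0 = (2 ^ gen (Suc i) * x0) * 2 ^ g" by (simp add: g power_add)
        moreover have "real_of_int (fl (Suc i)) \<le> 2 ^ gen (Suc i) * x0" "2 ^ gen (Suc i) * x0 < real_of_int (fl (Suc i)) + 1"
          unfolding fl_def by linarith+
        ultimately show "real_of_int (fl (Suc i)) * 2 ^ g \<le> 2 ^ gen s * x0" "2 ^ gen s * x0 < (real_of_int (fl (Suc i)) + 1) * 2 ^ g"
          by (simp_all only: mult_le_cancel_right_pos mult_less_cancel_right_pos zero_less_power zero_less_numeral)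
      qed
      have "2 ^ g \<le> v"
      proof (cases "fl (Suc i) \<le> a")
        case True
        with sep have "real_of_int (fl (Suc i)) + 1 + 1 \<le> real_of_int a" by linarith
        then have "(real_of_int (fl (Suc i)) + 1 + 1) * 2 ^ g \<le> real_of_int a * 2 ^ g" by (intro mult_right_mono) auto
        then show ?thesis using pa xa unfolding v_def by (simp add: distrib_right)
      next
        case False
        with sep have "real_of_int a + 1 + 1 \<le> real_of_int (fl (Suc i))" by linarith
        then have "(real_of_int a + 1 + 1) * 2 ^ g \<le> real_of_int (fl (Suc i)) * 2 ^ g" by (intro mult_right_mono) auto
        then show ?thesis using pa xa unfolding v_def by (simp add: distrib_right)
      qed
      then have "(2 ^ g) powr h' \<le> (1 + v) powr h'" using h by (intro powr_mono2) auto
      then have gv: "2 powr (g * h') \<le> (1 + v) powr h'"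
        by (simp add: powr_realpow[symmetric] powr_powr del: powr_realpow)
      have "lam s p \<le> lam i (fl i)" using anc_lam[of i] i by simp
      also have "\<dots> \<le> C1 * 2 powr (- (gen i * h0))" using c1[of i] by (simp add: C1_def)
      also have "\<dots> \<le> C1 * 2 powr (c0 + - (gen (Suc i) * h'))"
        using c0(2)[of i] C1 by (intro mult_left_mono powr_mono) auto
      also have "\<dots> = C * 2 powr (- (gen s * h') + g * h')"
        by (simp add: C_def g mult.assoc powr_add[symmetric] algebra_simps)
      also have "\<dots> = C * 2 powr (- (gen s * h')) * 2 powr (g * h')" by (simp only: powr_add mult.assoc)
      also have "\<dots> \<le> C * 2 powr (- (gen s * h')) * (1 + v) powr h'"
        using gv C by (intro mult_left_mono) auto
      finally show ?thesis .
    qed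
    then show ?thesis unfolding v_def .
  qed
  with C(1) show ?thesis by (rule that)
qed

text \<open>Decay of order h' + 2 absorbs the growth of order h' of the weights away from x0 and
  leaves a lattice sum of exponent -2. It is applied to the derivatives of \<psi> and to the
  majorant of its Taylor remainder.\<close>

lemma two_microlocal_sum:
  fixes h' C x0 :: real
  assumes C: "C \<ge> 1" "\<And>s p. lam s p \<le> C * 2 powr (- (gen s * h')) * (1 + \<bar>off s x0 p\<bar>) powr h'"
    and L: "\<And>u A. finite A \<Longrightarrow> (\<Sum>p\<in>A. (1 + \<bar>u - real_of_int p\<bar>) powr (-2)) \<le> L"
    and g: "B \<ge> 0" "\<And>u. \<bar>g u\<bar> \<le> B * (1 + \<bar>u\<bar>) powr (- (h' + 2))"
  shows "(\<Sum>p\<in>{0..<2 ^ gen s}. lam s p * \<bar>g (off s x0 p)\<bar>) \<le> C * B * L * 2 powr (- (gen s * h'))"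
proof -
  have "(\<Sum>p\<in>{0..<2 ^ gen s}. lam s p * \<bar>g (off s x0 p)\<bar>)
      \<le> (\<Sum>p\<in>{0..<2 ^ gen s}. (C * B * 2 powr (- (gen s * h'))) * (1 + \<bar>off s x0 p\<bar>) powr (-2))"
  proof (rule sum_mono)
    fix p :: int
    define v where "v = \<bar>off s x0 p\<bar>"
    have "lam s p * \<bar>g (off s x0 p)\<bar> \<le>
       (C * 2 powr (- (gen s * h')) * (1 + v) powr h') * (B * (1 + v) powr (- (h' + 2)))"
      unfolding v_def using C by (intro mult_mono C(2) g) auto
    also have "\<dots> = (C * B * 2 powr (- (gen s * h'))) * ((1 + v) powr h' * (1 + v) powr (- (h' + 2)))"
      by simp
    also have "(1 + v) powr h' * (1 + v) powr (- (h' + 2)) = (1 + v) powr (-2)"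
      by (subst powr_add[symmetric]) simp
    finally show "lam s p * \<bar>g (off s x0 p)\<bar> \<le>
       (C * B * 2 powr (- (gen s * h'))) * (1 + \<bar>off s x0 p\<bar>) powr (-2)"
      unfolding v_def .
  qed
  also have "\<dots> = (C * B * 2 powr (- (gen s * h'))) * (\<Sum>p\<in>{0..<2 ^ gen s}. (1 + \<bar>off s x0 p\<bar>) powr (-2))"
    by (simp only: sum_distrib_left)
  also have "\<dots> \<le> (C * B * 2 powr (- (gen s * h'))) * L"
    using C(1) g(1) by (intro mult_left_mono L) auto
  finally show ?thesis by (simp only: mult_ac)
qed

text \<open>Interpolating with the uniform decay of the coefficients makes the blocks of scale finer than the
  distance of x and x0 summable, at the cost of an arbitrarily small loss in the exponent.\<close>

lemma far_block_bound:
  fixes h' h'' C x0 :: real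
  assumes h: "0 \<le> h''" "h'' < h'"
    and C: "C \<ge> 1" "\<And>s p. lam s p \<le> C * 2 powr (- (gen s * h')) * (1 + \<bar>off s x0 p\<bar>) powr h'"
  shows "\<exists>Q\<ge>0. \<forall>s x. 1 \<le> 2 ^ gen s * \<bar>x - x0\<bar> \<longrightarrow>
     \<bar>blk s x\<bar> \<le> Q * \<bar>x - x0\<bar> powr h'' * 2 powr (- (\<alpha> * (1 - h'' / h') * gen s))"
proof -
  \<comment> \<open>Each weight is split into its powers \<theta> and 1 - \<theta>: the first uses
    the pointwise bound and yields h'', the second uses the uniform decay and yields
    summability.\<close>
  define \<theta> where "\<theta> = h'' / h'"
  have th: "0 \<le> \<theta>" "\<theta> < 1" "h' * \<theta> = h''" using h by (auto simp: \<theta>_def)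
  obtain L where L: "L > 0" "\<And>u A. finite A \<Longrightarrow> (\<Sum>p\<in>A. (1 + \<bar>u - real_of_int p\<bar>) powr (-2)) \<le> L"
    using lattice_sum_bound by blast
  obtain C0 where C0: "C0 > 0" "\<And>x. \<bar>\<psi> x\<bar> \<le> C0 * (1 + \<bar>x\<bar>) powr (- (h'' + 2))"
    using psi_decay[of "h'' + 2"] by blast
  define Q where "Q = C * 2 powr h'' * C0 * L"
  have "\<bar>blk s x\<bar> \<le> Q * \<bar>x - x0\<bar> powr h'' * 2 powr (- (\<alpha> * (1 - \<theta>) * gen s))" if t1: "1 \<le> 2 ^ gen s * \<bar>x - x0\<bar>" for s x
  proof -
    define t where "t = 2 ^ gen s * \<bar>x - x0\<bar>"
    define a where "a = 2 powr (- (gen s * h''))"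
    define b where "b = 2 powr (- (\<alpha> * (1 - \<theta>) * gen s))"
    have ab: "0 < a" "0 < b" by (auto simp: a_def b_def)
    have lam2: "lam s p \<le> C * a * (1 + \<bar>off s x0 p\<bar>) powr h'' * b" for p
    proof (cases "lam s p = 0")
      case True
      then show ?thesis using C ab by simp
    next
      case False
      then have pos: "0 < lam s p" using lam_nonneg[of s p] by simp
      define v where "v = \<bar>off s x0 p\<bar>"
      have "lam s p = lam s p powr \<theta> * lam s p powr (1 - \<theta>)"
        using pos by (simp add: powr_add[symmetric])
      also have "\<dots> \<le> (C * 2 powr (- (gen s * h')) * (1 + v) powr h') powr \<theta> * (2 powr (- (\<alpha> * gen s))) powr (1 - \<theta>)"
        using th C(2)[of s p] lam_le[of s p] pos unfolding v_def
        by (intro mult_mono powr_mono2) auto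
      also have "\<dots> = C powr \<theta> * a * (1 + v) powr h'' * b"
      proof -
        have "(2 powr (- (gen s * h'))) powr \<theta> = a"
          by (simp add: a_def powr_powr th(3)[symmetric] mult.assoc)
        moreover have "((1 + v) powr h') powr \<theta> = (1 + v) powr h''" by (simp add: powr_powr th(3))
        moreover have "(2 powr (- (\<alpha> * gen s))) powr (1 - \<theta>) = b" by (simp add: b_def powr_powr mult_ac)
        ultimately show ?thesis by (simp only: powr_mult)
      qed
      also have "\<dots> \<le> C * a * (1 + v) powr h'' * b"
      proof -
        have "C powr \<theta> \<le> C powr 1" using C th by (intro powr_mono) auto
        then show ?thesis using C ab by (intro mult_right_mono) auto
      qed
      finally show ?thesis unfolding v_def .
    qed
    have "\<bar>blk s x\<bar> \<le> (\<Sum>p\<in>{0..<2 ^ gen s}. \<bar>lam s p * \<psi> (off s x p)\<bar>)"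
      unfolding blk_def by (rule sum_abs)
    also have "\<dots> \<le> (\<Sum>p\<in>{0..<2 ^ gen s}. (C * a * (2 powr h'' * t powr h'') * b * C0) * (1 + \<bar>off s x p\<bar>) powr (-2))"
    proof (rule sum_mono)
      fix p :: int
      define v where "v = \<bar>off s x0 p\<bar>"
      define w where "w = \<bar>off s x p\<bar>"
      have "v \<le> w + t"
      proof -
        have "off s x0 p = (off s x p) - 2 ^ gen s * (x - x0)"
          by (simp add: algebra_simps)
        then have "v \<le> w + \<bar>2 ^ gen s * (x - x0)\<bar>" unfolding v_def w_def by (simp only: abs_triangle_ineq4)
        then show ?thesis by (simp add: t_def abs_mult)
      qed
      moreover have w0: "0 \<le> w" by (simp add: w_def)
      moreover have "w \<le> t * w" using t1 w0 by (simp add: t_def mult_le_cancel_right1)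
      \<comment> \<open>Since t \<ge> 1, the weights controlled around x0 are also controlled around
        x, where \<psi> is localised, at the price of a power of t.\<close>
      ultimately have "1 + v \<le> (2 * t) * (1 + w)"
        using t1 unfolding t_def[symmetric] by (simp add: distrib_left)
      moreover have "0 \<le> 1 + v" by (simp add: v_def)
      ultimately have "(1 + v) powr h'' \<le> ((2 * t) * (1 + w)) powr h''"
        using h by (intro powr_mono2) auto
      then have vp: "(1 + v) powr h'' \<le> (2 powr h'' * t powr h'') * (1 + w) powr h''"
        by (simp only: powr_mult)
      have "\<bar>lam s p * \<psi> (off s x p)\<bar> \<le> (C * a * (1 + v) powr h'' * b) * (C0 * (1 + w) powr (- (h'' + 2)))"
        unfolding abs_mult abs_of_nonneg[OF lam_nonneg] v_def w_def
        using C ab by (intro mult_mono lam2 C0(2)) auto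
      also have "\<dots> \<le> (C * a * ((2 powr h'' * t powr h'') * (1 + w) powr h'') * b) * (C0 * (1 + w) powr (- (h'' + 2)))"
        using C ab C0 by (intro mult_right_mono mult_left_mono vp) auto
      also have "\<dots> = (C * a * (2 powr h'' * t powr h'') * b * C0) * ((1 + w) powr h'' * (1 + w) powr (- (h'' + 2)))"
        by (simp only: mult_ac)
      also have "(1 + w) powr h'' * (1 + w) powr (- (h'' + 2)) = (1 + w) powr (-2)"
        by (subst powr_add[symmetric]) simp
      finally show "\<bar>lam s p * \<psi> (off s x p)\<bar> \<le>
         (C * a * (2 powr h'' * t powr h'') * b * C0) * (1 + \<bar>off s x p\<bar>) powr (-2)"
        unfolding w_def .
    qed
    also have "\<dots> = (C * a * (2 powr h'' * t powr h'') * b * C0) * (\<Sum>p\<in>{0..<2 ^ gen s}. (1 + \<bar>off s x p\<bar>) powr (-2))"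
      by (simp only: sum_distrib_left)
    also have "\<dots> \<le> (C * a * (2 powr h'' * t powr h'') * b * C0) * L"
      using C ab C0 by (intro mult_left_mono L) auto
    also have "\<dots> = Q * (a * t powr h'') * b" by (simp only: Q_def mult_ac)
    also have "a * t powr h'' = \<bar>x - x0\<bar> powr h''"
    proof -
      have "t powr h'' = (2 powr real (gen s)) powr h'' * \<bar>x - x0\<bar> powr h''"
        by (simp only: t_def powr_mult powr_realpow zero_less_numeral)
      also have "(2 powr real (gen s)) powr h'' = 2 powr (gen s * h'')" by (simp only: powr_powr)
      finally have "a * t powr h'' = (a * 2 powr (gen s * h'')) * \<bar>x - x0\<bar> powr h''" by (simp only: mult.assoc)
      also have "a * 2 powr (gen s * h'') = 1" by (simp add: a_def powr_add[symmetric])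
      finally show ?thesis by simp
    qed
    finally show ?thesis unfolding b_def .
  qed
  moreover have "Q \<ge> 0" using C C0 L by (simp add: Q_def)
  ultimately show ?thesis unfolding \<theta>_def by blast
qed

text \<open>At stages whose mesh is coarser than |x - x0| the block differs from its Taylor
  polynomial by the remainder. At finer stages block and Taylor polynomial are each small on their
  own, and the difference is estimated trivially.\<close>

lemma lam_le_imp_hoelder_exp_ge:
  fixes x0 h0 h'' :: real
  assumes x0: "x0 \<in> K" and h: "0 \<le> h''" "h'' < h0"
    and ev: "\<forall>\<^sub>F s in sequentially. lam s (node s x0) \<le> 2 powr (- (gen s * h0))"
  shows "ereal h'' \<le> hoelder_exp F x0"
proof -
  \<comment> \<open>The gap below h0 pays for the bound on weights away from x0, the gap above h''
    for summability over the stages.\<close>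
  define h' where "h' = (h'' + h0) / 2"
  have h': "0 \<le> h'" "h'' < h'" "h' < h0" using h by (auto simp: h'_def)
  obtain C where C: "C \<ge> 1" "\<And>s p. lam s p \<le> C * 2 powr (- (gen s * h')) * (1 + \<bar>off s x0 p\<bar>) powr h'"
    using two_microlocal[OF x0 h'(1) h'(3) ev] by blast
  obtain L where L: "L > 0" "\<And>u A. finite A \<Longrightarrow> (\<Sum>p\<in>A. (1 + \<bar>u - real_of_int p\<bar>) powr (-2)) \<le> L"
    using lattice_sum_bound by blast
  \<comment> \<open>N \<le> h'' \<le> N + 1 serves both regimes: t^(N + 1) \<le> t^h'' for t \<le>
    1, and t^l \<le> t^h'' for t \<ge> 1 and l \<le> N.\<close>
  define N where "N = nat \<lfloor>h''\<rfloor>"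
  have N: "real N \<le> h''" "h'' \<le> real (Suc N)" unfolding N_def using h(1) by linarith+
  \<comment> \<open>The coefficient of (x - x0)^l in the Taylor expansion of \<open>blk s\<close> at
    x0.\<close>
  define A where "A s l = (\<Sum>p\<in>{0..<2 ^ gen s}. lam s p * D l (off s x0 p)) / fact l * (2 ^ gen s) ^ l" for s l
  have "\<exists>B. \<forall>l. 0 \<le> B l \<and> (\<forall>s. \<bar>A s l\<bar> \<le> B l * 2 powr (- (gen s * h')) * (2 ^ gen s) ^ l)"
  proof (rule choice, rule allI)
    fix l
    obtain Cl where Cl: "Cl > 0" "\<And>u. \<bar>D l u\<bar> \<le> Cl * (1 + \<bar>u\<bar>) powr (- (h' + 2))"
      using D_decay[of l "h' + 2"] by blast
    have "\<bar>A s l\<bar> \<le> (C * Cl * L) * 2 powr (- (gen s * h')) * (2 ^ gen s) ^ l" for s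
    proof -
      have "\<bar>\<Sum>p\<in>{0..<2 ^ gen s}. lam s p * D l (off s x0 p)\<bar>
         \<le> (\<Sum>p\<in>{0..<2 ^ gen s}. \<bar>lam s p * D l (off s x0 p)\<bar>)" by (rule sum_abs)
      also have "\<dots> = (\<Sum>p\<in>{0..<2 ^ gen s}. lam s p * \<bar>D l (off s x0 p)\<bar>)"
        by (simp add: abs_mult lam_nonneg)
      also have "\<dots> \<le> C * Cl * L * 2 powr (- (gen s * h'))"
        by (rule two_microlocal_sum[OF C L(2)]) (use Cl in auto)
      finally have "\<bar>\<Sum>p\<in>{0..<2 ^ gen s}. lam s p * D l (off s x0 p)\<bar> / fact l \<le> C * Cl * L * 2 powr (- (gen s * h')) / 1"
        by (intro frac_le) auto
      then have "\<bar>\<Sum>p\<in>{0..<2 ^ gen s}. lam s p * D l (off s x0 p)\<bar> / fact l * (2 ^ gen s) ^ l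
          \<le> C * Cl * L * 2 powr (- (gen s * h')) / 1 * (2 ^ gen s) ^ l"
        by (intro mult_right_mono) auto
      then show ?thesis by (simp add: A_def abs_mult)
    qed
    moreover have "0 \<le> C * Cl * L" using C Cl L by simp
    ultimately show "\<exists>B. 0 \<le> B \<and> (\<forall>s. \<bar>A s l\<bar> \<le> B * 2 powr (- (gen s * h')) * (2 ^ gen s) ^ l)" by blast
  qed
  then obtain B where B: "\<And>l. 0 \<le> B l" "\<And>s l. \<bar>A s l\<bar> \<le> B l * 2 powr (- (gen s * h')) * (2 ^ gen s) ^ l" by blast
  define T where "T s x = (\<Sum>l<Suc N. A s l * (x - x0) ^ l)" for s x
  define \<theta> where "\<theta> = h'' / h'"
  \<comment> \<open>A common rate of decay over the stages for both regimes: h' - h'' comes from the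
    Taylor terms, the other value from the interpolated block bound.\<close>
  define \<delta> where "\<delta> = min (h' - h'') (\<alpha> * (1 - \<theta>))"
  have del: "\<delta> > 0" "\<delta> \<le> h' - h''" "\<delta> \<le> \<alpha> * (1 - \<theta>)"
    using h h' alpha_pos by (auto simp: \<delta>_def \<theta>_def)
  obtain Q1 where Q1: "Q1 \<ge> 0" "\<And>s x. 1 \<le> 2 ^ gen s * \<bar>x - x0\<bar> \<Longrightarrow>
     \<bar>blk s x\<bar> \<le> Q1 * \<bar>x - x0\<bar> powr h'' * 2 powr (- (\<alpha> * (1 - h'' / h') * gen s))"
    using far_block_bound[OF h(1) h'(2) C] by blast
  obtain R where R: "R > 0" "\<And>u w. \<bar>w\<bar> \<le> 1 \<Longrightarrow>
    \<bar>\<psi> (u + w) - (\<Sum>l<Suc N. D l u / fact l * w ^ l)\<bar> \<le> R * (1 + \<bar>u\<bar>) powr (- (h' + 2)) * \<bar>w\<bar> ^ Suc N"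
  proof -
    have "0 \<le> h' + 2" using h'(1) by simp
    from taylor_remainder[OF this, of N] show ?thesis using that by blast
  qed
  define Q where "Q = C * R * L + Q1 + (\<Sum>l<Suc N. B l)"
  have SB: "0 \<le> (\<Sum>l<Suc N. B l)" by (intro sum_nonneg B)
  have QQ: "Q1 + (\<Sum>l<Suc N. B l) \<le> Q" "C * R * L \<le> Q" "0 \<le> Q"
    using C R L Q1 SB by (auto simp: Q_def)
  have scale: "2 powr (- (gen s * h')) * (2 ^ gen s * \<bar>x - x0\<bar>) powr h'' \<le> \<bar>x - x0\<bar> powr h'' * 2 powr (- (\<delta> * gen s))" for s x
  proof -
    have "(2 ^ gen s * \<bar>x - x0\<bar>) powr h'' = 2 powr (gen s * h'') * \<bar>x - x0\<bar> powr h''"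
      by (simp only: powr_mult powr_realpow[OF zero_less_numeral, symmetric] powr_powr)
    then have "2 powr (- (gen s * h')) * (2 ^ gen s * \<bar>x - x0\<bar>) powr h'' = \<bar>x - x0\<bar> powr h'' * 2 powr (- (gen s * h') + gen s * h'')"
      by (simp only: powr_add mult_ac)
    also have "\<dots> \<le> \<bar>x - x0\<bar> powr h'' * 2 powr (- (\<delta> * gen s))"
    proof -
      have "\<delta> * gen s \<le> (h' - h'') * gen s" by (intro mult_right_mono del) auto
      then show ?thesis by (intro mult_left_mono powr_mono) (auto simp: algebra_simps)
    qed
    finally show ?thesis .
  qed
  have block: "\<bar>blk s x - T s x\<bar> \<le> Q * \<bar>x - x0\<bar> powr h'' * 2 powr (- (\<delta> * gen s))" for s x
  proof -
    define t where "t = 2 ^ gen s * \<bar>x - x0\<bar>"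
    have t0: "0 \<le> t" by (simp add: t_def)
    show ?thesis
    proof (cases "t \<le> 1")
      case True
      define w where "w = 2 ^ gen s * (x - x0)"
      have w: "\<bar>w\<bar> = t" unfolding w_def t_def abs_mult by simp
      have "A s l * (x - x0) ^ l = (\<Sum>p\<in>{0..<2 ^ gen s}. lam s p * (D l (off s x0 p) / fact l * w ^ l))" for l
        by (simp only: A_def w_def power_mult_distrib sum_divide_distrib sum_distrib_right) (simp only: times_divide_eq_left times_divide_eq_right mult_ac)
      then have "T s x = (\<Sum>l<Suc N. \<Sum>p\<in>{0..<2 ^ gen s}. lam s p * (D l (off s x0 p) / fact l * w ^ l))"
        by (simp only: T_def)
      also have "\<dots> = (\<Sum>p\<in>{0..<2 ^ gen s}. lam s p * (\<Sum>l<Suc N. D l (off s x0 p) / fact l * w ^ l))"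
        by (subst sum.swap) (simp only: sum_distrib_left)
      finally have eq: "blk s x - T s x = (\<Sum>p\<in>{0..<2 ^ gen s}. lam s p *
          (\<psi> (off s x p) - (\<Sum>l<Suc N. D l (off s x0 p) / fact l * w ^ l)))"
        by (simp only: blk_def right_diff_distrib sum_subtractf)
      have "\<bar>blk s x - T s x\<bar> \<le> (\<Sum>p\<in>{0..<2 ^ gen s}. \<bar>lam s p *
          (\<psi> (off s x p) - (\<Sum>l<Suc N. D l (off s x0 p) / fact l * w ^ l))\<bar>)"
        unfolding eq by (rule sum_abs)
      also have "\<dots> \<le> (\<Sum>p\<in>{0..<2 ^ gen s}. lam s p * \<bar>R * (1 + \<bar>off s x0 p\<bar>) powr (- (h' + 2))\<bar> * t ^ Suc N)"
      proof (rule sum_mono)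
        fix p :: int
        have xx: "off s x p = (off s x0 p) + w" by (simp add: w_def algebra_simps)
        have "\<bar>\<psi> (off s x p) - (\<Sum>l<Suc N. D l (off s x0 p) / fact l * w ^ l)\<bar>
            \<le> \<bar>R * (1 + \<bar>off s x0 p\<bar>) powr (- (h' + 2))\<bar> * t ^ Suc N"
          unfolding xx using R(2)[of w "off s x0 p"] True R(1) unfolding w by simp
        then show "\<bar>lam s p * (\<psi> (off s x p) - (\<Sum>l<Suc N. D l (off s x0 p) / fact l * w ^ l))\<bar>
          \<le> lam s p * \<bar>R * (1 + \<bar>off s x0 p\<bar>) powr (- (h' + 2))\<bar> * t ^ Suc N"
          unfolding abs_mult[of "lam s p"] abs_of_nonneg[OF lam_nonneg] mult.assoc[of "lam s p"]
          by (intro mult_left_mono lam_nonneg)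
      qed
      also have "\<dots> = (\<Sum>p\<in>{0..<2 ^ gen s}. lam s p * \<bar>(\<lambda>u. R * (1 + \<bar>u\<bar>) powr (- (h' + 2))) (off s x0 p)\<bar>) * t ^ Suc N"
        by (simp only: sum_distrib_right)
      also have "\<dots> \<le> (C * R * L * 2 powr (- (gen s * h'))) * t ^ Suc N"
        using t0 R(1) by (intro mult_right_mono two_microlocal_sum[OF C L(2)]) auto
      also have "\<dots> \<le> (Q * 2 powr (- (gen s * h'))) * t powr h''"
        using powr_min_interp[OF t0 True N(2)] t0 QQ by (intro mult_mono) auto
      also have "\<dots> \<le> Q * (\<bar>x - x0\<bar> powr h'' * 2 powr (- (\<delta> * gen s)))"
        unfolding mult.assoc t_def by (intro mult_left_mono scale QQ)
      finally show ?thesis by (simp only: mult.assoc)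
    next
      case False
      define W where "W = \<bar>x - x0\<bar> powr h'' * 2 powr (- (\<delta> * gen s))"
      have "\<bar>blk s x\<bar> \<le> Q1 * \<bar>x - x0\<bar> powr h'' * 2 powr (- (\<alpha> * (1 - h'' / h') * gen s))"
        using False by (intro Q1(2)) (simp add: t_def)
      also have "\<dots> \<le> Q1 * \<bar>x - x0\<bar> powr h'' * 2 powr (- (\<delta> * gen s))"
        using Q1(1) mult_right_mono[OF del(3), of "real (gen s)"]
        by (intro mult_left_mono powr_mono) (auto simp: \<theta>_def)
      finally have b1: "\<bar>blk s x\<bar> \<le> Q1 * W" by (simp only: W_def mult.assoc)
      have "\<bar>T s x\<bar> \<le> (\<Sum>l<Suc N. \<bar>A s l * (x - x0) ^ l\<bar>)" unfolding T_def by (rule sum_abs)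
      also have "\<dots> \<le> (\<Sum>l<Suc N. B l * W)"
      proof (rule sum_mono)
        fix l assume l: "l \<in> {..<Suc N}"
        have "\<bar>A s l * (x - x0) ^ l\<bar> \<le> (B l * 2 powr (- (gen s * h')) * (2 ^ gen s) ^ l) * \<bar>x - x0\<bar> ^ l"
          unfolding abs_mult power_abs by (intro mult_right_mono B) auto
        also have "\<dots> = B l * (2 powr (- (gen s * h')) * t ^ l)"
          by (simp only: t_def power_mult_distrib mult_ac)
        also have "t ^ l \<le> t powr h''"
        proof -
          have "t ^ l = t powr (real l)" using False by (simp add: powr_realpow)
          also have "\<dots> \<le> t powr h''" using False l N(1) by (intro powr_mono) auto
          finally show ?thesis .
        qed
        then have "B l * (2 powr (- (gen s * h')) * t ^ l) \<le> B l * (2 powr (- (gen s * h')) * t powr h'')"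
          by (intro mult_left_mono B) auto
        also have "\<dots> \<le> B l * W" unfolding t_def W_def by (intro mult_left_mono scale B)
        finally show "\<bar>A s l * (x - x0) ^ l\<bar> \<le> B l * W" .
      qed
      also have "\<dots> = (\<Sum>l<Suc N. B l) * W" by (simp only: sum_distrib_right)
      finally have b2: "\<bar>T s x\<bar> \<le> (\<Sum>l<Suc N. B l) * W" .
      have "\<bar>blk s x - T s x\<bar> \<le> \<bar>blk s x\<bar> + \<bar>T s x\<bar>" by (rule abs_triangle_ineq4)
      also have "\<dots> \<le> (Q1 + (\<Sum>l<Suc N. B l)) * W" using b1 b2 by (simp only: distrib_right)
      also have "\<dots> \<le> Q * W" using QQ by (intro mult_right_mono) (auto simp: W_def)
      finally show ?thesis by (simp only: W_def mult.assoc)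
    qed
  qed
  \<comment> \<open>Since l \<le> N \<le> h'' < h', the factor 2^(n l) produced by differentiation
    is beaten by 2^(-n h').\<close>
  have smA: "summable (\<lambda>s. A s l)" if "l < Suc N" for l
  proof (rule summable_comparison_test'[where N = 0])
    have pos: "h' - real l > 0" using that N(1) h'(2) by simp
    show "summable (\<lambda>s. B l * 2 powr (- ((h' - real l) * gen s)))"
      by (intro summable_mult summable_decay pos)
    fix s
    have "(2 ^ gen s) ^ l = (2::real) powr (real l * gen s)"
    proof -
      have "(2::real) powr (real l * gen s) = 2 powr real (gen s * l)" by (simp add: mult.commute)
      also have "\<dots> = 2 ^ (gen s * l)" by (rule powr_realpow) simp
      finally show ?thesis by (simp add: power_mult)
    qed
    then have "2 powr (- (gen s * h')) * (2 ^ gen s) ^ l = (2::real) powr (- ((h' - real l) * gen s))"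
      by (simp add: powr_add[symmetric] algebra_simps)
    then show "norm (A s l) \<le> B l * 2 powr (- ((h' - real l) * gen s))"
      using B(2)[of s l] by (simp add: mult.assoc)
  qed
  define P where "P = (\<Sum>l<Suc N. monom (\<Sum>s. A s l) l)"
  have "\<bar>F x - poly P (x - x0)\<bar> \<le> (Q * (\<Sum>s. 2 powr (- (\<delta> * gen s)))) * \<bar>x - x0\<bar> powr h''" for x
  proof -
    have "(\<lambda>s. T s x) sums (\<Sum>l<Suc N. (\<Sum>s. A s l) * (x - x0) ^ l)"
      unfolding T_def by (intro sums_sum sums_mult2 summable_sums smA) auto
    moreover have "(\<Sum>l<Suc N. (\<Sum>s. A s l) * (x - x0) ^ l) = poly P (x - x0)"
      by (simp only: P_def poly_sum poly_monom)
    ultimately have Ts: "(\<lambda>s. T s x) sums poly P (x - x0)" by simp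
    have "(\<lambda>s. blk s x) sums F x" unfolding F_def by (rule summable_sums[OF summable_blk(2)])
    from sums_diff[OF this Ts] have eq: "F x - poly P (x - x0) = (\<Sum>s. blk s x - T s x)"
      by (rule sums_unique)
    have sm: "summable (\<lambda>s. Q * \<bar>x - x0\<bar> powr h'' * 2 powr (- (\<delta> * gen s)))"
      by (intro summable_mult summable_decay del)
    then have sa: "summable (\<lambda>s. \<bar>blk s x - T s x\<bar>)"
      by (rule summable_comparison_test'[where N = 0]) (use block in auto)
    have "\<bar>\<Sum>s. blk s x - T s x\<bar> \<le> (\<Sum>s. \<bar>blk s x - T s x\<bar>)" by (rule summable_rabs[OF sa])
    also have "\<dots> \<le> (\<Sum>s. Q * \<bar>x - x0\<bar> powr h'' * 2 powr (- (\<delta> * gen s)))"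
      by (rule suminf_le[OF block sa sm])
    also have "\<dots> = Q * \<bar>x - x0\<bar> powr h'' * (\<Sum>s. 2 powr (- (\<delta> * gen s)))"
      by (rule suminf_mult[OF summable_decay[OF del(1)]])
    finally show ?thesis unfolding eq by (simp only: mult_ac)
  qed
  then have "ereal h'' \<in> ereal ` {h. h \<ge> 0 \<and> (\<exists>P :: real poly. \<exists>C \<delta>. \<delta> > 0 \<and>
      (\<forall>x. \<bar>x - x0\<bar> < \<delta> \<longrightarrow> \<bar>F x - poly P (x - x0)\<bar> \<le> C * \<bar>x - x0\<bar> powr h))}"
    using h(1) by (intro imageI CollectI conjI exI[of _ P] exI[of _ "Q * (\<Sum>s. 2 powr (- (\<delta> * gen s)))"] exI[of _ "1::real"]) auto
  then show ?thesis unfolding hoelder_exp_def by (rule Sup_upper)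
qed

end

section \<open>Hausdorff dimension\<close>

lemma hausdorff_measure_0D:
  assumes "hausdorff_measure t E = 0" "\<epsilon> > 0"
  shows "\<exists>U :: nat \<Rightarrow> real set. (\<forall>i. bounded (U i) \<and> diameter (U i) \<le> 1) \<and> E \<subseteq> (\<Union>i. U i) \<and>
      (\<Sum>i. ennreal (diameter (U i) powr t)) < ennreal \<epsilon>"
proof -
  have "hausdorff_pre t 1 E \<le> hausdorff_measure t E"
    unfolding hausdorff_measure_def by (rule SUP_upper) simp
  then have "hausdorff_pre t 1 E < ennreal \<epsilon>" using assms by simp
  then show ?thesis
    unfolding hausdorff_pre_def Inf_less_iff by blast
qed

text \<open>The inverse of \<phi> is Hoelder of exponent s, so a cover of E pulls back to a cover of
  [0, 1). If the t-dimensional measure vanished for some t < s, the pulled-back intervals would have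
  total length below 1.\<close>

lemma dimH_ge_expanding:
  fixes \<phi> :: "real \<Rightarrow> real"
  assumes s: "s > 0" and C: "C > 0"
    and exp: "\<And>y y'. y \<in> {0..<1} \<Longrightarrow> y' \<in> {0..<1} \<Longrightarrow> \<bar>y - y'\<bar> \<le> C * \<bar>\<phi> y - \<phi> y'\<bar> powr s"
    and sub: "\<phi> ` {0..<1} \<subseteq> E"
  shows "ereal s \<le> dimH E"
proof -
  have "\<phi> 0 \<in> E" using sub by auto
  then have ne: "E \<noteq> {}" by blast
  have "s \<le> t" if t: "t > 0" "hausdorff_measure t E = 0" for t
  proof (rule ccontr)
    assume "\<not> s \<le> t"
    \<comment> \<open>A set of diameter d pulls back into an interval of length 2 C d^t, so this
      threshold makes the total length less than 1.\<close>
    have "1 / (2 * C) > 0" using C by simp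
    from hausdorff_measure_0D[OF t(2) this]
    obtain U :: "nat \<Rightarrow> real set" where Ub: "\<forall>i. bounded (U i) \<and> diameter (U i) \<le> 1" and Uc: "E \<subseteq> (\<Union>i. U i)"
      and Us: "(\<Sum>i. ennreal (diameter (U i) powr t)) < ennreal (1 / (2 * C))"
      by (elim exE conjE)
    have U: "bounded (U i)" "diameter (U i) \<le> 1" for i using Ub by auto
    define V where "V i = {y \<in> {0..<1}. \<phi> y \<in> U i}" for i
    define r where "r i = C * diameter (U i) powr t" for i
    define c where "c i = (SOME y. y \<in> V i)" for i
    define W where "W i = {c i - r i..c i + r i}" for i
    have r0: "r i \<ge> 0" for i using C by (simp add: r_def)
    have VW: "V i \<subseteq> W i" for i
    proof
      fix y assume y: "y \<in> V i"
      then have c: "c i \<in> V i" unfolding c_def by (rule someI)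
      have "\<bar>\<phi> y - \<phi> (c i)\<bar> \<le> diameter (U i)"
        using diameter_bounded_bound[OF U(1)[of i], of "\<phi> y" "\<phi> (c i)"] y c by (simp add: V_def dist_real_def)
      then have "\<bar>\<phi> y - \<phi> (c i)\<bar> powr s \<le> diameter (U i) powr s" using s by (intro powr_mono2) auto
      \<comment> \<open>Diameters at most 1 let the exponent drop from s to the smaller t.\<close>
      also have "\<dots> \<le> diameter (U i) powr t"
        using \<open>\<not> s \<le> t\<close> U by (intro powr_mono') (auto simp: diameter_ge_0)
      finally have "\<bar>y - c i\<bar> \<le> r i"
        unfolding r_def using exp[of y "c i"] y c C
        by (intro order_trans[OF exp] mult_left_mono) (auto simp: V_def)
      then show "y \<in> W i" by (auto simp: W_def)
    qed
    have "{0..<1} \<subseteq> (\<Union>i. W i)"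
    proof
      fix y :: real assume "y \<in> {0..<1}"
      then obtain i where "\<phi> y \<in> U i" using sub Uc by blast
      then have "y \<in> V i" using \<open>y \<in> {0..<1}\<close> by (simp add: V_def)
      then show "y \<in> (\<Union>i. W i)" using VW by blast
    qed
    then have "emeasure lborel {0..<1::real} \<le> emeasure lborel (\<Union>i. W i)"
      by (intro emeasure_mono) (auto simp: W_def)
    also have "\<dots> \<le> (\<Sum>i. emeasure lborel (W i))"
      by (intro emeasure_subadditive_countably) (auto simp: W_def)
    also have "\<dots> = (\<Sum>i. ennreal (2 * C) * ennreal (diameter (U i) powr t))"
    proof -
      have "emeasure lborel (W i) = ennreal (2 * C) * ennreal (diameter (U i) powr t)" for i
      proof -
        have "emeasure lborel (W i) = ennreal (2 * r i)"
          unfolding W_def using r0[of i] by (subst emeasure_lborel_Icc) auto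
        also have "2 * r i = (2 * C) * diameter (U i) powr t" by (simp add: r_def)
        also have "ennreal \<dots> = ennreal (2 * C) * ennreal (diameter (U i) powr t)"
          using C by (intro ennreal_mult) auto
        finally show ?thesis .
      qed
      then show ?thesis by simp
    qed
    also have "\<dots> = ennreal (2 * C) * (\<Sum>i. ennreal (diameter (U i) powr t))"
      by (rule ennreal_suminf_cmult)
    also have "\<dots> < ennreal (2 * C) * ennreal (1 / (2 * C))"
      using Us C by (intro ennreal_mult_strict_left_mono) auto
    also have "\<dots> = ennreal ((2 * C) * (1 / (2 * C)))" using C by (intro ennreal_mult[symmetric]) auto
    also have "\<dots> = 1" using C by simp
    finally show False by simp
  qed
  then have "ereal s \<le> Inf {ereal t | t. t > 0 \<and> hausdorff_measure t E = 0}"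
    by (intro Inf_greatest) auto
  then show ?thesis using ne by (simp add: dimH_def)
qed

lemma dimH_mono: "A \<subseteq> B \<Longrightarrow> dimH A \<le> dimH B"
proof (cases "A = {}")
  case False
  assume AB: "A \<subseteq> B"
  then have "hausdorff_measure s A \<le> hausdorff_measure s B" for s
    unfolding hausdorff_measure_def hausdorff_pre_def
    by (intro SUP_mono' Inf_superset_mono Collect_mono) blast
  then have "hausdorff_measure s B = 0 \<Longrightarrow> hausdorff_measure s A = 0" for s
    by (metis le_zero_eq)
  then show ?thesis using False AB
    unfolding dimH_def by (auto intro!: Inf_superset_mono)
qed (simp add: dimH_def)

lemma dimH_le: "s > 0 \<Longrightarrow> hausdorff_measure s E = 0 \<Longrightarrow> dimH E \<le> ereal s"
  unfolding dimH_def by (auto intro!: Inf_lower)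

lemma dimH_nonneg: "E \<noteq> {} \<Longrightarrow> 0 \<le> dimH E"
  unfolding dimH_def by (auto intro!: Inf_greatest)

context cascade
begin

text \<open>With n = \<open>gen s\<close>, the partition function at q bounds the number of nodes of
  stage s with weight^q at least 2^(-n r) by C 2^(n (r - \<tau>)). Points of E lie in such nodes
  infinitely often, so the nodes beyond any stage cover E and their d-th powers of diameters are
  summable; for d \<le> 0 no such node remains at late stages. The sign of q is free, so heavy and
  light nodes are treated alike.\<close>

lemma frequently_heavy_cover:
  fixes q r \<tau> d :: real
  assumes EK: "E \<subseteq> K"
    and fr: "\<And>x. x \<in> E \<Longrightarrow> \<exists>\<^sub>F s in sequentially. 2 powr (- (gen s * r)) \<le> lam s (node s x) powr q"
    and Z: "\<forall>\<^sub>F i in sequentially. Z i q \<le> 2 powr (- (len i * \<tau>))"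
    and d: "r - \<tau> < d"
  shows "d > 0 \<Longrightarrow> hausdorff_measure d E = 0" and "d \<le> 0 \<Longrightarrow> E = {}"
proof -
  obtain C where C: "C \<ge> 1" "\<And>s. (\<Prod>i<s. Z i q) \<le> C * 2 powr (- (gen s * \<tau>))"
    using prod_upper[of "\<lambda>i. Z i q" \<tau>] Z Z_pos by (metis less_imp_le)
  define \<eta> where "\<eta> = d - (r - \<tau>)"
  have eta: "\<eta> > 0" using d by (simp add: \<eta>_def)
  define sel where "sel s = {k::nat. k < 2 ^ gen s \<and> 2 powr (- (gen s * r)) \<le> lam s (int k) powr q}" for s
  have fin: "finite (sel s)" for s unfolding sel_def by (rule finite_subset[of _ "{..<2 ^ gen s}"]) auto
  have cnt: "card (sel s) * 2 powr (- (gen s * d)) \<le> C * 2 powr (- (\<eta> * gen s))" for s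
  proof -
    have "card (sel s) * 2 powr (- (gen s * r)) = (\<Sum>k\<in>sel s. 2 powr (- (gen s * r)))" by simp
    also have "\<dots> \<le> (\<Sum>k\<in>sel s. lam s (int k) powr q)" by (intro sum_mono) (simp add: sel_def)
    also have "\<dots> = (\<Sum>p\<in>int ` sel s. lam s p powr q)" by (subst sum.reindex) auto
    also have "\<dots> \<le> (\<Sum>p\<in>{0..<2 ^ gen s}. lam s p powr q)"
      by (intro sum_mono2) (auto simp: sel_def)
    also have "\<dots> \<le> C * 2 powr (- (gen s * \<tau>))" using C(2)[of s] by (simp add: partition_function)
    finally have "card (sel s) * 2 powr (- (gen s * r)) * 2 powr (gen s * (r - d)) \<le> C * 2 powr (- (gen s * \<tau>)) * 2 powr (gen s * (r - d))"
      by (intro mult_right_mono) auto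
    moreover have "2 powr (- (gen s * r)) * 2 powr (gen s * (r - d)) = (2::real) powr (- (gen s * d))"
      by (simp add: powr_add[symmetric] algebra_simps)
    moreover have "2 powr (- (gen s * \<tau>)) * 2 powr (gen s * (r - d)) = (2::real) powr (- (\<eta> * gen s))"
      by (simp add: powr_add[symmetric] \<eta>_def algebra_simps)
    ultimately show ?thesis by (simp only: mult.assoc)
  qed
  define f where "f s = C * 2 powr (- (\<eta> * gen s))" for s
  have sf: "summable f"
    unfolding f_def by (intro summable_mult summable_powr_gen gen_ge eta)
  have hit: "\<exists>\<^sub>F s in sequentially. nat (node s x) \<in> sel s" if x: "x \<in> E" for x
    using fr[OF x]
  proof (rule frequently_elim1)
    fix s assume a: "2 powr (- (gen s * r)) \<le> lam s (node s x) powr q"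
    have "0 < lam s (node s x)" using x EK unfolding K_def by blast
    then have "0 \<le> node s x" "node s x < 2 ^ gen s" using lam_pos_range by blast+
    then show "nat (node s x) \<in> sel s" using a by (simp add: sel_def nat_less_iff)
  qed
  show "E = {}" if d0: "d \<le> 0"
  proof (rule ccontr)
    assume "E \<noteq> {}"
    then obtain x where x: "x \<in> E" by blast
    have "\<forall>\<^sub>F s in sequentially. f s < 1"
      using summable_LIMSEQ_zero[OF sf] by (rule order_tendstoD) simp
    then have "\<exists>\<^sub>F s in sequentially. nat (node s x) \<in> sel s \<and> f s < 1"
      using hit[OF x] by (simp add: frequently_eventually_frequently)
    then obtain s where s: "nat (node s x) \<in> sel s" "f s < 1" using frequently_ex by blast
    have "1 \<le> card (sel s)" using s(1) fin[of s] by (metis One_nat_def Suc_leI card_gt_0_iff empty_iff)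
    moreover have "1 \<le> 2 powr (- (gen s * d))" using d0 by (intro ge_one_powr_ge_zero) (auto simp: mult_nonneg_nonpos)
    ultimately have "1 * 1 \<le> card (sel s) * 2 powr (- (gen s * d))" by (intro mult_mono) auto
    then show False using cnt[of s] s(2) by (simp add: f_def)
  qed
  show "hausdorff_measure d E = 0" if d0: "d > 0"
  proof -
    have pre: "hausdorff_pre d \<delta> E \<le> ennreal \<epsilon>" if del: "\<delta> > 0" and eps: "\<epsilon> > 0" for \<delta> \<epsilon>
    proof -
      obtain S1 where S1: "\<And>n. n \<ge> S1 \<Longrightarrow> norm (\<Sum>i. f (i + n)) < \<epsilon>"
        using suminf_exist_split[OF eps sf] by blast
      obtain S2 where S2: "(1/2) ^ S2 < \<delta>" using real_arch_pow_inv[OF del, of "1/2"] by auto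
      define S where "S = max S1 S2"
      define I where "I s k = {real k / 2 ^ gen s..(real k + 1) / 2 ^ gen s}" for s k
      have dI: "diameter (I s k) = (1/2) ^ gen s" for s k
      proof -
        have "real k / 2 ^ gen s \<le> (real k + 1) / 2 ^ gen s" by (intro divide_right_mono) auto
        then show ?thesis unfolding I_def
          by (simp add: diff_divide_distrib[symmetric] power_divide)
      qed
      \<comment> \<open>Indices that are not selected are padded with the empty set, which
        contributes 0; the pairing function then flattens stage and position into one
        sequence.\<close>
      define G where "G = (\<lambda>(s, k). if k \<in> sel (s + S) then I (s + S) k else {})"
      define U where "U i = G (prod_decode i)" for i
      have Ub: "bounded (U i) \<and> diameter (U i) \<le> \<delta>" for i
      proof -
        obtain s k where sk: "prod_decode i = (s, k)" by fastforce
        have "S2 \<le> gen (s + S)" using gen_ge[of "s + S"] by (simp add: S_def)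
        then have "(1/2::real) ^ gen (s + S) \<le> (1/2) ^ S2" by (intro power_decreasing) auto
        then have "diameter (I (s + S) k) \<le> \<delta>" using S2 dI[of "s + S" k] by linarith
        moreover have "bounded (I (s + S) k)" unfolding I_def by (rule bounded_closed_interval)
        ultimately show ?thesis using del by (simp add: U_def G_def sk)
      qed
      have cov: "E \<subseteq> (\<Union>i. U i)"
      proof
        fix x assume x: "x \<in> E"
        have "\<exists>\<^sub>F s in sequentially. s \<ge> S \<and> nat (node s x) \<in> sel s"
          using frequently_eventually_frequently[OF hit[OF x] eventually_ge_at_top[of S]]
          by (rule frequently_elim1) blast
        then obtain s where s: "s \<ge> S" "nat (node s x) \<in> sel s" using frequently_ex by blast
        have "x \<in> K" using x EK by blast
        then have "0 \<le> x" using K_range by blast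
        then have fl: "0 \<le> node s x" by simp
        define k where "k = nat (node s x)"
        have k: "real k = real_of_int (node s x)" using fl by (simp add: k_def)
        have "real k \<le> 2 ^ gen s * x" "2 ^ gen s * x \<le> real k + 1" unfolding k by linarith+
        then have "x \<in> I s k" by (simp add: I_def field_simps)
        then have "x \<in> G (s - S, k)" using s by (simp add: G_def k_def)
        then have "x \<in> U (prod_encode (s - S, k))" by (simp add: U_def)
        then show "x \<in> (\<Union>i. U i)" by blast
      qed
      have inner: "(\<Sum>k. ennreal (diameter (G (s, k)) powr d)) \<le> ennreal (f (s + S))" for s
      proof -
        have "(\<Sum>k. ennreal (diameter (G (s, k)) powr d)) = (\<Sum>k\<in>sel (s + S). ennreal (diameter (G (s, k)) powr d))"
          by (rule suminf_finite[OF fin]) (simp add: G_def)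
        also have "\<dots> = (\<Sum>k\<in>sel (s + S). ennreal (2 powr (- (gen (s + S) * d))))"
        proof (rule sum.cong[OF refl])
          fix k assume "k \<in> sel (s + S)"
          then have "diameter (G (s, k)) powr d = ((1/2) ^ gen (s + S)) powr d" by (simp add: G_def dI)
          also have "(1/2::real) ^ gen (s + S) = 2 powr (- real (gen (s + S)))"
            by (simp add: powr_minus powr_realpow power_divide inverse_eq_divide)
          also have "\<dots> powr d = 2 powr (- (gen (s + S) * d))" by (simp add: powr_powr)
          finally show "ennreal (diameter (G (s, k)) powr d) = ennreal (2 powr (- (gen (s + S) * d)))" by simp
        qed
        also have "\<dots> = ennreal (card (sel (s + S)) * 2 powr (- (gen (s + S) * d)))"
          by (simp add: ennreal_mult'' ennreal_of_nat_eq_real_of_nat)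
        also have "\<dots> \<le> ennreal (f (s + S))" using cnt[of "s + S"] by (intro ennreal_leI) (simp add: f_def)
        finally show ?thesis .
      qed
      have "(\<Sum>i. ennreal (diameter (U i) powr d)) = (\<Sum>s. \<Sum>k. ennreal (diameter (G (s, k)) powr d))"
        unfolding U_def
        by (rule suminf_ennreal_2dimen[of "\<lambda>s. \<Sum>k. ennreal (diameter (G (s, k)) powr d)" "\<lambda>p. ennreal (diameter (G p) powr d)"]) simp
      also have "\<dots> \<le> (\<Sum>s. ennreal (f (s + S)))" by (intro suminf_le inner) auto
      also have "\<dots> = ennreal (\<Sum>s. f (s + S))"
      proof (rule suminf_ennreal2)
        show "0 \<le> f (s + S)" for s using C by (simp add: f_def)
        show "summable (\<lambda>s. f (s + S))" by (rule summable_ignore_initial_segment[OF sf])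
      qed
      also have "\<dots> \<le> ennreal \<epsilon>"
        using S1[of S] by (intro ennreal_leI) (auto simp: S_def)
      finally have le: "(\<Sum>i. ennreal (diameter (U i) powr d)) \<le> ennreal \<epsilon>" .
      have "hausdorff_pre d \<delta> E \<le> (\<Sum>i. ennreal (diameter (U i) powr d))"
        unfolding hausdorff_pre_def using Ub cov by (intro Inf_lower) blast
      then show ?thesis using le by (rule order_trans)
    qed
    have "hausdorff_pre d \<delta> E \<le> 0" if "\<delta> > 0" for \<delta>
      by (rule ennreal_le_epsilon) (use pre[OF that] in simp)
    then have "hausdorff_measure d E \<le> 0"
      unfolding hausdorff_measure_def by (intro SUP_least) simp
    then show ?thesis by simp
  qed
qed

section \<open>Cantor subsets with restricted digits\<close>

definition subK :: "(nat \<Rightarrow> int set) \<Rightarrow> real set" where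
  "subK A = {x \<in> K. \<forall>i. node (Suc i) x mod 2 ^ len i \<in> A i}"

lemma subK_point:
  assumes "\<And>i. c i \<in> A i" "\<And>i c. c \<in> A i \<Longrightarrow> 0 < v i c"
  obtains x where "x \<in> subK A" "\<And>s. node s x = pos c s"
proof -
  have v: "\<And>i. 0 < v i (c i)" using assms by blast
  obtain x where x: "x \<in> K" "\<And>s. node s x = pos c s" using point_exists[OF v] by blast
  have "node (Suc i) x mod 2 ^ len i = c i" for i
    using x(2)[of "Suc i"] pos_divmod(2)[of i c] v[of i] by simp
  then have "x \<in> subK A" using x(1) assms(1) by (simp add: subK_def)
  with x(2) show ?thesis using that by blast
qed

lemma subK_nonempty:
  assumes "\<And>i. A i \<noteq> {}" "\<And>i c. c \<in> A i \<Longrightarrow> 0 < v i c"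
  shows "subK A \<noteq> {}"
proof -
  have "\<forall>i. \<exists>c. c \<in> A i" using assms(1) by blast
  then obtain c where "\<And>i. c i \<in> A i" by metis
  then obtain x where "x \<in> subK A" using subK_point[of c A, OF _ assms(2)] by metis
  then show ?thesis by blast
qed

text \<open>A number y in [0, 1) is expanded in mixed radix with bases \<open>card (A i)\<close>,
  and its digits select the children. Agreement up to stage i forces |y - y'| \<le> 1 /
  \<open>M i\<close>, while a difference at stage i + 1 separates the images by at least
  2^(-\<open>gen (Suc i)\<close>); as consecutive generations are comparable, the map is expanding
  with exponent s < d.\<close>

lemma dimH_subK_ge:
  fixes s d :: real
  assumes ne: "\<And>i. A i \<noteq> {}" and dig: "\<And>i c. c \<in> A i \<Longrightarrow> 0 < v i c"
    and s: "0 < s" "s < d" and card: "\<forall>\<^sub>F i in sequentially. 2 powr (len i * d) \<le> card (A i)"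
  shows "ereal s \<le> dimH (subK A)"
proof -
  have fin: "finite (A i)" for i
  proof (rule finite_subset)
    show "A i \<subseteq> {0..<2 ^ len i}" using dig digit_range by blast
  qed simp
  define N where "N i = card (A i)" for i
  have N: "N i > 0" for i using ne fin by (simp add: N_def card_gt_0_iff)
  have "\<forall>i. \<exists>e. bij_betw e {0..<N i} (A i)" using fin ex_bij_betw_nat_finite unfolding N_def by blast
  then obtain e where e: "\<And>i. bij_betw (e i) {0..<N i} (A i)" by metis
  define M where "M s = (\<Prod>i<s. N i)" for s
  have M_Suc: "M (Suc i) = M i * N i" and M0: "M 0 = 1" for i by (simp_all add: M_def)
  have "\<forall>\<^sub>F i in sequentially. 2 powr (- (len i * (- d))) \<le> real (N i)" using card by (simp add: N_def)
  then obtain c where c: "c > 0" "\<And>s. c * 2 powr (- (gen s * (- d))) \<le> (\<Prod>i<s. real (N i))"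
    using prod_lower[of "\<lambda>i. real (N i)" "- d"] N by auto
  have Mge: "c * 2 powr (gen s * d) \<le> real (M s)" for s using c(2)[of s] by (simp add: M_def)
  \<comment> \<open>\<open>f y s\<close> numbers the interval of length 1 / \<open>M s\<close> that
    contains y; reduced modulo the last base it is the last mixed radix digit.\<close>
  define f where "f y s = nat \<lfloor>y * real (M s)\<rfloor>" for y :: real and s
  have f_div: "f y i = f y (Suc i) div N i" if "0 \<le> y" for y i
  proof -
    have "\<lfloor>y * M (Suc i) / real_of_int (int (N i))\<rfloor> = \<lfloor>y * M (Suc i)\<rfloor> div int (N i)"
      by (rule floor_divide_real_eq_div) simp
    moreover have "y * M (Suc i) / real_of_int (int (N i)) = y * M i" using N[of i] by (simp add: M_Suc)
    ultimately show ?thesis using that unfolding f_def by (simp add: nat_div_distrib)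
  qed
  define dg where "dg y i = e i (f y (Suc i) mod N i)" for y i
  have dgA: "dg y i \<in> A i" for y i
    unfolding dg_def using bij_betwE[OF e[of i]] N[of i] by simp
  have "\<exists>x. x \<in> subK A \<and> (\<forall>s. node s x = pos (dg y) s)" for y
    using subK_point[of "dg y" A, OF dgA dig] by metis
  then obtain \<phi> where \<phi>: "\<And>y. \<phi> y \<in> subK A" "\<And>y s. node s (\<phi> y) = pos (dg y) s" by metis
  obtain c' where c': "\<And>i. gen (Suc i) * s \<le> gen i * d + c'"
    using gen_Suc_slack[of s d] s by auto
  define C where "C = 2 powr c' / c"
  have expand: "\<bar>y - y'\<bar> \<le> C * \<bar>\<phi> y - \<phi> y'\<bar> powr s" if y: "y \<in> {0..<1}" "y' \<in> {0..<1}" for y y' :: real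
  proof (cases "y = y'")
    case False
    have same: "\<bar>y - y'\<bar> * (c * 2 powr (gen i * d)) \<le> 1" if "f y i = f y' i" for i
    proof -
      have "0 \<le> y * M i" "0 \<le> y' * M i" using y by auto
      then have "\<lfloor>y * M i\<rfloor> = \<lfloor>y' * M i\<rfloor>" using that unfolding f_def by (simp add: eq_nat_nat_iff)
      then have "\<bar>y * M i - y' * M i\<bar> \<le> 1" by linarith
      then have "\<bar>y - y'\<bar> * M i \<le> 1" by (simp add: left_diff_distrib[symmetric] abs_mult)
      then show ?thesis
        using mult_left_mono[OF Mge[of i], of "\<bar>y - y'\<bar>"] by linarith
    qed
    \<comment> \<open>Distinct points are told apart eventually because \<open>M\<close> tends to
      infinity, d being positive.\<close>
    obtain j where "f y j \<noteq> f y' j"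
    proof -
      have "0 < d" using s by simp
      from absorb_const[OF this, of "2 / (c * \<bar>y - y'\<bar>)"]
      obtain j where j: "2 / (c * \<bar>y - y'\<bar>) * 2 powr (- (gen j * d)) \<le> 2 powr (- (gen j * (0::real)))"
        unfolding eventually_sequentially by blast
      define a where "a = c * \<bar>y - y'\<bar>"
      define e where "e = 2 powr (gen j * d)"
      have pos: "0 < a" "0 < e" using False c by (simp_all add: a_def e_def)
      have "2 / a * (1 / e) \<le> 1"
        using j by (simp add: a_def e_def powr_minus_divide)
      then have "2 \<le> a * e" using pos by (simp add: field_simps)
      then have "2 \<le> \<bar>y - y'\<bar> * (c * 2 powr (gen j * d))"
        by (simp only: a_def e_def mult_ac)
      then have "f y j \<noteq> f y' j" using same[of j] by linarith
      then show ?thesis by (rule that)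
    qed
    moreover have "\<not> f y 0 \<noteq> f y' 0"
      using y by (simp add: f_def M0)
    ultimately obtain i where i: "f y i = f y' i" "f y (Suc i) \<noteq> f y' (Suc i)"
      using ex_least_nat_less[of "\<lambda>i. f y i \<noteq> f y' i" j] by blast
    have "f y (Suc i) mod N i \<noteq> f y' (Suc i) mod N i"
      using i f_div[of y i] f_div[of y' i] y by (metis atLeastLessThan_iff div_mult_mod_eq)
    then have dne: "dg y i \<noteq> dg y' i"
      unfolding dg_def using bij_betw_imp_inj_on[OF e[of i]] N[of i] by (simp add: inj_on_eq_iff)
    have vy: "\<And>i. 0 < v i (dg y i)" for y using dgA dig by blast
    define p where "p = pos (dg y) (Suc i)"
    define p' where "p' = pos (dg y') (Suc i)"
    have "p \<noteq> p'" unfolding p_def p'_def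
      using dne pos_divmod(2)[of i "dg y"] pos_divmod(2)[of i "dg y'"] vy by metis
    moreover have "0 < lam (Suc i) p" "0 < lam (Suc i) p'"
      using \<phi>(1)[of y] \<phi>(1)[of y'] unfolding p_def p'_def \<phi>(2)[symmetric] subK_def K_def by blast+
    ultimately have "4 \<le> \<bar>p - p'\<bar>" by (intro lam_separated)
    moreover have "p = node (Suc i) (\<phi> y)" "p' = node (Suc i) (\<phi> y')" by (simp_all add: p_def p'_def \<phi>(2))
    ultimately have "1 \<le> \<bar>2 ^ gen (Suc i) * \<phi> y - 2 ^ gen (Suc i) * \<phi> y'\<bar>" by linarith
    also have "\<dots> = 2 ^ gen (Suc i) * \<bar>\<phi> y - \<phi> y'\<bar>"
      by (simp add: right_diff_distrib[symmetric] abs_mult)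
    finally have "2 powr (- real (gen (Suc i))) \<le> \<bar>\<phi> y - \<phi> y'\<bar>"
      by (simp add: powr_minus powr_realpow field_simps)
    then have "(2 powr (- real (gen (Suc i)))) powr s \<le> \<bar>\<phi> y - \<phi> y'\<bar> powr s" using s by (intro powr_mono2) auto
    then have dist: "2 powr (- (gen (Suc i) * s)) \<le> \<bar>\<phi> y - \<phi> y'\<bar> powr s" by (simp add: powr_powr)
    have "\<bar>y - y'\<bar> \<le> (1 / c) * 2 powr (- (gen i * d))"
      using same[OF i(1)] c by (simp add: powr_minus field_simps)
    also have "\<dots> \<le> (1 / c) * 2 powr (c' + - (gen (Suc i) * s))"
      using c'[of i] c by (intro mult_left_mono powr_mono) auto
    also have "\<dots> = C * 2 powr (- (gen (Suc i) * s))" by (simp only: powr_add C_def) simp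
    also have "\<dots> \<le> C * \<bar>\<phi> y - \<phi> y'\<bar> powr s" using dist c by (intro mult_left_mono) (auto simp: C_def)
    finally show ?thesis .
  qed (use c in \<open>simp add: C_def\<close>)
  show ?thesis
    by (rule dimH_ge_expanding[OF s(1) _ expand]) (use \<phi> c in \<open>auto simp: C_def\<close>)
qed

end

section \<open>The multifractal formalism\<close>

context cascade
begin

lemma lam_floor_prod:
  fixes x :: real
  assumes "\<lfloor>x\<rfloor> = 0"
  shows "lam s (node s x) = (\<Prod>i<s. v i (node (Suc i) x mod 2 ^ len i))"
proof (induction s)
  case 0
  then show ?case using assms by simp
next
  case (Suc s)
  have "node (Suc s) x div 2 ^ len s = node s x"
    using floor_ancestor[of s "Suc s" x] by (simp add: gen_Suc)
  then show ?case using Suc by simp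
qed

text \<open>The first S digit sets are replaced by the digits of x0, which forces every point into
  the node of x0 at stage S. Exponents and dimension bounds depend only on the tail, so nothing is
  lost.\<close>

lemma subK_localize:
  assumes x0: "x0 \<in> K" and r: "r > 0" and sub: "\<And>i c. c \<in> A i \<Longrightarrow> 0 < v i c"
  obtains A' where "\<And>i c. c \<in> A' i \<Longrightarrow> 0 < v i c" "\<forall>\<^sub>F i in sequentially. A' i = A i"
    "\<And>i. A i \<noteq> {} \<Longrightarrow> A' i \<noteq> {}" "subK A' \<subseteq> ball x0 r"
proof -
  obtain S where S: "(1/2) ^ S < r" using real_arch_pow_inv[OF r, of "1/2"] by auto
  define dg where "dg i = node (Suc i) x0 mod 2 ^ len i" for i
  define A' where "A' i = (if i < S then {dg i} else A i)" for i
  have dg: "0 < v i (dg i)" for i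
    using x0 lam_SucD[of i "node (Suc i) x0"] unfolding K_def dg_def by blast
  show ?thesis
  proof
    show "0 < v i c" if "c \<in> A' i" for i c using that sub dg by (auto simp: A'_def split: if_splits)
    show "\<forall>\<^sub>F i in sequentially. A' i = A i"
      using eventually_ge_at_top[of S] by eventually_elim (simp add: A'_def)
    show "A' i \<noteq> {}" if "A i \<noteq> {}" for i using that by (simp add: A'_def)
    show "subK A' \<subseteq> ball x0 r"
    proof
      fix x assume x: "x \<in> subK A'"
      then have "x \<in> K" by (simp add: subK_def)
      have "node s x = node s x0" if "s \<le> S" for s
        using that
      proof (induction s)
        case 0
        have "\<lfloor>y\<rfloor> = 0" if "y \<in> K" for y using K_range[OF that] by (simp add: floor_eq_iff)
        then show ?case using \<open>x \<in> K\<close> x0 by simp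
      next
        case (Suc s)
        have m: "node (Suc s) x mod 2 ^ len s = node (Suc s) x0 mod 2 ^ len s"
          using x Suc.prems unfolding subK_def A'_def dg_def by (auto dest: spec[of _ s])
        have d: "node (Suc s) y div 2 ^ len s = node s y" for y :: real
          using floor_ancestor[of s "Suc s" y] by (simp add: gen_Suc)
        have "node (Suc s) x div 2 ^ len s = node (Suc s) x0 div 2 ^ len s"
          unfolding d using Suc by simp
        with m show ?case by (metis div_mult_mod_eq)
      qed
      then have "node S x = node S x0" by simp
      then have "\<bar>2 ^ gen S * x - 2 ^ gen S * x0\<bar> < 1" by linarith
      then have "2 ^ gen S * \<bar>x - x0\<bar> < 1" by (simp add: right_diff_distrib[symmetric] abs_mult)
      then have "\<bar>x - x0\<bar> < (1/2) ^ gen S" by (simp add: power_divide field_simps)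
      also have "\<dots> \<le> (1/2) ^ S" by (intro power_decreasing gen_ge) auto
      finally show "x \<in> ball x0 r" using S by (simp add: dist_real_def abs_minus_commute)
    qed
  qed
qed

end

context wavelet_cascade
begin

lemma hoelder_exp_nonneg: "x \<in> K \<Longrightarrow> 0 \<le> hoelder_exp F x"
proof -
  assume x: "x \<in> K"
  have "\<forall>\<^sub>F s in sequentially. lam s (node s x) \<le> 2 powr (- (gen s * \<alpha>))"
    using lam_le by (simp add: mult.commute)
  from lam_le_imp_hoelder_exp_ge[OF x order_refl alpha_pos this] show ?thesis by (simp add: zero_ereal_def)
qed

lemma hoelder_exp_lt_imp_frequently:
  fixes h1 x :: real
  assumes x: "x \<in> K" and h: "hoelder_exp F x < ereal h1"
  shows "\<exists>\<^sub>F s in sequentially. 2 powr (- (gen s * h1)) \<le> lam s (node s x)"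
proof (rule ccontr)
  assume "\<not> ?thesis"
  then have ev: "\<forall>\<^sub>F s in sequentially. lam s (node s x) \<le> 2 powr (- (gen s * h1))"
    unfolding not_frequently by eventually_elim simp
  obtain z where z: "hoelder_exp F x < ereal z" "ereal z < ereal h1" using ereal_dense2[OF h] by blast
  have "0 \<le> ereal z" using hoelder_exp_nonneg[OF x] z(1) by (meson less_imp_le order_trans)
  then have "ereal z \<le> hoelder_exp F x"
    using z(2) by (intro lam_le_imp_hoelder_exp_ge[OF x _ _ ev]) auto
  then show False using z(1) by simp
qed

text \<open>The weight along the branch of x is the product of the chosen factors, so eventual
  bounds on factors become bounds on the product up to constants, and these disappear in the strict
  margins. For h = \<infinity> the assumption \<open>up\<close> is vacuous.\<close>

lemma hoelder_exp_subK:
  assumes x: "x \<in> subK A"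
    and lo: "\<And>r :: real. ereal r < h \<Longrightarrow> \<forall>\<^sub>F i in sequentially. \<forall>c\<in>A i. v i c \<le> 2 powr (- (len i * r))"
    and up: "\<And>r :: real. h < ereal r \<Longrightarrow> \<forall>\<^sub>F i in sequentially. \<forall>c\<in>A i. 2 powr (- (len i * r)) \<le> v i c"
  shows "hoelder_exp F x = h"
proof (rule antisym)
  have K: "x \<in> K" using x by (simp add: subK_def)
  define z where "z i = v i (node (Suc i) x mod 2 ^ len i)" for i
  have zA: "node (Suc i) x mod 2 ^ len i \<in> A i" for i using x by (simp add: subK_def)
  have lam: "lam s (node s x) = (\<Prod>i<s. z i)" for s
    unfolding z_def by (rule lam_floor_prod) (use K_range[OF K] in \<open>simp add: floor_eq_iff\<close>)
  have zpos: "0 < z i" for i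
    using K lam_SucD[of i "node (Suc i) x"] unfolding K_def z_def by blast
  show "hoelder_exp F x \<le> h"
  proof (rule ccontr)
    assume "\<not> hoelder_exp F x \<le> h"
    then have "h < hoelder_exp F x" by simp
    from ereal_dense2[OF this] obtain r where r: "h < ereal r" "ereal r < hoelder_exp F x" by blast
    obtain r' where r'0: "h < ereal r'" "ereal r' < ereal r" using ereal_dense2[OF r(1)] by blast
    then have r': "h < ereal r'" "r' < r" by simp_all
    have "\<forall>\<^sub>F i in sequentially. 2 powr (- (len i * r')) \<le> z i"
      using up[OF r'(1)] by eventually_elim (use zA in \<open>auto simp: z_def\<close>)
    then obtain c where c: "c > 0" "\<And>s. c * 2 powr (- (gen s * r')) \<le> (\<Prod>i<s. z i)"
      using prod_lower[of z r', OF zpos] by blast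
    have "\<forall>\<^sub>F s in sequentially. (2 / c) * 2 powr (- (gen s * r)) \<le> 2 powr (- (gen s * r'))"
      by (rule absorb_const[OF r'(2)])
    moreover have "\<forall>\<^sub>F s in sequentially. lam s (node s x) \<le> 2 powr (- (gen s * r))"
      by (rule hoelder_exp_gt_imp_lam_le[OF r(2)])
    ultimately have "\<forall>\<^sub>F s in sequentially. False"
    proof eventually_elim
      case (elim s)
      have "c * 2 powr (- (gen s * r')) \<le> 2 powr (- (gen s * r))" using c(2)[of s] elim(2) lam by simp
      moreover have "2 * 2 powr (- (gen s * r)) \<le> c * 2 powr (- (gen s * r'))"
        using elim(1) c(1) by (simp add: field_simps)
      moreover have "(0::real) < 2 powr (- (gen s * r))" by simp
      ultimately show False by linarith
    qed
    then show False by simp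
  qed
  show "h \<le> hoelder_exp F x"
  proof (rule ccontr)
    assume "\<not> h \<le> hoelder_exp F x"
    then have "hoelder_exp F x < h" by simp
    from ereal_dense2[OF this] obtain h2 where h2: "hoelder_exp F x < ereal h2" "ereal h2 < h" by blast
    obtain r where r0: "ereal h2 < ereal r" "ereal r < h" using ereal_dense2[OF h2(2)] by blast
    then have r: "ereal r < h" "h2 < r" by simp_all
    have "\<forall>\<^sub>F i in sequentially. z i \<le> 2 powr (- (len i * r))"
      using lo[OF r(1)] by eventually_elim (use zA in \<open>auto simp: z_def\<close>)
    then obtain C where C: "\<And>s. (\<Prod>i<s. z i) \<le> C * 2 powr (- (gen s * r))"
      using prod_upper[of z r] zpos by (metis less_imp_le)
    have h2': "h2 < (h2 + r) / 2" "(h2 + r) / 2 < r" using r by auto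
    have "\<forall>\<^sub>F s in sequentially. C * 2 powr (- (gen s * r)) \<le> 2 powr (- (gen s * ((h2 + r) / 2)))"
      by (rule absorb_const[OF h2'(2)])
    then have ev: "\<forall>\<^sub>F s in sequentially. lam s (node s x) \<le> 2 powr (- (gen s * ((h2 + r) / 2)))"
      by eventually_elim (use C in \<open>auto simp: lam intro: order_trans\<close>)
    have "0 \<le> ereal h2" using hoelder_exp_nonneg[OF K] h2(1) by (meson less_imp_le order_trans)
    then have "ereal h2 \<le> hoelder_exp F x"
      using h2' by (intro lam_le_imp_hoelder_exp_ge[OF K _ _ ev]) auto
    then show False using h2(1) by simp
  qed
qed

text \<open>The terms of \<open>Z\<close> are nonnegative, so a subfamily of 2^(l s) digits with
  weight^q at least 2^(-l r) already bounds it from below.\<close>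

lemma scaling_fun_le_subdigits:
  fixes r s q :: real
  assumes dig: "\<And>i c. c \<in> A i \<Longrightarrow> 0 < v i c"
    and w: "\<forall>\<^sub>F i in sequentially. \<forall>c\<in>A i. 2 powr (- (len i * r)) \<le> v i c powr q"
    and card: "\<forall>\<^sub>F i in sequentially. 2 powr (len i * s) \<le> card (A i)"
  shows "scaling_fun \<psi> F q \<le> ereal (r - s)"
proof (rule scaling_fun_le)
  show "\<forall>\<^sub>F i in sequentially. 2 powr (- (len i * (r - s))) \<le> Z i q"
    using w card
  proof eventually_elim
    case (elim i)
    have sub: "A i \<subseteq> {0..<2 ^ len i}" using dig digit_range by blast
    have "2 powr (- (len i * (r - s))) = 2 powr (len i * s) * 2 powr (- (len i * r))"
      by (simp add: powr_add[symmetric] algebra_simps)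
    also have "\<dots> \<le> card (A i) * 2 powr (- (len i * r))" using elim(2) by (intro mult_right_mono) auto
    also have "\<dots> = (\<Sum>c\<in>A i. 2 powr (- (len i * r)))" by simp
    also have "\<dots> \<le> (\<Sum>c\<in>A i. v i c powr q)" using elim(1) by (intro sum_mono) auto
    also have "\<dots> \<le> Z i q" unfolding Z_def using sub by (intro sum_mono2) auto
    finally show ?case .
  qed
qed

end

text \<open>Interface between the multifractal analysis and the construction of digits.
  \<open>digits\<close> supplies enough children of every admissible exponent, \<infinity> included,
  and yields the lower bounds on dimensions; \<open>Z_upper\<close> says that all children together
  are not too many, and yields the upper bounds. \<open>supergradient\<close> provides an exponent
  whose transform is attained at q.\<close>

locale realization = wavelet_cascade +
  fixes T :: "real \<Rightarrow> ereal"
  assumes T_noinf: "T q \<noteq> \<infinity>"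
    and T_dom: "edom T = UNIV \<or> edom T = {0..}"
    and T_star: "h \<noteq> -\<infinity> \<Longrightarrow> legendre T h > -\<infinity> \<Longrightarrow> legendre T h \<ge> 0"
    and T_star_pos: "legendre T h \<ge> 0 \<Longrightarrow> h \<noteq> -\<infinity> \<Longrightarrow> h > 0"
    and supergradient: "q \<in> edom T \<Longrightarrow> edom T = UNIV \<or> q > 0 \<Longrightarrow> \<exists>h. legendre T (ereal h) = ereal (h * q) - T q"
    and Z_upper: "q \<in> edom T \<Longrightarrow> ereal \<tau> < T q \<Longrightarrow> \<forall>\<^sub>F i in sequentially. Z i q \<le> 2 powr (- (real (len i) * \<tau>))"
    and digits: "h > 0 \<Longrightarrow> legendre T h \<ge> 0 \<Longrightarrow> \<exists>A. (\<forall>i. A i \<noteq> {}) \<and> (\<forall>i. \<forall>c\<in>A i. 0 < v i c) \<and>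
        (\<forall>r::real. ereal r < h \<longrightarrow> (\<forall>\<^sub>F i in sequentially. \<forall>c\<in>A i. v i c \<le> 2 powr (- (len i * r)))) \<and>
        (\<forall>r::real. h < ereal r \<longrightarrow> (\<forall>\<^sub>F i in sequentially. \<forall>c\<in>A i. 2 powr (- (len i * r)) \<le> v i c)) \<and>
        (\<forall>s::real. ereal s < legendre T h \<longrightarrow> (\<forall>\<^sub>F i in sequentially. 2 powr (len i * s) \<le> card (A i)))"
begin

lemma T_real: "q \<in> edom T \<Longrightarrow> \<exists>t. T q = ereal t"
  using T_noinf[of q] unfolding edom_def by (cases "T q") auto

text \<open>The covering argument with its loss e tending to 0. The second conclusion serves to
  exclude points: a negative r - t is incompatible with a nonempty E.\<close>

lemma iso_set_bound:
  fixes q r t :: real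
  assumes q: "q \<in> edom T" "T q = ereal t" and E: "E \<subseteq> K" "E \<noteq> {}"
    and fr: "\<And>x (e::real). x \<in> E \<Longrightarrow> e > 0 \<Longrightarrow> \<exists>\<^sub>F s in sequentially. 2 powr (- (gen s * (r + e))) \<le> lam s (node s x) powr q"
  shows "dimH E \<le> ereal (r - t)" "0 \<le> r - t"
proof -
  have *: "0 < r - t + e \<and> dimH E \<le> ereal (r - t + e)" if e: "e > 0" for e :: real
  proof -
    \<comment> \<open>One third of e goes to the partition function and one third to the weights,
      which leaves the strict inequality that the covering argument asks for.\<close>
    have Z: "\<forall>\<^sub>F i in sequentially. Z i q \<le> 2 powr (- (len i * (t - e / 3)))"
      using e q by (intro Z_upper) auto
    have f: "\<And>x. x \<in> E \<Longrightarrow> \<exists>\<^sub>F s in sequentially. 2 powr (- (gen s * (r + e / 3))) \<le> lam s (node s x) powr q"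
      using fr e by simp
    have d: "r + e / 3 - (t - e / 3) < r - t + e" using e by simp
    have H: "0 < r - t + e \<Longrightarrow> hausdorff_measure (r - t + e) E = 0" "r - t + e \<le> 0 \<Longrightarrow> E = {}"
      using frequently_heavy_cover[OF E(1) f Z d] by blast+
    have pos: "0 < r - t + e" using H(2) E(2) by (meson not_less)
    show ?thesis using pos dimH_le[OF pos H(1)[OF pos]] by simp
  qed
  show "dimH E \<le> ereal (r - t)"
    by (rule ereal_le_epsilon2) (use * in auto)
  show "0 \<le> r - t"
    by (rule field_le_epsilon) (use * in \<open>auto intro: less_imp_le\<close>)
qed

lemma iso_set_sub: "iso_set \<psi> F h \<subseteq> K"
  by (auto simp: iso_set_def wsupp_eq)

lemma frequently_powr_upper:
  fixes h q e x :: real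
  assumes x: "x \<in> K" and h: "hoelder_exp F x \<le> ereal h" and q: "q \<ge> 0" and e: "e > 0"
  shows "\<exists>\<^sub>F s in sequentially. 2 powr (- (gen s * (h * q + e))) \<le> lam s (node s x) powr q"
proof -
  \<comment> \<open>Dividing by q + 1 instead of q also covers q = 0.\<close>
  define h1 where "h1 = h + e / (q + 1)"
  have q1: "0 < q + 1" using q by simp
  have "ereal h < ereal h1" using e q1 by (simp add: h1_def)
  with h have "hoelder_exp F x < ereal h1" by (rule le_less_trans)
  from hoelder_exp_lt_imp_frequently[OF x this] show ?thesis
  proof (rule frequently_elim1)
    fix s assume a: "2 powr (- (gen s * h1)) \<le> lam s (node s x)"
    have "e / (q + 1) * q \<le> e" using q e by (simp add: field_simps)
    then have "h1 * q \<le> h * q + e" by (simp add: h1_def distrib_right)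
    then have "gen s * (h1 * q) \<le> gen s * (h * q + e)" by (intro mult_left_mono) auto
    then have "2 powr (- (gen s * (h * q + e))) \<le> 2 powr (- (gen s * h1) * q)" by (intro powr_mono) auto
    also have "\<dots> = (2 powr (- (gen s * h1))) powr q" by (simp add: powr_powr)
    also have "\<dots> \<le> lam s (node s x) powr q" using a q by (intro powr_mono2) auto
    finally show "2 powr (- (gen s * (h * q + e))) \<le> lam s (node s x) powr q" .
  qed
qed

text \<open>For q \<le> 0 small weights have large powers, and a lower bound on the exponent makes
  the weights small at all late stages.\<close>

lemma frequently_powr_lower:
  fixes h1 q r x :: real
  assumes x: "x \<in> K" and h: "ereal h1 < hoelder_exp F x" and q: "q \<le> 0" and r: "h1 * q \<le> r"
  shows "\<exists>\<^sub>F s in sequentially. 2 powr (- (gen s * r)) \<le> lam s (node s x) powr q"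
proof -
  have "\<forall>\<^sub>F s in sequentially. 2 powr (- (gen s * r)) \<le> lam s (node s x) powr q"
    using hoelder_exp_gt_imp_lam_le[OF h]
  proof eventually_elim
    case (elim s)
    have pos: "0 < lam s (node s x)" using x unfolding K_def by blast
    have "gen s * (h1 * q) \<le> gen s * r" using r by (intro mult_left_mono) auto
    then have "2 powr (- (gen s * r)) \<le> 2 powr (- (gen s * h1) * q)" by (intro powr_mono) auto
    also have "\<dots> = (2 powr (- (gen s * h1))) powr q" by (simp add: powr_powr)
    also have "\<dots> \<le> lam s (node s x) powr q" using elim q pos by (intro powr_mono2') auto
    finally show ?case .
  qed
  then show ?thesis by (simp add: eventually_frequently)
qed

lemma dimH_iso_le: "dimH (iso_set \<psi> F h) \<le> legendre T h"
proof (cases "iso_set \<psi> F h = {}")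
  case True
  then show ?thesis by (simp add: dimH_def)
next
  case ne: False
  have hx: "hoelder_exp F x = h" "x \<in> K" if "x \<in> iso_set \<psi> F h" for x
    using that iso_set_sub by (auto simp: iso_set_def)
  have "0 \<le> h" using ne hx hoelder_exp_nonneg by force
  show ?thesis
  proof (cases h)
    case PInf
    have main: "dimH (iso_set \<psi> F h) \<le> (if q < 0 then -\<infinity> else 0) - T q" if q: "q \<in> edom T" "q \<le> 0" for q
    proof -
      obtain t where t: "T q = ereal t" using T_real[OF q(1)] by blast
      show ?thesis
      proof (cases "q < 0")
        case True
        \<comment> \<open>Every finite h1 lies below the exponent \<infinity>. This one gives h1 * q
          = -(|t| + 1), so the resulting inequality 0 \<le> h1 * q - t is absurd: a finite value of
          T at a negative q excludes infinite exponents.\<close>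
        define h1 where "h1 = (\<bar>t\<bar> + 1) / (- q)"
        have h1: "h1 * q = - (\<bar>t\<bar> + 1)" using True by (simp add: h1_def)
        have "0 \<le> - (\<bar>t\<bar> + 1) - t"
        proof (rule iso_set_bound(2)[OF q(1) t iso_set_sub ne])
          fix x and e :: real assume "x \<in> iso_set \<psi> F h" "e > 0"
          then show "\<exists>\<^sub>F s in sequentially. 2 powr (- (gen s * (- (\<bar>t\<bar> + 1) + e))) \<le> lam s (node s x) powr q"
            using hx[of x] PInf q h1 by (intro frequently_powr_lower[of x h1]) auto
        qed
        then show ?thesis by linarith
      next
        case False
        then have q0: "q = 0" using q by simp
        have "dimH (iso_set \<psi> F h) \<le> ereal (0 - t)"
        proof (rule iso_set_bound(1)[OF q(1) t iso_set_sub ne])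
          fix x and e :: real assume "x \<in> iso_set \<psi> F h" "e > 0"
          then show "\<exists>\<^sub>F s in sequentially. 2 powr (- (gen s * (0 + e))) \<le> lam s (node s x) powr q"
            using hx[of x] PInf q0 by (intro frequently_powr_lower[of x 0]) auto
        qed
        then show ?thesis using q0 t by simp
      qed
    qed
    have leg: "legendre T h = Inf {(if q < 0 then -\<infinity> else 0) - T q |q. q \<in> edom T \<and> q \<le> 0}"
      unfolding legendre_def PInf by (simp only: simp_thms if_True)
    show ?thesis unfolding leg by (rule Inf_greatest) (use main in blast)
  next
    case (real h0)
    have main: "dimH (iso_set \<psi> F h) \<le> ereal (h0 * q) - T q" if q: "q \<in> edom T" for q
    proof -
      obtain t where t: "T q = ereal t" using T_real[OF q(1)] by blast
      have "dimH (iso_set \<psi> F h) \<le> ereal (h0 * q - t)"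
      proof (rule iso_set_bound(1)[OF q t iso_set_sub ne])
        fix x and e :: real assume x: "x \<in> iso_set \<psi> F h" "e > 0"
        show "\<exists>\<^sub>F s in sequentially. 2 powr (- (gen s * (h0 * q + e))) \<le> lam s (node s x) powr q"
        proof (cases "0 \<le> q")
          case True
          then show ?thesis using hx[OF x(1)] real x(2) by (intro frequently_powr_upper) auto
        next
          case False
          \<comment> \<open>Smaller than h0 because q < 0, with h1 * q = h0 * q + e: the slack in
            the exponent becomes exactly the allowed slack e.\<close>
          define h1 where "h1 = h0 + e / q"
          have "h1 < h0" using False x(2) by (simp add: h1_def divide_pos_neg)
          moreover have "h1 * q = h0 * q + e" using False by (simp add: h1_def distrib_right)
          ultimately show ?thesis using hx[OF x(1)] real False by (intro frequently_powr_lower[of x h1]) auto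
        qed
      qed
      then show ?thesis using t by simp
    qed
    have leg: "legendre T h = Inf {ereal (h0 * q) - T q |q. q \<in> edom T}"
      by (simp add: legendre_def real)
    show ?thesis unfolding leg by (rule Inf_greatest) (use main in blast)
  next
    case MInf
    then show ?thesis using \<open>0 \<le> h\<close> by simp
  qed
qed

text \<open>A nonempty set has nonnegative dimension, so a negative upper bound forces
  emptiness.\<close>

lemma iso_empty: "h = -\<infinity> \<or> \<not> 0 \<le> legendre T h \<Longrightarrow> iso_set \<psi> F h = {}"
proof (rule ccontr)
  assume h: "h = -\<infinity> \<or> \<not> 0 \<le> legendre T h" and ne: "iso_set \<psi> F h \<noteq> {}"
  then obtain x where x: "x \<in> K" "hoelder_exp F x = h" using iso_set_sub by (auto simp: iso_set_def)
  then have "h \<noteq> -\<infinity>" using hoelder_exp_nonneg[OF x(1)] by auto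
  moreover have "0 \<le> legendre T h" using dimH_nonneg[OF ne] dimH_iso_le[of h] by (rule order_trans)
  ultimately show False using h by blast
qed

lemma dimH_iso_ball_ge:
  assumes h: "h \<noteq> -\<infinity>" "0 \<le> legendre T h" and x0: "x0 \<in> K" and r: "r > 0"
  shows "legendre T h \<le> dimH (iso_set \<psi> F h \<inter> ball x0 r)"
proof -
  have hpos: "h > 0" using T_star_pos h by blast
  obtain A where A: "\<And>i. A i \<noteq> {}" "\<And>i c. c \<in> A i \<Longrightarrow> 0 < v i c"
    and lo: "\<And>r::real. ereal r < h \<Longrightarrow> \<forall>\<^sub>F i in sequentially. \<forall>c\<in>A i. v i c \<le> 2 powr (- (len i * r))"
    and up: "\<And>r::real. h < ereal r \<Longrightarrow> \<forall>\<^sub>F i in sequentially. \<forall>c\<in>A i. 2 powr (- (len i * r)) \<le> v i c"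
    and card: "\<And>s::real. ereal s < legendre T h \<Longrightarrow> \<forall>\<^sub>F i in sequentially. 2 powr (len i * s) \<le> card (A i)"
    using digits[OF hpos h(2)] by blast
  obtain A' where A': "\<And>i c. c \<in> A' i \<Longrightarrow> 0 < v i c" and eq: "\<forall>\<^sub>F i in sequentially. A' i = A i"
    and ne': "\<And>i. A i \<noteq> {} \<Longrightarrow> A' i \<noteq> {}" and ball: "subK A' \<subseteq> ball x0 r"
    using subK_localize[where A = A, OF x0 r A(2)] by blast
  have ne: "A' i \<noteq> {}" for i using ne' A(1) by blast
  have sub: "subK A' \<subseteq> iso_set \<psi> F h \<inter> ball x0 r"
  proof
    fix x assume x: "x \<in> subK A'"
    have "hoelder_exp F x = h"
    proof (rule hoelder_exp_subK[OF x])
      show "\<forall>\<^sub>F i in sequentially. \<forall>c\<in>A' i. v i c \<le> 2 powr (- (len i * r))" if "ereal r < h" for r :: real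
        using lo[OF that] eq by eventually_elim simp
      show "\<forall>\<^sub>F i in sequentially. \<forall>c\<in>A' i. 2 powr (- (len i * r)) \<le> v i c" if "h < ereal r" for r :: real
        using up[OF that] eq by eventually_elim simp
    qed
    then show "x \<in> iso_set \<psi> F h \<inter> ball x0 r" using x ball by (auto simp: iso_set_def wsupp_eq subK_def)
  qed
  \<comment> \<open>This settles the case where the transform is 0 at h, in which only nonemptiness
    is at stake, and makes the \<open>s\<close> below positive.\<close>
  have dim0: "0 \<le> dimH (subK A')" by (intro dimH_nonneg subK_nonempty ne A')
  have "legendre T h \<le> dimH (subK A')"
  proof (rule ccontr)
    assume "\<not> legendre T h \<le> dimH (subK A')"
    then have "dimH (subK A') < legendre T h" by simp
    from ereal_dense2[OF this]
    obtain s where s: "dimH (subK A') < ereal s" "ereal s < legendre T h" by blast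
    obtain d where d0: "ereal s < ereal d" "ereal d < legendre T h" using ereal_dense2[OF s(2)] by blast
    then have d: "s < d" "ereal d < legendre T h" by simp_all
    have "0 < ereal s" using dim0 s(1) by (rule order_le_less_trans)
    then have "0 < s" by simp
    have cd: "\<forall>\<^sub>F i in sequentially. 2 powr (len i * d) \<le> card (A' i)"
      using card[OF d(2)] eq by eventually_elim simp
    have "ereal s \<le> dimH (subK A')" by (rule dimH_subK_ge[OF ne A' \<open>0 < s\<close> d(1) cd])
    then show False using s(1) by simp
  qed
  also have "\<dots> \<le> dimH (iso_set \<psi> F h \<inter> ball x0 r)" by (rule dimH_mono[OF sub])
  finally show ?thesis .
qed

lemma K_nonempty: "K \<noteq> {}"
proof -
  have "\<forall>i. \<exists>c. 0 < v i c" using digit_ex by blast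
  then obtain c where "\<And>i. 0 < v i (c i)" by metis
  from point_exists[where c = c, OF this] show ?thesis by blast
qed

lemma dimH_iso: "h \<noteq> -\<infinity> \<Longrightarrow> dimH (iso_set \<psi> F h) = legendre T h"
proof (cases "0 \<le> legendre T h")
  case True
  assume h: "h \<noteq> -\<infinity>"
  obtain x0 where x0: "x0 \<in> K" using K_nonempty by blast
  have "legendre T h \<le> dimH (iso_set \<psi> F h \<inter> ball x0 1)" using dimH_iso_ball_ge[OF h True x0] by simp
  also have "\<dots> \<le> dimH (iso_set \<psi> F h)" by (intro dimH_mono) auto
  finally show ?thesis using dimH_iso_le[of h] by (simp add: order_antisym)
next
  case False
  assume "h \<noteq> -\<infinity>"
  then have "legendre T h = -\<infinity>" using T_star[of h] False by (metis ereal_infty_less(2))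
  then show ?thesis using iso_empty[of h] False by (simp add: dimH_def)
qed

lemma homogeneous: "homogeneously_multifractal \<psi> F"
  unfolding homogeneously_multifractal_def
proof (intro allI impI)
  fix h x1 r1 x2 r2
  assume r: "r1 > 0" "r2 > 0" and b: "ball x1 r1 \<inter> wsupp \<psi> F \<noteq> {}" "ball x2 r2 \<inter> wsupp \<psi> F \<noteq> {}"
  show "dimH (iso_set \<psi> F h \<inter> ball x1 r1) = dimH (iso_set \<psi> F h \<inter> ball x2 r2)"
  proof (cases "h = -\<infinity> \<or> \<not> 0 \<le> legendre T h")
    case True
    then show ?thesis using iso_empty by simp
  next
    case False
    have "dimH (iso_set \<psi> F h \<inter> ball x r) = legendre T h" if meet: "ball x r \<inter> wsupp \<psi> F \<noteq> {}" for x r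
    proof -
      obtain y where y: "y \<in> ball x r" "y \<in> K" using meet wsupp_eq by auto
      obtain e where e: "e > 0" "ball y e \<subseteq> ball x r" using y(1) open_ball open_contains_ball by blast
      have "legendre T h \<le> dimH (iso_set \<psi> F h \<inter> ball y e)" using False y e by (intro dimH_iso_ball_ge) auto
      also have "\<dots> \<le> dimH (iso_set \<psi> F h \<inter> ball x r)" using e by (intro dimH_mono) auto
      finally have "legendre T h \<le> dimH (iso_set \<psi> F h \<inter> ball x r)" .
      moreover have "dimH (iso_set \<psi> F h \<inter> ball x r) \<le> legendre T h"
        by (rule order_trans[OF dimH_mono[OF Int_lower1] dimH_iso_le])
      ultimately show ?thesis by (rule antisym[rotated])
    qed
    then show ?thesis using b by simp
  qed
qed

lemma scaling_fun_ge_T: "T q \<le> scaling_fun \<psi> F q"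
proof (rule ccontr)
  assume "\<not> T q \<le> scaling_fun \<psi> F q"
  then have "scaling_fun \<psi> F q < T q" by simp
  from ereal_dense2[OF this] obtain \<tau> where \<tau>: "scaling_fun \<psi> F q < ereal \<tau>" "ereal \<tau> < T q" by blast
  have "q \<in> edom T" using \<tau>(2) unfolding edom_def by (cases "T q") auto
  then have "ereal \<tau> \<le> scaling_fun \<psi> F q" using \<tau> by (intro scaling_fun_ge Z_upper)
  then show False using \<tau> by simp
qed

text \<open>The digits of exponent h alone contribute about 2^(l T*(h)) 2^(-l h q) = 2^(-l T(q)) to
  the partition function.\<close>

lemma scaling_fun_le_real:
  assumes h: "0 \<le> legendre T (ereal h)" and q: "legendre T (ereal h) = ereal (h * q) - T q" "q \<in> edom T"
  shows "scaling_fun \<psi> F q \<le> T q"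
proof -
  obtain t where t: "T q = ereal t" using T_real[OF q(2)] by blast
  have hpos: "ereal h > 0" using T_star_pos[OF h] by simp
  obtain A where A: "\<And>i. A i \<noteq> {}" "\<And>i c. c \<in> A i \<Longrightarrow> 0 < v i c"
    and lo: "\<And>r::real. ereal r < ereal h \<Longrightarrow> \<forall>\<^sub>F i in sequentially. \<forall>c\<in>A i. v i c \<le> 2 powr (- (len i * r))"
    and up: "\<And>r::real. ereal h < ereal r \<Longrightarrow> \<forall>\<^sub>F i in sequentially. \<forall>c\<in>A i. 2 powr (- (len i * r)) \<le> v i c"
    and card: "\<And>s::real. ereal s < legendre T (ereal h) \<Longrightarrow> \<forall>\<^sub>F i in sequentially. 2 powr (len i * s) \<le> card (A i)"
    using digits[OF hpos h] by blast
  have eps: "scaling_fun \<psi> F q \<le> ereal t + ereal e" if e: "e > 0" for e :: real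
  proof -
    \<comment> \<open>The exponents of the digits only tend to h, so h is moved to the side on which
      the q-th powers get smaller; the shift is sized to cost at most e / 2.\<close>
    define h1 where "h1 = (if 0 \<le> q then h + e / (2 * (\<bar>q\<bar> + 1)) else h - e / (2 * (\<bar>q\<bar> + 1)))"
    have ep: "e / (2 * (\<bar>q\<bar> + 1)) > 0" using e by simp
    have "e / (2 * (\<bar>q\<bar> + 1)) * \<bar>q\<bar> \<le> e / 2" using e by (simp add: field_simps)
    then have h1q: "h1 * q \<le> h * q + e / 2" by (auto simp: h1_def algebra_simps)
    have w: "\<forall>\<^sub>F i in sequentially. \<forall>c\<in>A i. 2 powr (- (len i * (h * q + e / 2))) \<le> v i c powr q"
    proof (cases "0 \<le> q")
      case True
      have "ereal h < ereal h1" using True ep by (simp add: h1_def)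
      from up[OF this] show ?thesis
      proof eventually_elim
        case (elim i)
        show ?case
        proof
          fix c assume c: "c \<in> A i"
          have "len i * (h1 * q) \<le> len i * (h * q + e / 2)" using h1q by (intro mult_left_mono) auto
          then have "2 powr (- (len i * (h * q + e / 2))) \<le> 2 powr (- (len i * h1) * q)" by (intro powr_mono) auto
          also have "\<dots> = (2 powr (- (len i * h1))) powr q" by (simp add: powr_powr)
          also have "\<dots> \<le> v i c powr q" using elim c True by (intro powr_mono2) auto
          finally show "2 powr (- (len i * (h * q + e / 2))) \<le> v i c powr q" .
        qed
      qed
    next
      case False
      have "ereal h1 < ereal h" using False ep by (simp add: h1_def)
      from lo[OF this] show ?thesis
      proof eventually_elim
        case (elim i)
        show ?case
        proof
          fix c assume c: "c \<in> A i"
          have "len i * (h1 * q) \<le> len i * (h * q + e / 2)" using h1q by (intro mult_left_mono) auto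
          then have "2 powr (- (len i * (h * q + e / 2))) \<le> 2 powr (- (len i * h1) * q)" by (intro powr_mono) auto
          also have "\<dots> = (2 powr (- (len i * h1))) powr q" by (simp add: powr_powr)
          also have "\<dots> \<le> v i c powr q" using elim c False A(2)[OF c] by (intro powr_mono2') auto
          finally show "2 powr (- (len i * (h * q + e / 2))) \<le> v i c powr q" .
        qed
      qed
    qed
    have "ereal (h * q - t - e / 2) < legendre T (ereal h)" using q t e by simp
    from scaling_fun_le_subdigits[OF A(2) w card[OF this]]
    have "scaling_fun \<psi> F q \<le> ereal (h * q + e / 2 - (h * q - t - e / 2))" .
    then show ?thesis by (simp add: add.commute)
  qed
  have "scaling_fun \<psi> F q \<le> ereal t" by (rule ereal_le_epsilon2) (use eps in blast)
  then show ?thesis using t by simp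
qed

text \<open>Here T*(\<infinity>) = - T(0), so digits of exponent \<infinity> exist. At q = 0 their
  number suffices; for q < 0 a single one per stage has a q-th power beyond any exponential rate,
  which forces the value -\<infinity>.\<close>

lemma scaling_fun_le_nonpos:
  assumes dom: "edom T = {0..}" and q: "q \<le> 0"
  shows "scaling_fun \<psi> F q \<le> T q"
proof -
  have "0 \<in> edom T" using dom by simp
  then obtain t where t: "T 0 = ereal t" using T_real by blast
  have "{(if q < 0 then -\<infinity> else 0) - T q |q. q \<in> edom T \<and> q \<le> 0} = {- T 0}"
    using dom by force
  then have leg: "legendre T \<infinity> = - ereal t" unfolding legendre_def using t by simp
  then have ge: "0 \<le> legendre T \<infinity>" using T_star[of \<infinity>] by simp
  obtain A where A: "\<And>i. A i \<noteq> {}" "\<And>i c. c \<in> A i \<Longrightarrow> 0 < v i c"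
    and lo: "\<And>r::real. ereal r < \<infinity> \<Longrightarrow> \<forall>\<^sub>F i in sequentially. \<forall>c\<in>A i. v i c \<le> 2 powr (- (len i * r))"
    and card: "\<And>s::real. ereal s < legendre T \<infinity> \<Longrightarrow> \<forall>\<^sub>F i in sequentially. 2 powr (len i * s) \<le> card (A i)"
    using digits[OF _ ge] by auto
  show ?thesis
  proof (cases "q = 0")
    case True
    have w: "\<forall>\<^sub>F i in sequentially. \<forall>c\<in>A i. 2 powr (- (len i * (0::real))) \<le> v i c powr q"
      using True A(2) by (auto intro!: always_eventually simp: less_imp_neq[symmetric])
    have eps: "scaling_fun \<psi> F q \<le> ereal t + ereal e" if e: "e > 0" for e :: real
    proof -
      have "ereal (- t - e) < legendre T \<infinity>" using leg e by simp
      from scaling_fun_le_subdigits[OF A(2) w card[OF this]] show ?thesis by (simp add: add.commute)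
    qed
    have "scaling_fun \<psi> F q \<le> ereal t" by (rule ereal_le_epsilon2) (use eps in blast)
    then show ?thesis using t True by simp
  next
    case False
    then have q0: "q < 0" using q by simp
    have fin: "finite (A i)" for i
    proof (rule finite_subset)
      show "A i \<subseteq> {0..<2 ^ len i}" using A(2) digit_range by blast
    qed simp
    have c1: "\<forall>\<^sub>F i in sequentially. 2 powr (len i * (0::real)) \<le> card (A i)"
      using A(1) fin by (auto intro!: always_eventually simp: Suc_le_eq card_gt_0_iff)
    have neg: "scaling_fun \<psi> F q \<le> ereal B" for B :: real
    proof -
      \<comment> \<open>Chosen so that weights at most 2^(-l R) have q-th power at least 2^(-l
        B).\<close>
      define R where "R = B / q"
      have w: "\<forall>\<^sub>F i in sequentially. \<forall>c\<in>A i. 2 powr (- (len i * B)) \<le> v i c powr q"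
      proof -
        have "ereal R < \<infinity>" by simp
        from lo[OF this] show ?thesis
      proof eventually_elim
        case (elim i)
        show ?case
        proof
          fix c assume c: "c \<in> A i"
          have "2 powr (- (len i * B)) = (2 powr (- (len i * R))) powr q"
            using q0 by (simp add: powr_powr R_def)
          also have "\<dots> \<le> v i c powr q" using elim c q0 A(2)[OF c] by (intro powr_mono2') auto
          finally show "2 powr (- (len i * B)) \<le> v i c powr q" .
        qed
      qed
      qed
      from scaling_fun_le_subdigits[OF A(2) w c1] show ?thesis by simp
    qed
    have "scaling_fun \<psi> F q = -\<infinity>" by (rule ereal_bot) (rule neg)
    then show ?thesis by simp
  qed
qed

lemma scaling_fun_eq: "scaling_fun \<psi> F q = T q"
proof (rule antisym[OF _ scaling_fun_ge_T])
  show "scaling_fun \<psi> F q \<le> T q"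
  proof (cases "edom T = UNIV \<or> q > 0")
    case True
    have q: "q \<in> edom T" using T_dom
    proof
      assume "edom T = {0..}"
      then have "(-1::real) \<notin> edom T" by simp
      then have "edom T \<noteq> UNIV" by blast
      then have "0 < q" using True by blast
      then show ?thesis unfolding \<open>edom T = {0..}\<close> by simp
    next
      assume "edom T = UNIV"
      then show ?thesis by (simp only: UNIV_I)
    qed
    obtain h where h: "legendre T (ereal h) = ereal (h * q) - T q" using supergradient[OF q True] by blast
    obtain t where "T q = ereal t" using T_real[OF q] by blast
    then have "legendre T (ereal h) > -\<infinity>" using h by simp
    then have "0 \<le> legendre T (ereal h)" by (intro T_star) auto
    then show ?thesis by (rule scaling_fun_le_real[OF _ h q])
  next
    case False
    then have "edom T = {0..}" "q \<le> 0" using T_dom by (blast, simp add: not_less)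
    then show ?thesis by (rule scaling_fun_le_nonpos)
  qed
qed

theorem realizes:
  "bounded (range F) \<and> hoelder_continuous F \<and> homogeneously_multifractal \<psi> F \<and> wsupp \<psi> F \<subseteq> {0..1} \<and>
   (\<forall>q. scaling_fun \<psi> F q = T q) \<and>
   (\<forall>h::ereal. h \<ge> 0 \<longrightarrow> dimH (iso_set \<psi> F h) = legendre (scaling_fun \<psi> F) h)"
proof (intro conjI allI impI)
  show "bounded (range F)" using F_bounded by (auto simp: bounded_iff)
  show "hoelder_continuous F" by (rule F_hoelder)
  show "homogeneously_multifractal \<psi> F" by (rule homogeneous)
  show "wsupp \<psi> F \<subseteq> {0..1}" by (auto simp: wsupp_def)
  show "scaling_fun \<psi> F q = T q" for q by (rule scaling_fun_eq)
  have "scaling_fun \<psi> F = T" by (rule ext) (rule scaling_fun_eq)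
  then show "dimH (iso_set \<psi> F h) = legendre (scaling_fun \<psi> F) h" if "h \<ge> 0" for h
    using dimH_iso[of h] that by auto
qed

end

section \<open>Digit systems approximating a Legendre transform\<close>

text \<open>The digits of all types are enumerated together and placed at consecutive multiples of 4
  starting from 4; the size condition keeps the last one at or below 2^l - 4.\<close>

lemma digit_system:
  fixes Ty :: "'t set" and N :: "'t \<Rightarrow> nat" and w :: "'t \<Rightarrow> real" and l :: nat
  assumes fin: "finite Ty" and w: "\<And>\<tau>. \<tau> \<in> Ty \<Longrightarrow> 0 < w \<tau>" and size: "4 * (\<Sum>\<tau>\<in>Ty. N \<tau>) + 4 \<le> 2 ^ l"
  shows "\<exists>v dig. (\<forall>c::int. 0 \<le> v c \<and> (0 < v c \<longrightarrow> 4 \<le> c \<and> c \<le> 2 ^ l - 4 \<and> 4 dvd c \<and> (\<exists>\<tau>\<in>Ty. v c = w \<tau>))) \<and>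
     (\<forall>\<tau>\<in>Ty. card (dig \<tau>) = N \<tau> \<and> (\<forall>c\<in>dig \<tau>. v c = w \<tau>)) \<and>
     (\<forall>q. (\<Sum>c\<in>{0..<2 ^ l}. v c powr q) = (\<Sum>\<tau>\<in>Ty. N \<tau> * w \<tau> powr q))"
proof -
  define Sg where "Sg = Sigma Ty (\<lambda>\<tau>. {..<N \<tau>})"
  have finS: "finite Sg" using fin by (simp add: Sg_def)
  have cardS: "card Sg = (\<Sum>\<tau>\<in>Ty. N \<tau>)" using fin by (simp add: Sg_def)
  obtain e where e: "bij_betw e Sg {0..<card Sg}" using ex_bij_betw_finite_nat[OF finS] by blast
  define code where "code x = 4 + 4 * int (e x)" for x
  have inj: "inj_on code Sg"
    using bij_betw_imp_inj_on[OF e] by (auto simp: inj_on_def code_def)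
  define v where "v c = (if c \<in> code ` Sg then w (fst (inv_into Sg code c)) else 0)" for c
  define dig where "dig \<tau> = code ` ({\<tau>} \<times> {..<N \<tau>})" for \<tau>
  have vcode: "v (code x) = w (fst x)" if "x \<in> Sg" for x
    using that inj by (simp add: v_def inv_into_f_f)
  have wpos: "0 < w (fst x)" if "x \<in> Sg" for x using that w by (auto simp: Sg_def)
  have range: "4 \<le> code x \<and> code x \<le> 2 ^ l - 4 \<and> 4 dvd code x" if "x \<in> Sg" for x
  proof -
    have "e x < card Sg" using that bij_betwE[OF e] by auto
    then have "4 * e x + 4 \<le> 4 * card Sg" by simp
    then have "4 * e x + 4 + 4 \<le> 2 ^ l" using size cardS by linarith
    then have "int (4 * e x + 4 + 4) \<le> int (2 ^ l)" by (simp only: of_nat_le_iff)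
    then show ?thesis by (simp add: code_def)
  qed
  have A: "0 \<le> v c \<and> (0 < v c \<longrightarrow> 4 \<le> c \<and> c \<le> 2 ^ l - 4 \<and> 4 dvd c \<and> (\<exists>\<tau>\<in>Ty. v c = w \<tau>))" for c
  proof (cases "c \<in> code ` Sg")
    case True
    then obtain x where x: "x \<in> Sg" "c = code x" by blast
    have "fst x \<in> Ty" using x(1) by (auto simp: Sg_def)
    then show ?thesis using range[OF x(1)] wpos[OF x(1)] vcode[OF x(1)] x(2) by (auto intro: less_imp_le)
  qed (simp add: v_def)
  have B: "card (dig \<tau>) = N \<tau> \<and> (\<forall>c\<in>dig \<tau>. v c = w \<tau>)" if "\<tau> \<in> Ty" for \<tau>
  proof -
    have sub: "{\<tau>} \<times> {..<N \<tau>} \<subseteq> Sg" using that by (auto simp: Sg_def)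
    have "card (dig \<tau>) = card ({\<tau>} \<times> {..<N \<tau>})"
      unfolding dig_def by (rule card_image[OF inj_on_subset[OF inj sub]])
    moreover have "\<forall>c\<in>dig \<tau>. v c = w \<tau>" using sub vcode unfolding dig_def by fastforce
    ultimately show ?thesis by (simp add: card_cartesian_product)
  qed
  have C: "(\<Sum>c\<in>{0..<2 ^ l}. v c powr q) = (\<Sum>\<tau>\<in>Ty. N \<tau> * w \<tau> powr q)" for q
  proof -
    have "(\<Sum>c\<in>{0..<2 ^ l}. v c powr q) = (\<Sum>c\<in>code ` Sg. v c powr q)"
    proof (rule sum.mono_neutral_right)
      show "code ` Sg \<subseteq> {0..<2 ^ l}" using range by force
      show "\<forall>c\<in>{0..<2 ^ l} - code ` Sg. v c powr q = 0" by (simp add: v_def)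
    qed simp
    also have "\<dots> = (\<Sum>x\<in>Sg. w (fst x) powr q)"
      using vcode by (simp add: sum.reindex[OF inj])
    also have "\<dots> = (\<Sum>\<tau>\<in>Ty. \<Sum>j<N \<tau>. w \<tau> powr q)"
      unfolding Sg_def using fin by (subst sum.Sigma) (auto simp: case_prod_beta)
    also have "\<dots> = (\<Sum>\<tau>\<in>Ty. N \<tau> * w \<tau> powr q)" by simp
    finally show ?thesis .
  qed
  show ?thesis using A B C by blast
qed

lemma legendre_le: "h \<noteq> \<infinity> \<Longrightarrow> q \<in> edom T \<Longrightarrow> legendre T h \<le> ereal (real_of_ereal h * q) - T q"
  unfolding legendre_def by (auto intro!: Inf_lower)

lemma legendre_infty_le_0: "0 \<in> edom T \<Longrightarrow> legendre T \<infinity> \<le> - T 0"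
proof -
  assume "0 \<in> edom T"
  then have "- T 0 \<in> {(if q < 0 then -\<infinity> else 0) - T q |q. q \<in> edom T \<and> q \<le> 0}"
    by (intro CollectI exI[of _ "0::real"]) simp
  then show ?thesis by (simp only: legendre_def simp_thms if_True Inf_lower)
qed

lemma legendre_infty_finite_neg: "q < 0 \<Longrightarrow> q \<in> edom T \<Longrightarrow> T q \<noteq> \<infinity> \<Longrightarrow> legendre T \<infinity> = -\<infinity>"
proof -
  assume q: "q < 0" "q \<in> edom T" "T q \<noteq> \<infinity>"
  then obtain t where "T q = ereal t" by (cases "T q") (auto simp: edom_def)
  then have "-\<infinity> = (if q < 0 then -\<infinity> else 0) - T q" using q by simp
  then have "-\<infinity> \<in> {(if q < 0 then -\<infinity> else 0) - T q |q. q \<in> edom T \<and> q \<le> 0}"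
    using q by (intro CollectI exI[of _ q]) simp
  then have "legendre T \<infinity> \<le> -\<infinity>" by (simp only: legendre_def simp_thms if_True Inf_lower)
  then show ?thesis by simp
qed

text \<open>At an interior point q the concave function T has a supporting line; for its slope h,
  the infimum defining the transform is attained at q.\<close>

lemma concave_supergradient:
  assumes conc: "concave_on (edom T) (\<lambda>q. real_of_ereal (T q))" and noinf: "\<forall>q. T q \<noteq> \<infinity>"
    and q: "q \<in> interior (edom T)"
  shows "\<exists>h. legendre T (ereal h) = ereal (h * q) - T q"
proof -
  define f where "f q = real_of_ereal (T q)" for q
  have Tf: "T q = ereal (f q)" if "q \<in> edom T" for q
    using that noinf[rule_format, of q] unfolding f_def edom_def by (cases "T q") auto
  have qd: "q \<in> edom T" using q interior_subset by blast
  have conv: "convex_on (edom T) (\<lambda>q. - f q)" using conc unfolding concave_on_def f_def .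
  \<comment> \<open>The right derivative of the convex function -T at q, as the infimum of the
    slopes of chords to the right.\<close>
  define g where "g = Inf ((\<lambda>t. (- f q - - f t) / (q - t)) ` ({q<..} \<inter> edom T))"
  have sup: "- f y \<ge> - f q + g * (y - q)" if "y \<in> edom T" for y
    unfolding g_def by (rule convex_le_Inf_differential[OF conv q that])
  have "legendre T (ereal (- g)) = ereal (- g * q - f q)"
  proof (rule antisym)
    show "legendre T (ereal (- g)) \<le> ereal (- g * q - f q)"
      using legendre_le[of "ereal (- g)" q T] qd Tf by simp
    have "legendre T (ereal (- g)) = Inf {ereal (- g * q) - T q |q. q \<in> edom T}"
      by (simp add: legendre_def)
    also have "ereal (- g * q - f q) \<le> \<dots>"
    proof (rule Inf_greatest)
      fix z assume "z \<in> {ereal (- g * q) - T q |q. q \<in> edom T}"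
      then obtain y where y: "y \<in> edom T" "z = ereal (- g * y) - T y" by blast
      have "- g * q - f q \<le> - g * y - f y" using sup[OF y(1)] by (simp add: algebra_simps)
      then show "ereal (- g * q - f q) \<le> z" using y Tf by simp
    qed
    finally show "ereal (- g * q - f q) \<le> legendre T (ereal (- g))" .
  qed
  then show ?thesis using Tf[OF qd] by (intro exI[of _ "- g"]) simp
qed

text \<open>The square root balances two errors: factors 2^m from counting types and factors 2^(l /
  m) from rounding are both 2^(o(l)).\<close>

definition root_floor :: "nat \<Rightarrow> nat" where "root_floor l = nat \<lfloor>sqrt (real l)\<rfloor>"

lemma root_floor_square: "root_floor l * root_floor l \<le> l"
proof -
  have "real (root_floor l) \<le> sqrt (real l)" unfolding root_floor_def by (simp add: of_nat_floor)
  then have "real (root_floor l) * real (root_floor l) \<le> sqrt (real l) * sqrt (real l)"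
    by (intro mult_mono) auto
  then have "real (root_floor l * root_floor l) \<le> real l" by simp
  then show ?thesis by (simp only: of_nat_le_iff)
qed

lemma root_floor_at_top: "filterlim root_floor at_top sequentially"
  unfolding filterlim_at_top
proof
  fix M
  show "\<forall>\<^sub>F l in sequentially. M \<le> root_floor l"
    using eventually_ge_at_top[of "M * M"]
  proof eventually_elim
    case (elim l)
    have "real (M * M) \<le> real l" using elim by (simp only: of_nat_le_iff)
    then have "real M \<le> sqrt (real l)" by (intro real_le_rsqrt) (simp add: power2_eq_square)
    then have "int M \<le> \<lfloor>sqrt (real l)\<rfloor>" by (simp add: le_floor_iff)
    then show ?case unfolding root_floor_def by simp
  qed
qed

text \<open>A type (a, b) at resolution m stands for the point (a / m, b / m) lying
  just below the graph of the Legendre transform; a = m * m represents the exponent infinity.\<close>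

definition types :: "(real \<Rightarrow> ereal) \<Rightarrow> nat \<Rightarrow> (nat \<times> nat) set" where
  "types T m = {(a, b). a \<le> m * m \<and> b \<le> m \<and> (\<exists>h. h \<noteq> -\<infinity> \<and> ereal (b / m) \<le> legendre T h \<and>
     ((\<exists>h0. h = ereal h0 \<and> h0 \<le> a / m \<and> a / m \<le> h0 + 1 / m) \<or> h = \<infinity> \<and> a = m * m))}"

text \<open>Lowering b by one costs l / m in the exponent and keeps each count at most 2^(l - m),
  which leaves room for all types at once. Truncated subtraction gives b = 0 a single digit, so
  every type is represented.\<close>

definition type_count :: "nat \<Rightarrow> nat \<times> nat \<Rightarrow> nat" where
  "type_count l \<tau> = 2 ^ ((l * (snd \<tau> - 1)) div root_floor l)"

definition type_weight :: "nat \<Rightarrow> nat \<times> nat \<Rightarrow> real" where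
  "type_weight l \<tau> = 2 powr (- (real l * (real (fst \<tau>) / root_floor l)))"

lemma finite_types: "finite (types T m)" and card_types: "card (types T m) \<le> (m * m + 1) * (m + 1)"
proof -
  have sub: "types T m \<subseteq> {0..m * m} \<times> {0..m}" by (auto simp: types_def)
  then show "finite (types T m)" by (rule finite_subset) simp
  have "card (types T m) \<le> card ({0..m * m} \<times> {0..m})" by (rule card_mono[OF _ sub]) simp
  then show "card (types T m) \<le> (m * m + 1) * (m + 1)" by simp
qed

lemma type_count_le:
  assumes "\<tau> \<in> types T (root_floor l)" and m: "1 \<le> root_floor l"
  shows "type_count l \<tau> \<le> 2 ^ (l - root_floor l)"
    and "real (type_count l \<tau>) \<le> 2 powr (real l * (real (snd \<tau>) / root_floor l))"
proof -
  define m where "m = root_floor l"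
  have m1: "1 \<le> m" using m by (simp add: m_def)
  have ml: "m * m \<le> l" unfolding m_def by (rule root_floor_square)
  have b: "snd \<tau> \<le> m" using assms by (auto simp: types_def m_def)
  have "l * (snd \<tau> - 1) \<le> l * (m - 1)" using b by (intro mult_left_mono) auto
  also have "\<dots> = l * m - l" by (simp add: diff_mult_distrib2)
  also have "\<dots> \<le> l * m - m * m" using ml by simp
  also have "\<dots> = (l - m) * m" by (simp add: diff_mult_distrib)
  finally have "(l * (snd \<tau> - 1)) div m \<le> ((l - m) * m) div m" by (rule div_le_mono)
  then have "(l * (snd \<tau> - 1)) div m \<le> l - m" using m1 by simp
  then show "type_count l \<tau> \<le> 2 ^ (l - root_floor l)"
    unfolding type_count_def m_def[symmetric] by (intro power_increasing) auto
  have "real ((l * (snd \<tau> - 1)) div m) \<le> real (l * (snd \<tau> - 1)) / real m" by (rule of_nat_div_le_of_nat)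
  also have "\<dots> \<le> real l * (real (snd \<tau>) / m)"
    by (simp add: divide_right_mono mult_left_mono)
  finally have "(2::real) powr real ((l * (snd \<tau> - 1)) div m) \<le> 2 powr (real l * (real (snd \<tau>) / m))"
    by (intro powr_mono) auto
  then show "real (type_count l \<tau>) \<le> 2 powr (real l * (real (snd \<tau>) / root_floor l))"
    unfolding type_count_def m_def[symmetric] by (simp add: powr_realpow)
qed

text \<open>One l / m is lost by passing from b to b - 1; the other pays for the integer division,
  whose error is at most 1 \<le> l / m.\<close>

lemma type_count_ge:
  assumes m: "1 \<le> root_floor l"
  shows "2 powr (real l * (real (snd \<tau>) / root_floor l) - 2 * (real l / root_floor l)) \<le> real (type_count l \<tau>)"
proof -
  define m where "m = root_floor l"
  have m1: "1 \<le> m" using m by (simp add: m_def)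
  have ml: "m * m \<le> l" unfolding m_def by (rule root_floor_square)
  have "m * 1 \<le> m * m" using m1 by (intro mult_left_mono) auto
  then have mlel: "m \<le> l" using ml by linarith
  have one: "1 \<le> real l / real m" using m1 mlel by simp
  have "l * (snd \<tau> - 1) = ((l * (snd \<tau> - 1)) div m) * m + (l * (snd \<tau> - 1)) mod m" by simp
  moreover have "(l * (snd \<tau> - 1)) mod m < m" using m1 by simp
  ultimately have "l * (snd \<tau> - 1) \<le> ((l * (snd \<tau> - 1)) div m) * m + m" by linarith
  then have "real (l * (snd \<tau> - 1)) \<le> real (((l * (snd \<tau> - 1)) div m) * m + m)" by (simp only: of_nat_le_iff)
  then have "real l * real (snd \<tau> - 1) / m \<le> real ((l * (snd \<tau> - 1)) div m) + 1"
    using m1 by (simp add: field_simps)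
  moreover have "real l * (real (snd \<tau>) - 1) / m \<le> real l * real (snd \<tau> - 1) / m"
    by (intro divide_right_mono mult_left_mono) auto
  moreover have "real l * (real (snd \<tau>) - 1) / m = real l * (real (snd \<tau>) / m) - real l / m"
    by (simp add: right_diff_distrib diff_divide_distrib)
  ultimately have "real l * (real (snd \<tau>) / m) - 2 * (real l / m) \<le> real ((l * (snd \<tau> - 1)) div m)"
    using one by linarith
  then have "2 powr (real l * (real (snd \<tau>) / m) - 2 * (real l / m)) \<le> (2::real) powr real ((l * (snd \<tau> - 1)) div m)"
    by (intro powr_mono) auto
  then show ?thesis unfolding type_count_def m_def[symmetric] by (simp add: powr_realpow)
qed

lemma many_digits_room: "\<forall>\<^sub>F m::nat in sequentially. 8 * ((m * m + 1) * (m + 1)) \<le> 2 ^ m"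
proof -
  have "\<forall>\<^sub>F m::nat in sequentially. 8 * ((real m * real m + 1) * (real m + 1)) \<le> 2 ^ m"
    by real_asymp
  then show ?thesis
  proof eventually_elim
    case (elim m)
    then have "real (8 * ((m * m + 1) * (m + 1))) \<le> real (2 ^ m)"
      by (simp only: of_nat_mult of_nat_add of_nat_1 of_nat_numeral of_nat_power)
    then show ?case by (simp only: of_nat_le_iff)
  qed
qed

text \<open>The factor 2^(-m) saved in every count outweighs the polynomial number of types.\<close>

lemma types_size:
  assumes m: "2 \<le> root_floor l" and room: "8 * ((root_floor l * root_floor l + 1) * (root_floor l + 1)) \<le> 2 ^ root_floor l"
  shows "4 * (\<Sum>\<tau>\<in>types T (root_floor l). type_count l \<tau>) + 4 \<le> 2 ^ l"
proof -
  define m where "m = root_floor l"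
  have m2: "2 \<le> m" using m by (simp add: m_def)
  have ml: "m * m \<le> l" unfolding m_def by (rule root_floor_square)
  have "m * 2 \<le> m * m" using m2 by (intro mult_left_mono) auto
  then have mlel: "m \<le> l" "4 \<le> l" using ml m2 by linarith+
  have "(\<Sum>\<tau>\<in>types T m. type_count l \<tau>) \<le> (\<Sum>\<tau>\<in>types T m. 2 ^ (l - m))"
    unfolding m_def using m by (intro sum_mono type_count_le) auto
  also have "\<dots> = card (types T m) * 2 ^ (l - m)" by simp
  also have "\<dots> \<le> ((m * m + 1) * (m + 1)) * 2 ^ (l - m)" by (intro mult_right_mono card_types) auto
  finally have "8 * (\<Sum>\<tau>\<in>types T m. type_count l \<tau>) \<le> 8 * (((m * m + 1) * (m + 1)) * 2 ^ (l - m))"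
    by (rule mult_le_mono2)
  also have "\<dots> = (8 * ((m * m + 1) * (m + 1))) * 2 ^ (l - m)" by (simp only: mult.assoc)
  also have "\<dots> \<le> 2 ^ m * 2 ^ (l - m)" using room by (intro mult_right_mono) (auto simp: m_def)
  also have "\<dots> = 2 ^ l" using mlel by (simp add: power_add[symmetric])
  finally have "8 * (\<Sum>\<tau>\<in>types T m. type_count l \<tau>) \<le> 2 ^ l" .
  moreover have "(2::nat) ^ 4 \<le> 2 ^ l" using mlel by (intro power_increasing) auto
  ultimately show ?thesis unfolding m_def by simp
qed

text \<open>Linear stage lengths give quadratic generations.\<close>

lemma growth_linear: "(\<lambda>i. real (i + i0) / real (\<Sum>j<i. j + i0)) \<longlonglongrightarrow> 0"
proof -
  have sum: "real (\<Sum>j<i. j + i0) = real i * (real i - 1) / 2 + real i * real i0" for i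
    by (induction i) (simp_all add: field_simps)
  have "(\<lambda>i. (real i + c) / (real i * (real i - 1) / 2 + real i * c)) \<longlonglongrightarrow> 0" for c :: real
    by real_asymp
  then show ?thesis unfolding sum of_nat_add .
qed

section \<open>From the hypotheses on T to a cascade\<close>

locale scaling_target =
  fixes T :: "real \<Rightarrow> ereal" and \<alpha> c :: real
  assumes noinf: "T q \<noteq> \<infinity>"
    and concave: "concave_on (edom T) (\<lambda>q. real_of_ereal (T q))"
    and alpha: "0 < \<alpha>" and c: "0 \<le> c" "c \<le> 1"
    and lower: "0 \<le> q \<Longrightarrow> ereal (\<alpha> * q - c) \<le> T q"
    and dom: "edom T = UNIV \<or> edom T = {0..}"
    and star: "h \<noteq> -\<infinity> \<Longrightarrow> legendre T h > -\<infinity> \<Longrightarrow> legendre T h \<ge> 0"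
begin

lemma dom_nonneg: "0 \<le> q \<Longrightarrow> q \<in> edom T"
  using lower[of q] unfolding edom_def by (cases "T q") auto

lemma T_real: "q \<in> edom T \<Longrightarrow> \<exists>t. T q = ereal t"
  using noinf[of q] unfolding edom_def by (cases "T q") auto

text \<open>For h < \<alpha> the lower bound on T gives h q - T(q) \<le> c - (\<alpha> - h) q, which
  is negative for large q.\<close>

lemma star_ge: "h \<noteq> -\<infinity> \<Longrightarrow> 0 \<le> legendre T h \<Longrightarrow> ereal \<alpha> \<le> h"
proof (cases h)
  case (real h0)
  assume leg: "0 \<le> legendre T h"
  show ?thesis
  proof (rule ccontr)
    assume "\<not> ereal \<alpha> \<le> h"
    then have lt: "h0 < \<alpha>" using real by simp
    \<comment> \<open>At this q the bound c - (\<alpha> - h0) q equals -1.\<close>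
    define q where "q = (c + 1) / (\<alpha> - h0)"
    have q: "0 \<le> q" "(\<alpha> - h0) * q = c + 1" using lt c by (auto simp: q_def)
    obtain t where t: "T q = ereal t" using T_real[OF dom_nonneg[OF q(1)]] by blast
    have "legendre T h \<le> ereal (h0 * q - t)"
      using legendre_le[of h q T] dom_nonneg[OF q(1)] real t by simp
    with leg have "0 \<le> ereal (h0 * q - t)" by (rule order_trans)
    then have "t \<le> h0 * q" by simp
    moreover have "\<alpha> * q - c \<le> t" using lower[OF q(1)] t by simp
    ultimately show False using q(2) by (simp add: left_diff_distrib)
  qed
qed simp_all

text \<open>Testing the infimum at q = 0 gives T*(h) \<le> - T(0) \<le> c. It guarantees that the
  wanted number of children fits into a dyadic subdivision.\<close>

lemma star_le_1: "h \<noteq> -\<infinity> \<Longrightarrow> legendre T h \<le> 1"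
proof -
  assume "h \<noteq> -\<infinity>"
  have d0: "0 \<in> edom T" by (rule dom_nonneg) simp
  obtain t where t: "T 0 = ereal t" using T_real[OF d0] by blast
  have "- c \<le> t" using lower[of 0] t by simp
  then have "- T 0 \<le> 1" using t c by (simp add: one_ereal_def)
  moreover have "legendre T h \<le> - T 0"
  proof (cases "h = \<infinity>")
    case True
    then show ?thesis using legendre_infty_le_0[OF d0] by simp
  next
    case False
    then show ?thesis using legendre_le[of h 0 T] d0 t by simp
  qed
  ultimately show ?thesis by (rule order_trans[rotated])
qed

lemma star_real: "h \<noteq> -\<infinity> \<Longrightarrow> 0 \<le> legendre T h \<Longrightarrow> \<exists>D. legendre T h = ereal D \<and> 0 \<le> D \<and> D \<le> 1"
  using star_le_1[of h] by (cases "legendre T h") (auto simp: one_ereal_def)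

lemma exists_supergradient:
  "q \<in> edom T \<Longrightarrow> edom T = UNIV \<or> q > 0 \<Longrightarrow> \<exists>h. legendre T (ereal h) = ereal (h * q) - T q"
proof -
  assume q: "q \<in> edom T" "edom T = UNIV \<or> q > 0"
  have "q \<in> interior (edom T)"
    using dom
  proof
    assume "edom T = UNIV"
    then show ?thesis by simp
  next
    assume e: "edom T = {0..}"
    then have "(-1::real) \<notin> edom T" by simp
    then have "0 < q" using q(2) by blast
    then show ?thesis unfolding e by simp
  qed
  then show ?thesis using concave noinf by (intro concave_supergradient) auto
qed

text \<open>A supergradient at q = 1, which is interior for either form of the domain. It supplies a
  default type, so that every stage has at least one child.\<close>

lemma exists_finite_exponent: "\<exists>h. 0 < h \<and> 0 \<le> legendre T (ereal h)"
proof -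
  have d1: "1 \<in> edom T" by (rule dom_nonneg) simp
  obtain h where h: "legendre T (ereal h) = ereal (h * 1) - T 1" using exists_supergradient[OF d1] by auto
  obtain t where "T 1 = ereal t" using T_real[OF d1] by blast
  then have "legendre T (ereal h) > -\<infinity>" using h by simp
  then have ge: "0 \<le> legendre T (ereal h)" by (intro star) auto
  have "ereal \<alpha> \<le> ereal h" by (rule star_ge[OF _ ge]) simp
  then have "0 < h" using alpha by simp
  with ge show ?thesis by blast
qed

text \<open>A type lies below the graph of the transform up to rounding the exponent by 1 / m, which
  costs |q| / m; the bound T*(h) \<le> h q - T(q) then controls it. A type of infinite exponent is
  dominated for q > 0 by taking m large, and does not exist for q < 0.\<close>

lemma type_slope_le:
  assumes ty: "\<tau> \<in> types T m" and m: "1 \<le> m" and q: "q \<in> edom T" "T q = ereal t"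
    and large: "0 < q \<Longrightarrow> T 0 = ereal t0 \<and> t - t0 \<le> q * m"
  shows "real (snd \<tau>) / m - q * (real (fst \<tau>) / m) \<le> \<bar>q\<bar> / m - t"
proof -
  obtain a b where ab: "\<tau> = (a, b)" by fastforce
  obtain h where h: "h \<noteq> -\<infinity>" "ereal (b / m) \<le> legendre T h"
    "(\<exists>h0. h = ereal h0 \<and> h0 \<le> a / m \<and> a / m \<le> h0 + 1 / m) \<or> h = \<infinity> \<and> a = m * m"
    using ty ab unfolding types_def by blast
  from h(3) have "b / m - q * (a / m) \<le> \<bar>q\<bar> / m - t"
  proof
    assume "\<exists>h0. h = ereal h0 \<and> h0 \<le> a / m \<and> a / m \<le> h0 + 1 / m"
    then obtain h0 where h0: "h = ereal h0" "h0 \<le> a / m" "a / m \<le> h0 + 1 / m" by blast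
    have "legendre T h \<le> ereal (h0 * q - t)"
      using legendre_le[of h q T] q h0(1) by simp
    with h(2) have "ereal (b / m) \<le> ereal (h0 * q - t)" by (rule order_trans)
    then have "b / m \<le> h0 * q - t" by simp
    moreover have "q * (h0 - a / m) \<le> \<bar>q\<bar> * (1 / m)"
    proof -
      have "q * (h0 - a / m) \<le> \<bar>q * (h0 - a / m)\<bar>" by simp
      also have "\<dots> = \<bar>q\<bar> * \<bar>h0 - a / m\<bar>" by (rule abs_mult)
      also have "\<dots> \<le> \<bar>q\<bar> * (1 / m)" using h0 by (intro mult_left_mono) auto
      finally show ?thesis .
    qed
    ultimately show ?thesis by (simp add: right_diff_distrib mult.commute)
  next
    assume inf: "h = \<infinity> \<and> a = m * m"
    have "\<not> q < 0"
    proof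
      assume "q < 0"
      then have "legendre T \<infinity> = -\<infinity>" using q(1) noinf by (intro legendre_infty_finite_neg)
      then show False using h(2) inf by simp
    qed
    have "ereal (b / m) \<le> legendre T \<infinity>" using h(2) inf by simp
    also have "\<dots> \<le> - T 0" by (intro legendre_infty_le_0 dom_nonneg) simp
    finally have bT: "ereal (b / m) \<le> - T 0" .
    have am: "a / m = m" using inf m by simp
    show ?thesis
    proof (cases "q = 0")
      case True
      have "b / m \<le> - t" using bT q(2) True by simp
      then show ?thesis using True by simp
    next
      case False
      then have "0 < q" using \<open>\<not> q < 0\<close> by simp
      from large[OF this] have t0: "T 0 = ereal t0" "t - t0 \<le> q * m" by auto
      have "b / m \<le> - t0" using bT t0 by simp
      moreover have "0 \<le> \<bar>q\<bar> / m" by simp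
      ultimately show ?thesis unfolding am using t0(2) by linarith
    qed
  qed
  then show ?thesis by (simp add: ab)
qed

text \<open>Rounding the exponent up keeps it at least \<alpha>, and rounding the dimension down
  keeps the type below the graph.\<close>

definition best_type :: "ereal \<Rightarrow> nat \<Rightarrow> nat \<times> nat" where
  "best_type h m = (if h = \<infinity> then m * m else nat \<lceil>real_of_ereal h * m\<rceil>, nat \<lfloor>real_of_ereal (legendre T h) * m\<rfloor>)"

lemma best_type:
  assumes h: "h \<noteq> -\<infinity>" "0 \<le> legendre T h" and m: "1 \<le> m" "h \<noteq> \<infinity> \<Longrightarrow> real_of_ereal h + 1 \<le> m"
  shows "best_type h m \<in> types T m"
    and "legendre T h = ereal D \<Longrightarrow> D - 1 / m \<le> real (snd (best_type h m)) / m"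
    and "h = ereal h0 \<Longrightarrow> h0 \<le> real (fst (best_type h m)) / m \<and> real (fst (best_type h m)) / m \<le> h0 + 1 / m"
    and "h = \<infinity> \<Longrightarrow> real (fst (best_type h m)) / m = m"
proof -
  have mpos: "0 < real m" using m by simp
  obtain D0 where D0: "legendre T h = ereal D0" "0 \<le> D0" "D0 \<le> 1" using star_real[OF h] by blast
  define b where "b = nat \<lfloor>D0 * m\<rfloor>"
  have sb: "snd (best_type h m) = b" by (simp add: best_type_def b_def D0)
  have b: "real b = real_of_int \<lfloor>D0 * m\<rfloor>" using D0 by (simp add: b_def)
  have b1: "real b \<le> D0 * m" "D0 * m \<le> real b + 1" unfolding b by linarith+
  have b2: "real b / m \<le> D0" "D0 - 1 / m \<le> real b / m"
  proof -
    show "real b / m \<le> D0" using b1(1) by (simp add: pos_divide_le_eq[OF mpos])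
    have "D0 \<le> (real b + 1) / m" using b1(2) by (simp add: pos_le_divide_eq[OF mpos])
    then show "D0 - 1 / m \<le> real b / m" by (simp add: add_divide_distrib)
  qed
  have "D0 * real m \<le> 1 * real m" using D0 by (intro mult_right_mono) auto
  then have bm: "b \<le> m" using b1 by simp
  show "legendre T h = ereal D \<Longrightarrow> D - 1 / m \<le> real (snd (best_type h m)) / m"
    using b2 D0 sb by simp
  have fin: "h0 \<le> real (fst (best_type h m)) / m \<and> real (fst (best_type h m)) / m \<le> h0 + 1 / m \<and> fst (best_type h m) \<le> m * m"
    if hh: "h = ereal h0" for h0
  proof -
    have "0 < h0" using star_ge[OF h] hh alpha by simp
    define a where "a = nat \<lceil>h0 * m\<rceil>"
    have fa: "fst (best_type h m) = a" by (simp add: best_type_def a_def hh)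
    have "0 \<le> h0 * m" using \<open>0 < h0\<close> by simp
    then have a: "real a = real_of_int \<lceil>h0 * m\<rceil>" by (simp add: a_def)
    have a1: "h0 * m \<le> real a" "real a \<le> h0 * m + 1" unfolding a by linarith+
    \<comment> \<open>The rounded exponent is at most h0 m + 1 and must fit into the range a \<le> m
      * m; this is why m \<ge> h0 + 1 is assumed.\<close>
    have "(h0 + 1) * m \<le> real m * m" using m(2) hh by (intro mult_right_mono) auto
    then have "real a \<le> real (m * m)" using a1 m(1) by (simp add: distrib_right)
    then have "a \<le> m * m" by (simp only: of_nat_le_iff)
    moreover have "h0 \<le> real a / m" using a1(1) by (simp add: pos_le_divide_eq[OF mpos])
    moreover have "real a / m \<le> (h0 * m + 1) / m" using a1(2) by (intro divide_right_mono) auto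
    moreover have "(h0 * m + 1) / m = h0 + 1 / m" using mpos by (simp add: add_divide_distrib)
    ultimately show ?thesis unfolding fa by simp
  qed
  show "h = ereal h0 \<Longrightarrow> h0 \<le> real (fst (best_type h m)) / m \<and> real (fst (best_type h m)) / m \<le> h0 + 1 / m"
    using fin by blast
  have inf: "fst (best_type h m) = m * m" if "h = \<infinity>" using that by (simp add: best_type_def)
  then show "h = \<infinity> \<Longrightarrow> real (fst (best_type h m)) / m = m" using mpos by simp
  have "ereal (real b / m) \<le> legendre T h" using b2 D0 by simp
  moreover have "((\<exists>h0. h = ereal h0 \<and> h0 \<le> real (fst (best_type h m)) / m \<and> real (fst (best_type h m)) / m \<le> h0 + 1 / m)
      \<or> h = \<infinity> \<and> fst (best_type h m) = m * m) \<and> fst (best_type h m) \<le> m * m"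
  proof (cases h)
    case (real h0)
    then show ?thesis using fin[OF real] by blast
  next
    case PInf
    then show ?thesis using inf[OF PInf] by simp
  qed (use h(1) in simp)
  ultimately show "best_type h m \<in> types T m"
    using bm h(1) sb unfolding types_def mem_Collect_eq case_prod_beta by blast
qed

text \<open>The second coordinate of a type is nonnegative, so the type comes from some h with T*(h)
  \<ge> 0, hence h \<ge> \<alpha>; the bound \<alpha> \<le> m treats h = \<infinity>.\<close>

lemma types_exponent_ge:
  assumes "\<tau> \<in> types T m" "1 \<le> m" "\<alpha> \<le> m"
  shows "\<alpha> \<le> real (fst \<tau>) / m"
proof -
  obtain a b where ab: "\<tau> = (a, b)" by fastforce
  obtain h where h: "h \<noteq> -\<infinity>" "ereal (b / m) \<le> legendre T h"
    "(\<exists>h0. h = ereal h0 \<and> h0 \<le> a / m \<and> a / m \<le> h0 + 1 / m) \<or> h = \<infinity> \<and> a = m * m"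
    using assms(1) ab unfolding types_def by blast
  have "0 \<le> ereal (b / m)" by simp
  then have "ereal \<alpha> \<le> h" using h(2) by (intro star_ge[OF h(1)]) (rule order_trans)
  with h(3) have "\<alpha> \<le> a / m"
    using assms(2,3) by auto
  then show ?thesis by (simp add: ab)
qed

lemma realization_exists:
  assumes wav: "schwartz_wavelet \<psi>"
  shows "\<exists>len v. realization \<psi> len v \<alpha> T"
proof -
  obtain h1 where h1: "0 < h1" "0 \<le> legendre T (ereal h1)" using exists_finite_exponent by blast
  \<comment> \<open>The resolution must let all types fit, contain the default exponent h1, and
    exceed \<alpha> so that the uniform decay also holds for the infinite exponent.\<close>
  define good where "good m \<longleftrightarrow> 8 * ((m * m + 1) * (m + 1)) \<le> 2 ^ m \<and> 2 \<le> m \<and> max (h1 + 1) \<alpha> \<le> real m" for m :: nat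
  have "\<forall>\<^sub>F m in sequentially. max (h1 + 1) \<alpha> \<le> real m"
    using filterlim_real_sequentially unfolding filterlim_at_top by blast
  then have "\<forall>\<^sub>F m in sequentially. good m"
    unfolding good_def by (intro eventually_conj many_digits_room eventually_ge_at_top)
  then have "\<forall>\<^sub>F l in sequentially. good (root_floor l)"
    using root_floor_at_top unfolding filterlim_iff by blast
  then obtain i1 where i1: "\<And>l. l \<ge> i1 \<Longrightarrow> good (root_floor l)" unfolding eventually_sequentially by blast
  \<comment> \<open>Starting with longer stages makes every stage good from the beginning.\<close>
  define i0 where "i0 = max i1 3"
  define len where "len i = i + i0" for i
  define R where "R i = root_floor (len i)" for i
  have good: "good (R i)" for i unfolding R_def len_def i0_def by (intro i1) simp
  have R: "8 * ((R i * R i + 1) * (R i + 1)) \<le> 2 ^ R i" "2 \<le> R i" "1 \<le> R i" "h1 + 1 \<le> real (R i)" "\<alpha> \<le> real (R i)" for i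
    using good[of i] by (auto simp: good_def)
  have RR: "R i * R i \<le> len i" for i unfolding R_def by (rule root_floor_square)
  have Rratio: "real (R i) \<le> real (len i) / R i" for i
  proof -
    have "real (R i * R i) \<le> real (len i)" using RR by (simp only: of_nat_le_iff)
    then show ?thesis using R(3)[of i] by (simp add: pos_le_divide_eq)
  qed
  have "filterlim len at_top sequentially"
    unfolding len_def by (rule filterlim_add_const_nat_at_top)
  then have "filterlim R at_top sequentially"
    unfolding R_def by (rule filterlim_compose[OF root_floor_at_top])
  then have "filterlim (\<lambda>i. real (R i)) at_top sequentially"
    by (rule filterlim_compose[OF filterlim_real_sequentially])
  then have Rinf: "\<forall>\<^sub>F i in sequentially. X \<le> real (R i)" for X
    unfolding filterlim_at_top by blast
  define Q where "Q i v dig \<longleftrightarrow>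
     (\<forall>c::int. 0 \<le> v c \<and> (0 < v c \<longrightarrow> 4 \<le> c \<and> c \<le> 2 ^ len i - 4 \<and> 4 dvd c \<and> (\<exists>\<tau>\<in>types T (R i). v c = type_weight (len i) \<tau>))) \<and>
     (\<forall>\<tau>\<in>types T (R i). card (dig \<tau>) = type_count (len i) \<tau> \<and> (\<forall>c\<in>dig \<tau>. v c = type_weight (len i) \<tau>)) \<and>
     (\<forall>q. (\<Sum>c\<in>{0..<2 ^ len i}. v c powr q) = (\<Sum>\<tau>\<in>types T (R i). type_count (len i) \<tau> * type_weight (len i) \<tau> powr q))"
    for i and v :: "int \<Rightarrow> real" and dig :: "nat \<times> nat \<Rightarrow> int set"
  have "\<exists>v dig. Q i v dig" for i
    unfolding Q_def
  proof (rule digit_system[OF finite_types])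
    show "0 < type_weight (len i) \<tau>" for \<tau> by (simp add: type_weight_def)
    show "4 * (\<Sum>\<tau>\<in>types T (R i). type_count (len i) \<tau>) + 4 \<le> 2 ^ len i"
      unfolding R_def by (rule types_size) (use R[of i] in \<open>auto simp: R_def\<close>)
  qed
  then obtain v dg where Q: "\<And>i. Q i (v i) (dg i)" by metis
  have v0: "0 \<le> v i c" for i c using Q[of i] unfolding Q_def by blast
  have vpos: "4 \<le> c \<and> c \<le> 2 ^ len i - 4 \<and> 4 dvd c" "\<exists>\<tau>\<in>types T (R i). v i c = type_weight (len i) \<tau>" if "0 < v i c" for i c
    using Q[of i] that unfolding Q_def by blast+
  have dg: "card (dg i \<tau>) = type_count (len i) \<tau>" "c \<in> dg i \<tau> \<Longrightarrow> v i c = type_weight (len i) \<tau>"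
    if "\<tau> \<in> types T (R i)" for i \<tau> c
    using Q[of i] that unfolding Q_def by blast+
  have sums: "(\<Sum>c\<in>{0..<2 ^ len i}. v i c powr q) = (\<Sum>\<tau>\<in>types T (R i). type_count (len i) \<tau> * type_weight (len i) \<tau> powr q)" for i q
    using Q[of i] unfolding Q_def by blast
  have wpos: "0 < type_weight l \<tau>" for l \<tau> by (simp add: type_weight_def)
  have dgne: "dg i \<tau> \<noteq> {}" if "\<tau> \<in> types T (R i)" for i \<tau>
  proof -
    have "0 < card (dg i \<tau>)" unfolding dg(1)[OF that] by (simp add: type_count_def)
    then show ?thesis by auto
  qed
  have ty1: "best_type (ereal h1) (R i) \<in> types T (R i)" for i
    using R[of i] h1(2) by (intro best_type(1)) auto
  have cas: "cascade len v \<alpha>"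
  proof
    show "3 \<le> len i" for i by (simp add: len_def i0_def)
    show "0 \<le> v i c" for i c by (rule v0)
    show "4 \<le> c \<and> c \<le> 2 ^ len i - 4 \<and> 4 dvd c" if "0 < v i c" for i c by (rule vpos(1)[OF that])
    show "0 < \<alpha>" by (rule alpha)
    show "v i c \<le> 2 powr (- (\<alpha> * real (len i)))" for i c
    proof (cases "0 < v i c")
      case True
      then obtain \<tau> where \<tau>: "\<tau> \<in> types T (R i)" "v i c = type_weight (len i) \<tau>" using vpos(2) by blast
      have "\<alpha> \<le> real (fst \<tau>) / R i" using \<tau>(1) R by (intro types_exponent_ge) auto
      then have "\<alpha> * real (len i) \<le> real (len i) * (real (fst \<tau>) / R i)"
        by (simp only: mult.commute[of \<alpha>]) (intro mult_left_mono, auto)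
      then show ?thesis unfolding \<tau>(2) type_weight_def R_def by (intro powr_mono) auto
    next
      case False
      then have "v i c \<le> 0" by simp
      also have "0 \<le> 2 powr (- (\<alpha> * real (len i)))" by simp
      finally show ?thesis .
    qed
    show "\<exists>c. 0 < v i c" for i
    proof -
      obtain c where "c \<in> dg i (best_type (ereal h1) (R i))" using dgne[OF ty1] by blast
      then have "0 < v i c" using dg(2)[OF ty1] wpos by simp
      then show ?thesis by blast
    qed
    show "(\<lambda>i. real (len i) / real (\<Sum>j<i. len j)) \<longlonglongrightarrow> 0"
      unfolding len_def by (rule growth_linear)
  qed
  have upper: "\<forall>\<^sub>F i in sequentially. cascade.Z len v i q \<le> 2 powr (- (real (len i) * \<tau>))"
    if q: "q \<in> edom T" "ereal \<tau> < T q" for q \<tau>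
  proof -
    obtain t where t: "T q = ereal t" using T_real[OF q(1)] by blast
    obtain t0 where t0: "T 0 = ereal t0" using T_real[OF dom_nonneg[OF order_refl]] by blast
    have \<delta>: "0 < t - \<tau>" using q(2) t by simp
    \<comment> \<open>The first threshold absorbs the rounding error and the number of types into t
      - \<tau>; the second makes types of infinite exponent harmless when q > 0.\<close>
    show ?thesis
      using Rinf[of "(1 + \<bar>q\<bar>) / (t - \<tau>)"] Rinf[of "(t - t0) / q"]
    proof eventually_elim
      case (elim i)
      define m where "m = R i"
      define l where "l = len i"
      have m1: "1 \<le> m" "0 < real m" using R(3)[of i] by (auto simp: m_def)
      have each: "real (type_count l \<sigma>) * type_weight l \<sigma> powr q \<le> 2 powr (real l * (\<bar>q\<bar> / m - t))"
        if \<sigma>: "\<sigma> \<in> types T m" for \<sigma>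
      proof -
        have "real (snd \<sigma>) / m - q * (real (fst \<sigma>) / m) \<le> \<bar>q\<bar> / m - t"
        proof (rule type_slope_le[OF \<sigma> m1(1) q(1) t])
          assume "0 < q"
          then show "T 0 = ereal t0 \<and> t - t0 \<le> q * m"
            using t0 elim(2) by (simp add: m_def field_simps)
        qed
        then have le: "real l * (real (snd \<sigma>) / m - q * (real (fst \<sigma>) / m)) \<le> real l * (\<bar>q\<bar> / m - t)"
          by (intro mult_left_mono) auto
        have "type_weight l \<sigma> powr q = 2 powr (- (real l * (real (fst \<sigma>) / m)) * q)"
          by (simp only: type_weight_def powr_powr m_def R_def l_def)
        moreover have "real (type_count l \<sigma>) \<le> 2 powr (real l * (real (snd \<sigma>) / m))"
          using type_count_le(2)[of \<sigma> T l] \<sigma> m1 by (simp add: m_def R_def l_def)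
        ultimately have "real (type_count l \<sigma>) * type_weight l \<sigma> powr q
            \<le> 2 powr (real l * (real (snd \<sigma>) / m)) * 2 powr (- (real l * (real (fst \<sigma>) / m)) * q)"
          by (simp only:) (intro mult_right_mono, auto)
        also have "\<dots> = 2 powr (real l * (real (snd \<sigma>) / m - q * (real (fst \<sigma>) / m)))"
          by (simp only: powr_add[symmetric] right_diff_distrib) (simp add: mult_ac)
        also have "\<dots> \<le> 2 powr (real l * (\<bar>q\<bar> / m - t))" using le by (intro powr_mono) auto
        finally show ?thesis .
      qed
      have "cascade.Z len v i q = (\<Sum>\<sigma>\<in>types T m. real (type_count l \<sigma>) * type_weight l \<sigma> powr q)"
        unfolding cascade.Z_def[OF cas] sums m_def l_def ..
      also have "\<dots> \<le> (\<Sum>\<sigma>\<in>types T m. 2 powr (real l * (\<bar>q\<bar> / m - t)))"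
        by (rule sum_mono) (rule each)
      also have "\<dots> = real (card (types T m)) * 2 powr (real l * (\<bar>q\<bar> / m - t))" by simp
      also have "\<dots> \<le> 2 powr real m * 2 powr (real l * (\<bar>q\<bar> / m - t))"
      proof (rule mult_right_mono)
        have "card (types T m) \<le> (m * m + 1) * (m + 1)" by (rule card_types)
        also have "\<dots> \<le> 8 * ((m * m + 1) * (m + 1))" by simp
        also have "\<dots> \<le> 2 ^ m" using R(1)[of i] by (simp only: m_def)
        finally have "real (card (types T m)) \<le> real (2 ^ m)" by (simp only: of_nat_le_iff)
        then show "real (card (types T m)) \<le> 2 powr real m" by (simp add: powr_realpow)
      qed simp
      also have "\<dots> = 2 powr (real m + real l * (\<bar>q\<bar> / m - t))" by (simp only: powr_add)
      also have "\<dots> \<le> 2 powr (- (real l * \<tau>))"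
      proof (rule powr_mono)
        have "(1 + \<bar>q\<bar>) / m \<le> t - \<tau>"
          using elim(1) \<delta> m1 by (simp add: m_def field_simps)
        then have "real l * ((1 + \<bar>q\<bar>) / m) \<le> real l * (t - \<tau>)" by (intro mult_left_mono) auto
        moreover have "real l * ((1 + \<bar>q\<bar>) / m) = real l / m + real l * (\<bar>q\<bar> / m)"
          by (simp add: add_divide_distrib distrib_left)
        moreover have "real m \<le> real l / m" using Rratio[of i] by (simp only: m_def l_def)
        ultimately show "real m + real l * (\<bar>q\<bar> / m - t) \<le> - (real l * \<tau>)"
          by (simp add: right_diff_distrib)
      qed simp
      finally show ?case by (simp only: l_def)
    qed
  qed
  have digs: "\<exists>A. (\<forall>i. A i \<noteq> {}) \<and> (\<forall>i. \<forall>c\<in>A i. 0 < v i c) \<and>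
        (\<forall>r::real. ereal r < h \<longrightarrow> (\<forall>\<^sub>F i in sequentially. \<forall>c\<in>A i. v i c \<le> 2 powr (- (len i * r)))) \<and>
        (\<forall>r::real. h < ereal r \<longrightarrow> (\<forall>\<^sub>F i in sequentially. \<forall>c\<in>A i. 2 powr (- (len i * r)) \<le> v i c)) \<and>
        (\<forall>s::real. ereal s < legendre T h \<longrightarrow> (\<forall>\<^sub>F i in sequentially. 2 powr (len i * s) \<le> card (A i)))"
    if hpos: "h > 0" and leg: "legendre T h \<ge> 0" for h
  proof -
    have h: "h \<noteq> -\<infinity>" using hpos by auto
    obtain D where D: "legendre T h = ereal D" using star_real[OF h leg] by blast
    \<comment> \<open>While the resolution is too coarse for h the default type stands in; only late
      stages matter for the asymptotics.\<close>
    define \<tau> where "\<tau> i = (if best_type h (R i) \<in> types T (R i) then best_type h (R i) else best_type (ereal h1) (R i))" for i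
    have \<tau>: "\<tau> i \<in> types T (R i)" for i using ty1 by (simp add: \<tau>_def)
    define A where "A i = dg i (\<tau> i)" for i
    have big: "\<forall>\<^sub>F i in sequentially. real_of_ereal h + 1 \<le> real (R i)" by (rule Rinf)
    have vA: "v i c = 2 powr (- (real (len i) * (real (fst (\<tau> i)) / R i)))" if "c \<in> A i" for i c
      using dg(2)[OF \<tau>] that unfolding A_def type_weight_def R_def by blast
    have sel: "\<tau> i = best_type h (R i)" if "real_of_ereal h + 1 \<le> real (R i)" for i
      using best_type(1)[OF h leg R(3)[of i]] that by (simp add: \<tau>_def)
    have "\<forall>i. A i \<noteq> {}" unfolding A_def using dgne \<tau> by blast
    moreover have "\<forall>i. \<forall>c\<in>A i. 0 < v i c" using vA by simp
    moreover have "\<forall>\<^sub>F i in sequentially. \<forall>c\<in>A i. v i c \<le> 2 powr (- (len i * r))" if r: "ereal r < h" for r :: real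
      using big Rinf[of r]
    proof eventually_elim
      case (elim i)
      have "r \<le> real (fst (\<tau> i)) / R i"
      proof (cases h)
        case (real h0)
        then show ?thesis using best_type(3)[OF h leg R(3)[of i] _ real] elim(1) sel[OF elim(1)] r by force
      next
        case PInf
        then show ?thesis using best_type(4)[OF h leg R(3)[of i] _ PInf] elim sel[OF elim(1)] by simp
      qed (use h in simp)
      then have "real (len i) * r \<le> real (len i) * (real (fst (\<tau> i)) / R i)" by (intro mult_left_mono) auto
      then show ?case using vA by (auto intro!: powr_mono)
    qed
    moreover have "\<forall>\<^sub>F i in sequentially. \<forall>c\<in>A i. 2 powr (- (len i * r)) \<le> v i c" if r: "h < ereal r" for r :: real
    proof -
      obtain h0 where h0: "h = ereal h0" using h r by (cases h) auto
      have rh: "0 < r - h0" using r h0 by simp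
      show ?thesis
        using big Rinf[of "1 / (r - h0)"]
      proof eventually_elim
        case (elim i)
        have "real (fst (\<tau> i)) / R i \<le> h0 + 1 / R i"
          using best_type(3)[OF h leg R(3)[of i] _ h0] elim(1) sel[OF elim(1)] by simp
        moreover have "1 / R i \<le> r - h0" using elim(2) rh R(3)[of i] by (simp add: field_simps)
        ultimately have "real (fst (\<tau> i)) / R i \<le> r" by linarith
        then have "real (len i) * (real (fst (\<tau> i)) / R i) \<le> real (len i) * r" by (intro mult_left_mono) auto
        then show ?case using vA by (auto intro!: powr_mono)
      qed
    qed
    moreover have "\<forall>\<^sub>F i in sequentially. 2 powr (len i * s) \<le> card (A i)" if s: "ereal s < legendre T h" for s :: real
    proof -
      have sD: "0 < D - s" using s D by simp
      \<comment> \<open>Of the 3 / m, one part is the rounding of the dimension and two parts are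
        the loss in \<open>type_count\<close>.\<close>
      show ?thesis
        using big Rinf[of "3 / (D - s)"]
      proof eventually_elim
        case (elim i)
        have "D - 1 / R i \<le> real (snd (\<tau> i)) / R i"
          using best_type(2)[OF h leg R(3)[of i] _ D] elim(1) sel[OF elim(1)] by simp
        moreover have "3 / R i \<le> D - s" using elim(2) sD R(3)[of i] by (simp add: field_simps)
        ultimately have "s + 2 / R i \<le> real (snd (\<tau> i)) / R i" by (simp add: field_simps)
        then have "real (len i) * (s + 2 / R i) \<le> real (len i) * (real (snd (\<tau> i)) / R i)" by (intro mult_left_mono) auto
        then have "real (len i) * s \<le> real (len i) * (real (snd (\<tau> i)) / R i) - 2 * (real (len i) / R i)"
          by (simp add: distrib_left)
        then have "2 powr (len i * s) \<le> 2 powr (real (len i) * (real (snd (\<tau> i)) / R i) - 2 * (real (len i) / R i))"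
          by (intro powr_mono) auto
        also have "\<dots> \<le> real (type_count (len i) (\<tau> i))"
          unfolding R_def by (rule type_count_ge) (use R(3)[of i] in \<open>simp add: R_def\<close>)
        also have "\<dots> = card (A i)" unfolding A_def dg(1)[OF \<tau>] ..
        finally show ?case .
      qed
    qed
    ultimately show ?thesis by (intro exI[of _ A]) blast
  qed
  have wc: "wavelet_cascade \<psi> len v \<alpha>" by (intro wavelet_cascade.intro wav cas)
  have "realization \<psi> len v \<alpha> T"
  proof (rule realization.intro[OF wc], rule realization_axioms.intro)
    show "T q \<noteq> \<infinity>" for q by (rule noinf)
    show "edom T = UNIV \<or> edom T = {0..}" by (rule dom)
    show "0 \<le> legendre T h" if "h \<noteq> -\<infinity>" "-\<infinity> < legendre T h" for h using that by (rule star)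
    show "0 < h" if "0 \<le> legendre T h" "h \<noteq> -\<infinity>" for h
    proof -
      have "0 < ereal \<alpha>" using alpha by simp
      also have "ereal \<alpha> \<le> h" by (rule star_ge[OF that(2,1)])
      finally show ?thesis .
    qed
    show "\<exists>h. legendre T (ereal h) = ereal (h * q) - T q" if "q \<in> edom T" "edom T = UNIV \<or> 0 < q" for q
      using that by (rule exists_supergradient)
  qed (fact upper, fact digs)
  then show ?thesis by (intro exI)
qed

end

theorem theorem1p12:
  fixes \<psi> :: "real \<Rightarrow> real" and T :: "real \<Rightarrow> ereal"
  assumes wavelet: "schwartz \<psi>" "orthonormal_wavelet \<psi>"
    and noinf: "\<forall>q. T q \<noteq> \<infinity>"
    and nondecr: "mono T"
    and concave: "convex (edom T)" "concave_on (edom T) (\<lambda>q. real_of_ereal (T q))"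
    and i: "\<exists>\<alpha>>0. \<exists>c\<in>{0..1}. \<forall>q\<ge>0. T q \<ge> ereal (\<alpha> * q - c)"
    and ii: "edom T = UNIV \<or> edom T = {0..}"
      "\<forall>h. h \<noteq> -\<infinity> \<and> legendre T h > -\<infinity> \<longrightarrow> legendre T h \<ge> 0"
    and iii: "Inf {q. q \<ge> 0 \<and> T q > 0} > 0 \<or>
      (\<exists>d>0. ((\<lambda>q. real_of_ereal (T q)) has_real_derivative d) (at_right 0) \<and>
             (\<forall>q>0. T q = ereal (d * q)))"
  shows "\<exists>F :: real \<Rightarrow> real. bounded (range F) \<and> hoelder_continuous F \<and>
           homogeneously_multifractal \<psi> F \<and> wsupp \<psi> F \<subseteq> {0..1} \<and>
           (\<forall>q. scaling_fun \<psi> F q = T q) \<and>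
           (\<forall>h::ereal. h \<ge> 0 \<longrightarrow> dimH (iso_set \<psi> F h) = legendre (scaling_fun \<psi> F) h)"
proof -
  obtain \<alpha> c where "\<alpha> > 0" "c \<in> {0..1}" "\<forall>q\<ge>0. T q \<ge> ereal (\<alpha> * q - c)" using i by blast
  then have "scaling_target T \<alpha> c"
    using noinf concave(2) ii by (intro scaling_target.intro) auto
  moreover have "schwartz_wavelet \<psi>" using wavelet by (rule schwartz_wavelet.intro)
  ultimately obtain len v where "realization \<psi> len v \<alpha> T"
    using scaling_target.realization_exists by blast
  then show ?thesis
    by (intro exI[of _ "wavelet_cascade.F \<psi> len v"]) (rule realization.realizes)
qed

end
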